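(* Let $h\ge 1$ be an integer such that $2h+1$ is prime, $2h+1\neq 3$ and $2h+1\neq 7$. Put $N=\frac{2^{2h}-1}{3(2h+1)}$. Then the number of isomorphism classes of proper Mathon arcs of degree $8$ in $\mathrm{PG}(2,2^{2h+1})$ is exactly $$\frac{N}{14}\,(2^{2h-2}-1)\,\bigl((6h+3)N-1\bigr).$$
   Context: Let $q$ be a power of $2$ and $\mathrm{Tr}:\mathrm{GF}(q)\to\mathrm{GF}(2)$ the absolute trace. A maximal arc of degree $d$ in $\mathrm{PG}(2,q)$ is a non-empty proper set of points meeting every line in $0$ or $d$ points; the trivial cases (a single point, or an affine plane $d=q$) are excluded. For $\alpha,\beta,\lambda\in\mathrm{GF}(q)$ with $\mathrm{Tr}(\alpha\beta)=1$ let $F_{\alpha,\beta,\lambda}=\{(x,y,z):\alpha x^2+xy+\beta y^2+\lambda z^2=0\}$. For $\lambda\ne0$ this is a non-degenerate conic with nucleus $F_0=(0,0,1)$, and the line $z=0$ is external to it. For $\lambda\ne\lambda'$ define $F_{\alpha,\beta,\lambda}\oplus F_{\alpha',\beta',\lambda'}=F_{\alpha'',\beta'',\lambda''}$ with $\alpha''=\frac{\alpha\lambda+\alpha'\lambda'}{\lambda+\lambda'}$, $\beta''=\frac{\beta\lambda+\beta'\lambda'}{\lambda+\lambda'}$, $\lambda''=\lambda+\lambda'$. A set $\mathcal C$ of such conics ($\lambda\neq0$, distinct members having distinct $\lambda$) is closed if the composition of any two distinct members is again a member of $\mathcal C$ (in particular the parameters of the composition satisfy the trace condition). For closed $\mathcal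 C$ the union of the conics of $\mathcal C$ together with $F_0$ is a maximal arc of degree $|\mathcal C|+1$; a maximal arc which, after a change of coordinates of the plane, arises in this way from a non-empty closed set is called of Mathon type (a Mathon arc). If $\mathrm{Tr}(\alpha)=1$ and $A\subset\mathrm{GF}(q)$ is an additive subgroup, the set $\{F_{\alpha,1,\lambda}:\lambda\in A\setminus\{0\}\}$ is closed; a maximal arc arising (up to change of coordinates) from such a set is of Denniston type. A proper Mathon arc is a maximal arc of Mathon type that is not of Denniston type. Two maximal arcs are isomorphic if some element of $\mathrm{P\Gamma L}(3,q)$ maps one onto the other. *)

theory Defs
  imports "HOL-Analysis.Analysis" "HOL-Computational_Algebra.Primes"
begin

text \<open>
  The plane \<open>PG(2,q)\<close> over a finite field \<open>'a\<close> with \<open>q = CARD('a)\<close>: points and lines are the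
  subspaces of \<open>'a ^ 3\<close> of vector space dimension 1 and 2, and incidence is inclusion.
  A point is thus a set of vectors which contains the zero vector.
\<close>

type_synonym 'a point = "('a, 3) vec set"
type_synonym 'a line = "('a, 3) vec set"

definition points :: "'a::{field,finite} point set" where
  "points = {P. vec.subspace P \<and> vec.dim P = 1}"

definition lines :: "'a::{field,finite} line set" where
  "lines = {L. vec.subspace L \<and> vec.dim L = 2}"

text \<open>
  The projective groups, as maps on sets of vectors. For \<open>\<sigma>\<close> bijective, additive and
  multiplicative, \<open>\<sigma> 0 = 0\<close> and \<open>\<sigma> 1 = 1\<close> are automatic.
\<close>

definition field_automorphism :: "('a::field \<Rightarrow> 'a) \<Rightarrow> bool" where
  "field_automorphism \<sigma> \<longleftrightarrow>
     bij \<sigma> \<and> (\<forall>x y. \<sigma> (x + y) = \<sigma> x + \<sigma> y) \<and> (\<forall>x y. \<sigma> (x * y) = \<sigma> x * \<sigma> y)"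

definition semilinear :: "('a::field \<Rightarrow> 'a) \<Rightarrow> ('a ^ 3 \<Rightarrow> 'a ^ 3) \<Rightarrow> bool" where
  "semilinear \<sigma> f \<longleftrightarrow>
     (\<forall>u v. f (u + v) = f u + f v) \<and> (\<forall>c v. f (c *s v) = \<sigma> c *s f v)"

definition PGL3 :: "('a::{field,finite} point \<Rightarrow> 'a point) set" where
  "PGL3 = {(`) f | f. Vector_Spaces.linear (*s) (*s) f \<and> bij f}"

definition PGammaL3 :: "('a::{field,finite} point \<Rightarrow> 'a point) set" where
  "PGammaL3 = {(`) f | f. \<exists>\<sigma>. field_automorphism \<sigma> \<and> semilinear \<sigma> f \<and> bij f}"

definition maximal_arc :: "nat \<Rightarrow> 'a::{field,finite} point set \<Rightarrow> bool" where
  "maximal_arc d K \<longleftrightarrow>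
     K \<subseteq> points \<and> K \<noteq> {} \<and> K \<noteq> points \<and>
     (\<forall>L\<in>lines. card {P \<in> K. P \<subseteq> L} \<in> {0, d}) \<and>
     d \<noteq> 1 \<and> d \<noteq> CARD('a)"

text \<open>
  The absolute trace of a field with \<open>2 ^ m\<close> elements; its values are the elements \<open>0\<close> and \<open>1\<close>
  of the prime field, regarded as elements of \<open>'a\<close>.
\<close>

definition abs_trace :: "'a::{field,finite} \<Rightarrow> 'a" where
  "abs_trace x = (\<Sum>i<(THE m. CARD('a) = 2 ^ m). x ^ (2 ^ i))"

text \<open>
  The conic \<open>F\<^bsub>\<alpha>,\<beta>,\<lambda>\<^esub>\<close> is represented by its triple of parameters
  (with \<open>\<mu>\<close> for the reserved symbol \<open>\<lambda>\<close>), since the composition is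
  defined in terms of these. An admissible triple (see below) is determined by its point set.
\<close>

type_synonym 'a conic_param = "'a \<times> 'a \<times> 'a"

fun conic_points :: "'a::{field,finite} conic_param \<Rightarrow> 'a point set" where
  "conic_points (\<alpha>, \<beta>, \<mu>) =
     {P \<in> points. \<forall>v\<in>P. \<alpha> * (v $ 1)\<^sup>2 + v $ 1 * v $ 2 + \<beta> * (v $ 2)\<^sup>2 + \<mu> * (v $ 3)\<^sup>2 = 0}"

fun admissible :: "'a::{field,finite} conic_param \<Rightarrow> bool" where
  "admissible (\<alpha>, \<beta>, \<mu>) \<longleftrightarrow> abs_trace (\<alpha> * \<beta>) = 1 \<and> \<mu> \<noteq> 0"

fun conic_mu :: "'a conic_param \<Rightarrow> 'a" where
  "conic_mu (\<alpha>, \<beta>, \<mu>) = \<mu>"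

fun conic_comp :: "'a::field conic_param \<Rightarrow> 'a conic_param \<Rightarrow> 'a conic_param" (infixl "\<oplus>" 65) where
  "(\<alpha>, \<beta>, \<mu>) \<oplus> (\<alpha>', \<beta>', \<mu>') =
     ((\<alpha> * \<mu> + \<alpha>' * \<mu>') / (\<mu> + \<mu>'), (\<beta> * \<mu> + \<beta>' * \<mu>') / (\<mu> + \<mu>'), \<mu> + \<mu>')"

definition closed_conics :: "'a::{field,finite} conic_param set \<Rightarrow> bool" where
  "closed_conics C \<longleftrightarrow>
     (\<forall>c\<in>C. admissible c) \<and> inj_on conic_mu C \<and>
     (\<forall>c\<in>C. \<forall>c'\<in>C. c \<noteq> c' \<longrightarrow> c \<oplus> c' \<in> C)"

definition F0 :: "'a::{field,finite} point" where
  "F0 = vec.span {vector [0, 0, 1]}"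

definition conics_union :: "'a::{field,finite} conic_param set \<Rightarrow> 'a point set" where
  "conics_union C = insert F0 (\<Union>c\<in>C. conic_points c)"

definition Mathon_type :: "'a::{field,finite} point set \<Rightarrow> bool" where
  "Mathon_type K \<longleftrightarrow>
     (\<exists>d. maximal_arc d K) \<and>
     (\<exists>C. C \<noteq> {} \<and> closed_conics C \<and> (\<exists>g\<in>PGL3. K = g ` conics_union C))"

definition additive_subgroup :: "'a::ab_group_add set \<Rightarrow> bool" where
  "additive_subgroup A \<longleftrightarrow> 0 \<in> A \<and> (\<forall>x\<in>A. \<forall>y\<in>A. x + y \<in> A) \<and> (\<forall>x\<in>A. - x \<in> A)"

definition Denniston_type :: "'a::{field,finite} point set \<Rightarrow> bool" where
  "Denniston_type K \<longleftrightarrow>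
     (\<exists>d. maximal_arc d K) \<and>
     (\<exists>\<alpha> A. abs_trace \<alpha> = 1 \<and> additive_subgroup A \<and>
        (\<exists>g\<in>PGL3. K = g ` conics_union {(\<alpha>, 1, \<mu>) | \<mu>. \<mu> \<in> A - {0}}))"

definition proper_Mathon_arcs :: "nat \<Rightarrow> 'a::{field,finite} point set set" where
  "proper_Mathon_arcs d = {K. maximal_arc d K \<and> Mathon_type K \<and> \<not> Denniston_type K}"

definition isomorphic :: "('a::{field,finite} point set \<times> 'a point set) set" where
  "isomorphic = {(K, K'). \<exists>g\<in>PGammaL3. g ` K = K'}"

definition iso_classes :: "'a::{field,finite} point set set \<Rightarrow> 'a point set set set" where
  "iso_classes S = S // (isomorphic \<inter> S \<times> S)"

end

theory Submission imports Defs "HOL-Computational_Algebra.Polynomial"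
begin

text \<open>
  Write \<open>q = 2 ^ m\<close> with \<open>m = 2 h + 1\<close>. The parameters \<open>\<mu>\<close> of a closed set of seven conics,
  together with 0, form a group \<open>A\<close> of order 8 on which \<open>\<mu> \<alpha>(\<mu>)\<close> and \<open>\<mu> \<beta>(\<mu>)\<close> are
  additive, so \<open>\<alpha>\<close> and \<open>\<beta>\<close> are combinations of \<open>1\<close>, \<open>\<mu>\<close> and \<open>\<mu>\<^sup>3\<close>. Unless the arc is of Denniston
  type, a coordinate change fixing \<open>F0\<close> leads to \<open>\<alpha> = 1 + \<mu>\<^sup>3 + c \<mu>\<close> and \<open>\<beta> = 1\<close>, where \<open>c\<close> can
  be changed at will by a further one. Such a family is admissible for some \<open>c\<close> if and only if
  \<open>Tr(\<mu>\<^sup>3)\<close> is additive on \<open>A\<close>, i.e. \<open>A\<close> is totally isotropic for the bilinear form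
  \<open>Tr(x\<^sup>2 y + x y\<^sup>2)\<close>, whose radical is \<open>{0, 1}\<close>.

  Since \<open>q + 1 > 7 * 4 + 1\<close>, Bezout's theorem shows that the arc contains no conics besides its seven
  defining ones. Comparing coefficients, two normal forms are projectively equivalent only if their
  groups coincide. So the isomorphism classes correspond to the orbits of the Galois group on the
  isotropic groups of order 8; the Galois group has prime order \<open>m\<close> and acts freely, as \<open>m\<close> is
  neither 3 nor 7.
\<close>

section \<open>Finite fields of characteristic two\<close>

text \<open>Oddness of m means that 3 does not divide q - 1, so cubing permutes the field. Three
  steps rest on this: the radical is no larger than {0, 1}; the coefficient of \<mu>^3 can be scaled
  to 1; and once it is 1, the equation s^3 = 1 leaves no scalar by which a group could still be
  stretched, so that groups, and not groups up to scalars, are the invariants. An arc is a set of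
  points in which nothing records the conics it was built from. The Bezout argument recovers the
  conics, and with them the parameters that are compared. To make linear substitutions a matter of
  computation, arcs are replaced by the cones of vectors above them. The count runs over ordered
  bases of the isotropic groups. With q = 8 K there are (8 K - 2) (4 K - 4) (2 K - 1) of them, and
  168 for each group. Since (6 h + 3) N = q / 2 - 1, the formula of the theorem is this number
  divided by 168 m.\<close>

lemma power_CARD_eq_self:
  fixes x :: "'a::{field,finite}"
  shows "x ^ CARD('a) = x"
proof (cases "x = 0")
  case False
  have "x * (\<Prod>y\<in>UNIV-{0}. x * y) = x * x ^ (CARD('a) - 1) * \<Prod>(UNIV-{0})"
    by (simp add: prod.distrib mult_ac)
  also have "x * x ^ (CARD('a) - 1) = x ^ Suc (CARD('a) - 1)"
    by (subst power_Suc) auto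
  also have "Suc (CARD('a) - 1) = CARD('a)"
    using finite_UNIV_card_ge_0[where ?'a = 'a] by simp
  also have "(\<Prod>y\<in>UNIV-{0}. x * y) = (\<Prod>y\<in>UNIV-{0}. y)"
    by (rule prod.reindex_bij_witness[of _ "\<lambda>y. y / x" "\<lambda>y. x * y"]) (use False in auto)
  finally show ?thesis
    by simp
qed (use finite_UNIV_card_ge_0[where ?'a = 'a] in auto)

text \<open>Translation by 1 permutes the field, so adding q times 1 does not change the sum of all
  elements; hence 2^m vanishes in the field.\<close>

lemma two_eq_zero_if_CARD:
  assumes "CARD('a::{field,finite}) = 2 ^ m"
  shows "(2::'a) = 0"
proof -
  have "(\<Sum>x\<in>UNIV. x) = (\<Sum>x\<in>UNIV. x + (1::'a))"
    by (rule sum.reindex_bij_witness[of _ "\<lambda>x. x + 1" "\<lambda>x. x - 1"]) auto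
  hence "of_nat (CARD('a)) = (0::'a)"
    by (simp add: sum.distrib)
  thus ?thesis using assms by simp
qed

locale char_two_field =
  fixes ty :: "'a::{field,finite} itself" and m :: nat
  assumes CARD_eq: "CARD('a) = 2 ^ m" and odd_m: "odd m"
begin

lemma two_eq_0 [simp]: "(2::'a) = 0"
  by (rule two_eq_zero_if_CARD[OF CARD_eq])

lemma add_self [simp]: "(x::'a) + x = 0"
  by (metis mult_2 mult_zero_left two_eq_0)

lemma add_self_left [simp]: "(x::'a) + (x + y) = y"
  by (simp add: add.assoc[symmetric])

lemma uminus_eq [simp]: "- (x::'a) = x"
  by (metis add_self minus_unique)

lemma minus_eq_plus [simp]: "(x::'a) - y = x + y"
  by (metis diff_conv_add_uminus uminus_eq)

lemma add_eq_0_iff_eq: "(x::'a) + y = 0 \<longleftrightarrow> x = y"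
  by (metis add_self add_left_cancel)

lemma sum_sq: "((x::'a) + y)\<^sup>2 = x\<^sup>2 + y\<^sup>2"
  by (simp add: power2_sum)

lemma sum_pow2: "((x::'a) + y) ^ (2 ^ i) = x ^ (2 ^ i) + y ^ (2 ^ i)"
  by (induction i) (simp_all add: power_mult sum_sq mult.commute[of 2])

lemma pow_card [simp]: "(x::'a) ^ (2 ^ m) = x"
  using power_CARD_eq_self[of x] by (simp add: CARD_eq)

lemma sq_eq_iff: "(x::'a)\<^sup>2 = y\<^sup>2 \<longleftrightarrow> x = y"
  by (metis add_eq_0_iff_eq sum_sq power_eq_0_iff zero_neq_numeral)

lemma ex_sqrt: "\<exists>s. s\<^sup>2 = (x::'a)"
proof -
  have "inj (\<lambda>x::'a. x\<^sup>2)" by (simp add: inj_def sq_eq_iff)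
  hence "surj (\<lambda>x::'a. x\<^sup>2)" by (simp add: finite_UNIV_inj_surj)
  thus ?thesis by (metis surjD)
qed

text \<open>For odd m, 2^m = 3 k + 2. Hence z^(3 k + 1) = 1 for nonzero z, so z is the inverse of
  (z^3)^k and is determined by its cube.\<close>

lemma cube_inj: "(x::'a) ^ 3 = y ^ 3 \<Longrightarrow> x = y"
proof (cases "x = 0 \<or> y = 0")
  case False
  assume *: "x ^ 3 = y ^ 3"
  have "(2::nat) ^ m mod 3 = 2"
    using odd_m
  proof (elim oddE)
    fix b assume "m = 2 * b + 1"
    moreover have "(4::nat) ^ b mod 3 = 1"
      by (induction b) (simp_all add: mod_mult_right_eq[symmetric])
    ultimately show ?thesis
      by (simp add: power_mult power_add) presburger
  qed
  then obtain k where k: "(2::nat) ^ m = 3 * k + 2" by (metis mult_div_mod_eq)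
  have "z ^ (3 * k) * z = 1" if "z \<noteq> 0" for z :: 'a
  proof -
    have "z ^ (3 * k + 2) = (z ^ (3 * k) * z) * z"
      by (simp only: power_add power2_eq_square mult.assoc)
    hence "(z ^ (3 * k) * z) * z = 1 * z" by (metis mult_1_left pow_card k)
    thus ?thesis using that by (metis mult_cancel_right)
  qed
  hence "(x ^ 3) ^ k * x = 1" "(x ^ 3) ^ k * y = 1" using False * by (metis power_mult)+
  thus ?thesis by (metis mult_left_cancel mult_zero_left zero_neq_one)
qed auto

lemma ex_cube_root: "\<exists>s. s ^ 3 = (x::'a)"
proof -
  have "inj (\<lambda>x::'a. x ^ 3)" by (simp add: inj_def cube_inj)
  hence "surj (\<lambda>x::'a. x ^ 3)" by (simp add: finite_UNIV_inj_surj)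
  thus ?thesis by (metis surjD)
qed

lemma m_pos: "m > 0" using odd_m by (rule odd_pos)

lemma the_exponent: "(THE n. CARD('a) = 2 ^ n) = m"
  by (rule the_equality) (simp_all add: CARD_eq)

lemma trace_eq: "abs_trace (x::'a) = (\<Sum>i<m. x ^ (2 ^ i))"
  unfolding abs_trace_def the_exponent ..

lemma trace_add: "abs_trace ((x::'a) + y) = abs_trace x + abs_trace y"
  by (simp add: trace_eq sum_pow2 sum.distrib)

lemma trace_0 [simp]: "abs_trace (0::'a) = 0"
  by (simp add: trace_eq power_0_left)

lemma trace_1 [simp]: "abs_trace (1::'a) = 1"
  using odd_m by (auto simp: trace_eq elim!: oddE)

text \<open>Squaring shifts the conjugates by one place, and the last one wraps round because
  x^(2^m) = x.\<close>

lemma trace_sq: "abs_trace ((x::'a)\<^sup>2) = abs_trace x"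
proof -
  have "abs_trace (x\<^sup>2) = (\<Sum>i<m. x ^ (2 ^ Suc i))"
    by (simp add: trace_eq power_mult)
  also have "\<dots> + x = (\<Sum>i<Suc m. x ^ (2 ^ i))"
    by (subst sum.lessThan_Suc_shift) (simp add: add.commute)
  also have "\<dots> = abs_trace x + x" by (simp add: trace_eq)
  finally show ?thesis by simp
qed

lemma sq_trace: "(abs_trace (x::'a))\<^sup>2 = abs_trace x"
proof -
  have "(sum f I)\<^sup>2 = (\<Sum>i\<in>I. (f i)\<^sup>2)" for f :: "nat \<Rightarrow> 'a" and I
    by (induction I rule: infinite_finite_induct) (simp_all add: sum_sq)
  hence "(abs_trace x)\<^sup>2 = abs_trace (x\<^sup>2)"
    by (simp add: trace_eq flip: power_mult) (simp add: mult.commute)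
  thus ?thesis by (simp add: trace_sq)
qed

lemma idem_cases: "(x::'a)\<^sup>2 = x \<longleftrightarrow> x = 0 \<or> x = 1"
  by (auto simp: power2_eq_square)

lemma trace_cases: "abs_trace (x::'a) = 0 \<or> abs_trace x = 1"
  using sq_trace[of x] by (simp add: idem_cases)

lemma trace_neq_0 [simp]: "abs_trace (x::'a) \<noteq> 0 \<longleftrightarrow> abs_trace x = 1"
  using trace_cases[of x] by auto

lemma trace_sq_mult: "abs_trace ((x::'a)\<^sup>2 * y\<^sup>2) = abs_trace (x * y)"
  by (metis power_mult_distrib trace_sq)

lemma ex_trace_mult: "(c::'a) \<noteq> 0 \<Longrightarrow> \<exists>x. abs_trace (x * c) = 1"
  by (rule exI[of _ "1 / c"]) simp

end

section \<open>Additive subgroups, functionals over GF(2) and the Artin-Schreier equation\<close>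

lemma additive_subgroup_UNIV [simp]: "additive_subgroup UNIV"
  by (simp add: additive_subgroup_def)

text \<open>In characteristic 2, and for a subgroup G, this is the subgroup generated by G and
  z.\<close>

definition adj :: "'b::ab_group_add set \<Rightarrow> 'b \<Rightarrow> 'b set" where
  "adj G z = G \<union> (+) z ` G"

context char_two_field
begin

lemma subgroupI: "0 \<in> G \<Longrightarrow> (\<And>x y. x \<in> G \<Longrightarrow> y \<in> G \<Longrightarrow> x + y \<in> G) \<Longrightarrow> additive_subgroup (G::'a set)"
  by (simp add: additive_subgroup_def)

lemma subgroup_adj: "additive_subgroup (G::'a set) \<Longrightarrow> additive_subgroup (adj G z)"
proof (rule subgroupI)
  assume G: "additive_subgroup G"
  show "0 \<in> adj G z" using G by (simp add: adj_def additive_subgroup_def)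
  fix x y assume "x \<in> adj G z" "y \<in> adj G z"
  then consider "x \<in> G" "y \<in> G" | g where "g \<in> G" "x = z + g" "y \<in> G"
    | g where "g \<in> G" "y = z + g" "x \<in> G" | g g' where "g \<in> G" "x = z + g" "g' \<in> G" "y = z + g'"
    by (auto simp: adj_def)
  thus "x + y \<in> adj G z"
  proof cases
    case 1 thus ?thesis using G by (simp add: adj_def additive_subgroup_def)
  next
    case 2
    hence "x + y = z + (g + y)" by (simp add: add.assoc)
    thus ?thesis using G 2 by (auto simp: adj_def additive_subgroup_def)
  next
    case 3
    hence "x + y = z + (x + g)" by (simp add: add_ac)
    thus ?thesis using G 3 by (auto simp: adj_def additive_subgroup_def)
  next
    case 4
    hence "x + y = g + g'" by (simp add: add_ac)
    thus ?thesis using G 4 by (auto simp: adj_def additive_subgroup_def)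
  qed
qed

lemma card_adj: "additive_subgroup (G::'a set) \<Longrightarrow> z \<notin> G \<Longrightarrow> card (adj G z) = 2 * card G"
proof -
  assume G: "additive_subgroup G" and z: "z \<notin> G"
  have "G \<inter> (+) z ` G = {}"
  proof safe
    fix g assume g: "z + g \<in> G" "g \<in> G"
    hence "(z + g) + g \<in> G" using G by (simp only: additive_subgroup_def)
    thus "z + g \<in> {}" using z by (simp add: add.assoc)
  qed
  thus ?thesis unfolding adj_def by (subst card_Un_disjoint) (auto simp: card_image)
qed

lemma adj_subset: "additive_subgroup (A::'a set) \<Longrightarrow> G \<subseteq> A \<Longrightarrow> z \<in> A \<Longrightarrow> adj G z \<subseteq> A"
  by (auto simp: adj_def additive_subgroup_def)

text \<open>These are the linear functionals over GF(2), with the prime field embedded in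
  \<open>'a\<close>.\<close>

definition character :: "('a \<Rightarrow> 'a) \<Rightarrow> bool" where
  "character \<phi> \<longleftrightarrow> (\<forall>x y. \<phi> (x + y) = \<phi> x + \<phi> y) \<and> (\<forall>x. \<phi> x = 0 \<or> \<phi> x = 1)"

lemma character_trace: "character (\<lambda>x. abs_trace (x * c))"
  by (simp add: character_def trace_add distrib_right trace_cases)

lemma subgroup_kernel: "additive_subgroup G \<Longrightarrow> character \<phi> \<Longrightarrow> additive_subgroup {x\<in>G. \<phi> x = 0}"
  by (auto simp: additive_subgroup_def character_def) (metis add_self)

text \<open>Translation by z exchanges the two fibres.\<close>

lemma card_kernel:
  assumes G: "additive_subgroup (G::'a set)" and \<phi>: "\<And>x y. x \<in> G \<Longrightarrow> y \<in> G \<Longrightarrow> \<phi> (x + y) = \<phi> x + (\<phi> y::'a)"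
    "\<And>x. x \<in> G \<Longrightarrow> \<phi> x = 0 \<or> \<phi> x = 1" and z: "z \<in> G" "\<phi> z = 1"
  shows "2 * card {x\<in>G. \<phi> x = 0} = card G" "2 * card {x\<in>G. \<phi> x = 1} = card G"
proof -
  have im: "{x\<in>G. \<phi> x = 1} = (+) z ` {x\<in>G. \<phi> x = 0}"
  proof safe
    fix x assume x: "x \<in> G" "\<phi> x = 1"
    hence "z + x \<in> {x\<in>G. \<phi> x = 0}" using G z \<phi> by (auto simp: additive_subgroup_def)
    moreover have "x = z + (z + x)" by simp
    ultimately show "x \<in> (+) z ` {x\<in>G. \<phi> x = 0}" by blast
  qed (use G z \<phi> in \<open>auto simp: additive_subgroup_def\<close>)
  have eq: "card {x\<in>G. \<phi> x = 1} = card {x\<in>G. \<phi> x = 0}"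
    unfolding im by (simp add: card_image)
  have "G = {x\<in>G. \<phi> x = 0} \<union> {x\<in>G. \<phi> x = 1}" using \<phi>(2) by blast
  hence "card G = card {x\<in>G. \<phi> x = 0} + card {x\<in>G. \<phi> x = 1}"
    by (metis (mono_tags, lifting) card_Un_disjoint disjoint_iff finite mem_Collect_eq zero_neq_one)
  thus "2 * card {x\<in>G. \<phi> x = 0} = card G" "2 * card {x\<in>G. \<phi> x = 1} = card G" using eq by simp_all
qed

lemma card_kernel_character:
  assumes "additive_subgroup G" "character \<phi>" "z \<in> G" "\<phi> z \<noteq> 0"
  shows "2 * card {x\<in>G. \<phi> x = 0} = card G"
  using assms by (intro card_kernel(1)[of G \<phi> z]) (auto simp: character_def)

text \<open>Over GF(2) a functional that vanishes on the kernel of \<psi> is a multiple of \<psi>,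
  and the only multiples are 0 and \<psi> itself. The lemma takes the place of dimension arguments
  in the dual space.\<close>

lemma character_dependent:
  assumes G: "additive_subgroup G" and \<phi>: "character \<phi>" and \<psi>: "character \<psi>"
    and ker: "\<And>x. x \<in> G \<Longrightarrow> \<psi> x = 0 \<Longrightarrow> \<phi> x = 0"
  shows "(\<forall>x\<in>G. \<phi> x = 0) \<or> (\<forall>x\<in>G. \<phi> x + \<psi> x = 0)"
proof (cases "\<exists>g\<in>G. \<psi> g = 1")
  case True
  then obtain g where g: "g \<in> G" "\<psi> g = 1" by blast
  have *: "\<phi> x = (if \<psi> x = 1 then \<phi> g else 0)" if x: "x \<in> G" for x
  proof (cases "\<psi> x = 1")
    case True
    have "x + g \<in> G" "\<psi> (x + g) = 0" using x g G \<psi> True by (auto simp: additive_subgroup_def character_def)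
    hence "\<phi> (x + g) = 0" by (rule ker)
    thus ?thesis using True \<phi> by (simp add: character_def add_eq_0_iff_eq)
  next
    case False
    thus ?thesis using ker[OF x] \<psi> by (auto simp: character_def)
  qed
  have "\<phi> g = 0 \<or> \<phi> g = 1" using \<phi> by (simp add: character_def)
  thus ?thesis
  proof
    assume "\<phi> g = 0"
    hence "\<forall>x\<in>G. \<phi> x = 0" using * by auto
    thus ?thesis ..
  next
    assume 1: "\<phi> g = 1"
    have "\<forall>x\<in>G. \<phi> x + \<psi> x = 0" using \<psi> *[unfolded 1] unfolding character_def
      by (metis add_self add_0)
    thus ?thesis ..
  qed
next
  case False
  thus ?thesis using ker \<psi> by (metis character_def)
qed

lemma card_trace_0: "2 * card {x::'a. abs_trace x = 0} = CARD('a)"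
  using card_kernel_character[OF additive_subgroup_UNIV character_trace[of 1], of 1] by simp

text \<open>The fibres of k^2 + k are the pairs {l, l + 1}, so at least q / 2 values are taken. All
  of them have trace 0, and only q / 2 elements do.\<close>

lemma artin_schreier:
  assumes "abs_trace (x::'a) = 0" shows "\<exists>k. k\<^sup>2 + k = x"
proof -
  let ?f = "\<lambda>k::'a. k\<^sup>2 + k"
  have fib: "{k. ?f k = ?f l} = {l, l + 1}" for l
  proof -
    have "?f k = ?f l \<longleftrightarrow> k = l \<or> k = l + 1" for k
    proof -
      have "?f (k + l) = ?f k + ?f l" by (simp add: sum_sq add_ac)
      hence "?f k = ?f l \<longleftrightarrow> ?f (k + l) = 0" by (simp only: add_eq_0_iff_eq)
      also have "\<dots> \<longleftrightarrow> k + l = 0 \<or> k + l = 1"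
        by (simp add: add_eq_0_iff_eq idem_cases)
      also have "\<dots> \<longleftrightarrow> k = l \<or> k = l + 1"
      proof -
        have "k + l = 1 \<longleftrightarrow> k = l + 1" by (metis add.commute add_self_left)
        thus ?thesis by (simp add: add_eq_0_iff_eq)
      qed
      finally show ?thesis .
    qed
    thus ?thesis by blast
  qed
  have "CARD('a) = card (\<Union>y\<in>range ?f. {k. ?f k = y})"
    by (rule arg_cong[of _ _ card]) auto
  also have "\<dots> \<le> (\<Sum>y\<in>range ?f. card {k. ?f k = y})"
    by (rule card_UN_le) simp
  also have "\<dots> \<le> (\<Sum>y\<in>range ?f. 2)"
    by (rule sum_mono) (auto simp: fib card_insert_if)
  finally have "CARD('a) \<le> 2 * card (range ?f)" by simp
  hence "card {x::'a. abs_trace x = 0} \<le> card (range ?f)"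
    using card_trace_0 by simp
  moreover have "range ?f \<subseteq> {x::'a. abs_trace x = 0}"
    by (auto simp: trace_add trace_sq)
  ultimately have "range ?f = {x::'a. abs_trace x = 0}"
    by (intro card_seteq) auto
  thus ?thesis using assms by (metis (mono_tags, lifting) mem_Collect_eq rangeE)
qed

section \<open>Isotropic subspaces for the polar form of the cubic trace\<close>


text \<open>The polarization of Tr(x^3): by \<open>trace_cube_add\<close> it measures how far the
  cubic trace is from being additive.\<close>

definition polar :: "'a \<Rightarrow> 'a \<Rightarrow> 'a" where
  "polar x y = abs_trace (x\<^sup>2 * y + x * y\<^sup>2)"

lemma trace_cube_add: "abs_trace (((x::'a) + y) ^ 3) = abs_trace (x ^ 3) + abs_trace (y ^ 3) + polar x y"
proof -
  have "(x + y) ^ 3 = x ^ 3 + y ^ 3 + (x\<^sup>2 * y + x * y\<^sup>2)"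
    by (simp add: power3_eq_cube power2_eq_square distrib_left distrib_right mult_ac add_ac)
  thus ?thesis by (simp add: polar_def trace_add)
qed

lemma polar_commute: "polar x y = polar y x"
  by (simp add: polar_def add.commute mult.commute)

lemma polar_add_right: "polar x (y + z) = polar x y + polar x z"
  by (simp add: polar_def sum_sq distrib_left trace_add add_ac)

lemma polar_add_left: "polar (x + y) z = polar x z + polar y z"
  by (simp add: polar_commute[of _ z] polar_add_right)

lemma polar_self [simp]: "polar x x = 0"
  by (simp add: polar_def power2_eq_square mult_ac)

lemma polar_0 [simp]: "polar x 0 = 0" "polar 0 x = 0"
  by (simp_all add: polar_def)

text \<open>Tr(x^2) = Tr(x) puts 1 into the radical.\<close>

lemma polar_1 [simp]: "polar 1 x = 0" "polar x 1 = 0"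
  by (simp_all add: polar_def trace_add trace_sq)

lemma character_polar: "character (polar x)"
  by (simp add: character_def polar_add_right) (simp add: polar_def trace_cases)

text \<open>With s^2 = x one has Tr(x y^2) = Tr(s y), so \<open>polar x y\<close> is the trace of y
  times x^2 + s. This factor vanishes only if x^4 = x, which leaves 0 and 1 because cubing is
  injective.\<close>

lemma polar_nondegenerate:
  assumes "x \<noteq> 0" "x \<noteq> 1" shows "\<exists>y. polar x y = 1"
proof -
  obtain s where s: "s\<^sup>2 = x" using ex_sqrt by blast
  have *: "polar x y = abs_trace (y * (x\<^sup>2 + s))" for y
    using trace_sq_mult[of s y] s
    by (simp add: polar_def trace_add distrib_left mult.commute)
  have "x\<^sup>2 + s \<noteq> 0"
  proof
    assume "x\<^sup>2 + s = 0"
    hence "s = x\<^sup>2" by (simp add: add_eq_0_iff_eq)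
    hence "x * (x ^ 3) = x * 1" using s by (simp add: power2_eq_square power3_eq_cube mult.assoc)
    hence "x ^ 3 = 1 ^ 3" using assms by simp
    thus False using cube_inj assms by blast
  qed
  from ex_trace_mult[OF this] show ?thesis unfolding * .
qed

lemma card_polar_kernel:
  assumes "x \<noteq> 0" "x \<noteq> 1" shows "2 * card {y. polar x y = 0} = 2 ^ m"
proof -
  obtain y where "polar x y = 1" using polar_nondegenerate assms by blast
  thus ?thesis
    using card_kernel_character[OF additive_subgroup_UNIV character_polar[of x], of y] by (simp add: CARD_eq)
qed

text \<open>Outside {0, 1, x, 1 + x} the functionals \<open>polar x\<close> and
  \<open>polar y\<close> are independent, since a dependence would put y or x + y into the radical.
  Each of them then halves the field.\<close>

lemma card_polar_kernel2:
  assumes x: "x \<noteq> 0" "x \<noteq> 1" and y: "y \<notin> {0, 1, x, 1 + x}"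
  shows "4 * card {z. polar x z = 0 \<and> polar y z = 0} = 2 ^ m"
proof -
  let ?G = "{z\<in>UNIV. polar x z = 0}"
  have G: "additive_subgroup ?G" by (rule subgroup_kernel[OF _ character_polar]) simp
  have "\<exists>z\<in>?G. polar y z \<noteq> 0"
  proof (rule ccontr)
    assume "\<not> ?thesis"
    hence "(\<forall>z\<in>UNIV. polar y z = 0) \<or> (\<forall>z\<in>UNIV. polar y z + polar x z = 0)"
      by (intro character_dependent character_polar) auto
    hence *: "(\<forall>z. polar y z = 0) \<or> (\<forall>z. polar (y + x) z = 0)"
      by (simp add: polar_add_left)
    have "y + x \<noteq> 0" using y by (simp add: add_eq_0_iff_eq)
    moreover have "y + x \<noteq> 1"
    proof
      assume "y + x = 1"
      hence "y = 1 + x" by (metis add.commute add_self_left)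
      thus False using y by simp
    qed
    ultimately obtain v where "polar (y + x) v = 1" using polar_nondegenerate by blast
    moreover obtain u where "polar y u = 1" using polar_nondegenerate y by blast
    ultimately show False using * by (metis zero_neq_one)
  qed
  then obtain z where "z \<in> ?G" "polar y z \<noteq> 0" by blast
  from card_kernel_character[OF G character_polar this] card_polar_kernel[OF x]
  show ?thesis by (simp add: conj_commute)
qed

section \<open>Counting the isotropic groups of order 8 by their ordered bases\<close>

definition isotropic_spaces :: "'a set set" where
  "isotropic_spaces = {A. additive_subgroup A \<and> card A = 8 \<and> (\<forall>x\<in>A. \<forall>y\<in>A. polar x y = 0)}"

definition gen3 :: "'a \<Rightarrow> 'a \<Rightarrow> 'a \<Rightarrow> 'a set" where
  "gen3 x y z = adj {0, x, y, x + y} z"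

lemma subgroup_gen2: "additive_subgroup {0, x, y, x + (y::'a)}"
proof -
  have "adj (adj {0} x) y = {0, x, y, x + y}" by (auto simp: adj_def add.commute)
  moreover have "additive_subgroup {0::'a}" by (simp add: additive_subgroup_def)
  ultimately show ?thesis by (metis subgroup_adj)
qed

lemma subgroup_gen3: "additive_subgroup (gen3 x y z)"
  unfolding gen3_def by (rule subgroup_adj[OF subgroup_gen2])

lemma card_gen2: "x \<noteq> 0 \<Longrightarrow> y \<noteq> 0 \<Longrightarrow> x \<noteq> (y::'a) \<Longrightarrow> card {0, x, y, x + y} = 4"
  by (simp add: card_insert_if) (metis add_cancel_left_right add_eq_0_iff_eq add_self_left)

lemma card_gen3:
  assumes "x \<noteq> 0" "y \<notin> {0, x}" "z \<notin> {0, x, y, x + (y::'a)}" shows "card (gen3 x y z) = 8"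
  using card_adj[OF subgroup_gen2 assms(3)] card_gen2[of x y] assms
  by (auto simp: gen3_def)

lemma gen3_eq:
  assumes "additive_subgroup A" "card A = 8"
    and "x \<in> A - {0}" "y \<in> A - {0, x}" "z \<in> A - {0, x, y, x + (y::'a)}"
  shows "gen3 x y z = A"
proof (rule card_subset_eq)
  show "gen3 x y z \<subseteq> A" unfolding gen3_def
    by (rule adj_subset) (use assms in \<open>auto simp: additive_subgroup_def\<close>)
  show "card (gen3 x y z) = card A" using assms card_gen3[of x y z] by auto
qed simp

lemma subgroup8_basis:
  assumes "additive_subgroup (A::'a set)" "card A = 8"
  obtains x y z where "x \<in> A - {0}" "y \<in> A - {0, x}" "z \<in> A - {0, x, y, x + y}" "A = gen3 x y z"
proof -
  have *: "\<exists>x. x \<in> A - S" if "card S < 8" "finite S" for S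
    using that assms(2) by (metis DiffI card_mono not_less subsetI)
  obtain x where x: "x \<in> A - {0}" using *[of "{0}"] by auto
  have "card {0, x} < 8" by (cases "x = 0") simp_all
  then obtain y where y: "y \<in> A - {0, x}" using *[of "{0, x}"] by auto
  obtain z where z: "z \<in> A - {0, x, y, x + y}"
    using *[of "{0, x, y, x + y}"] card_gen2[of x y] x y by auto
  show ?thesis using that[OF x y z] gen3_eq[OF assms x y z] by simp
qed

lemma isotropic_adj:
  assumes "\<And>u v. u \<in> G \<Longrightarrow> v \<in> G \<Longrightarrow> polar u v = 0" "\<And>u. u \<in> G \<Longrightarrow> polar z u = 0"
    and "u \<in> adj G z" "v \<in> adj G z"
  shows "polar u v = 0"
  using assms by (auto simp: adj_def polar_add_left polar_add_right polar_commute[of _ z])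

lemma isotropic_gen3:
  assumes "polar x y = 0" "polar x z = 0" "polar y z = 0" and "u \<in> gen3 x y z" "v \<in> gen3 x y z"
  shows "polar u v = 0"
proof (rule isotropic_adj[OF _ _ assms(4,5)[unfolded gen3_def]])
  fix u v assume "u \<in> {0, x, y, x + y}" "v \<in> {0, x, y, x + y}"
  thus "polar u v = 0" "polar z u = 0"
    using assms(1-3) by (auto simp: polar_add_left polar_add_right polar_commute[of y x] polar_commute[of z])
qed

text \<open>The ordered bases of all isotropic groups, written as successive choices so that the
  cardinality becomes an iterated sum.\<close>

definition isotropic_triples :: "('a \<times> 'a \<times> 'a) set" where
  "isotropic_triples = (SIGMA x:UNIV - {0}. SIGMA y:{y. polar x y = 0} - {0, x}.
     {z. polar x z = 0 \<and> polar y z = 0} - {0, x, y, x + y})"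

definition bases :: "'a set \<Rightarrow> ('a \<times> 'a \<times> 'a) set" where
  "bases A = (SIGMA x:A - {0}. SIGMA y:A - {0, x}. A - {0, x, y, x + y})"

text \<open>The number is 7 * 6 * 4, the order of GL(3,2).\<close>

lemma card_bases:
  assumes "additive_subgroup A" "card A = 8" shows "card (bases A) = 168"
proof -
  have 0: "0 \<in> A" using assms(1) by (simp add: additive_subgroup_def)
  have z: "card (A - {0, x, y, x + y}) = 4" if "x \<in> A - {0}" "y \<in> A - {0, x}" for x y
    using that assms card_gen2[of x y]
    by (subst card_Diff_subset) (auto simp: additive_subgroup_def)
  have y: "card (A - {0, x}) = 6" if "x \<in> A - {0}" for x
    using that assms 0 by (subst card_Diff_subset) auto
  have "card (bases A) = (\<Sum>x\<in>A - {0}. \<Sum>y\<in>A - {0, x}. 4)"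
    unfolding bases_def by (simp add: z)
  also have "\<dots> = (\<Sum>x\<in>A - {0}. 24)" by (rule sum.cong) (simp_all add: y)
  also have "\<dots> = 168" using assms 0 by (simp add: card_Diff_subset)
  finally show ?thesis .
qed

lemma isotropic_triples_eq: "isotropic_triples = (\<Union>A\<in>isotropic_spaces. bases A)"
proof (rule equalityI)
  show "isotropic_triples \<subseteq> (\<Union>A\<in>isotropic_spaces. bases A)"
  proof
    fix t assume t: "t \<in> isotropic_triples"
    obtain x y z where [simp]: "t = (x, y, z)" by (cases t)
    have *: "x \<noteq> 0" "y \<notin> {0, x}" "z \<notin> {0, x, y, x + y}" "polar x y = 0" "polar x z = 0" "polar y z = 0"
      using t by (auto simp: isotropic_triples_def)
    have "gen3 x y z \<in> isotropic_spaces"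
      using subgroup_gen3 card_gen3[OF *(1-3)] isotropic_gen3[OF *(4-6)]
      by (auto simp: isotropic_spaces_def)
    moreover have "t \<in> bases (gen3 x y z)"
      using * by (auto simp: bases_def gen3_def adj_def)
    ultimately show "t \<in> (\<Union>A\<in>isotropic_spaces. bases A)" by blast
  qed
  show "(\<Union>A\<in>isotropic_spaces. bases A) \<subseteq> isotropic_triples"
    by (auto simp: isotropic_triples_def bases_def isotropic_spaces_def)
qed

text \<open>A triple generates the group of which it is a basis, so the sets \<open>bases A\<close>
  for different A are disjoint.\<close>

lemma card_isotropic_triples_spaces: "card isotropic_triples = 168 * card isotropic_spaces"
proof -
  have "card isotropic_triples = (\<Sum>A\<in>isotropic_spaces. card (bases A))"
    unfolding isotropic_triples_eq
  proof (rule card_UN_disjoint)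
    show "\<forall>A\<in>isotropic_spaces. \<forall>B\<in>isotropic_spaces. A \<noteq> B \<longrightarrow> bases A \<inter> bases B = {}"
    proof (intro ballI impI)
      fix A B assume AB: "A \<in> isotropic_spaces" "B \<in> isotropic_spaces" "A \<noteq> B"
      have "gen3 x y z = C" if "(x, y, z) \<in> bases C" "C \<in> isotropic_spaces" for x y z C
        using that by (intro gen3_eq) (auto simp: bases_def isotropic_spaces_def)
      thus "bases A \<inter> bases B = {}" using AB by (metis disjoint_iff prod_cases3)
    qed
  qed auto
  also have "\<dots> = (\<Sum>A\<in>isotropic_spaces. 168)"
    by (rule sum.cong) (auto simp: isotropic_spaces_def card_bases)
  finally show ?thesis by simp
qed

text \<open>The radical splits the choices. If x = 1, then y is arbitrary and imposes the only
  condition on z. For any other x there are 2 k - 2 choices of y; two of them, 1 and x + 1, add no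
  condition on z beyond that of x, while each of the others halves the range of z again.\<close>

lemma card_isotropic_triples:
  assumes k: "2 ^ m = 4 * k" "k \<ge> 4"
  shows "card isotropic_triples = (4 * k - 2) * ((2 * k - 4) * (k - 1))"
proof -
  define Z where "Z x y = {z. polar x z = 0 \<and> polar y z = 0} - {0, x, y, x + y}" for x y
  define Y where "Y x = {y. polar x y = 0} - {0, x}" for x
  have Z: "card (Z x y) = card {z. polar x z = 0 \<and> polar y z = 0} - 4"
    if "x \<noteq> 0" "y \<in> Y x" for x y
    unfolding Z_def using that card_gen2[of x y]
    by (subst card_Diff_subset)
      (auto simp: Y_def polar_add_right polar_commute[of y x])
  have "card isotropic_triples = (\<Sum>x\<in>UNIV - {0}. \<Sum>y\<in>Y x. card (Z x y))"
    by (simp add: isotropic_triples_def Y_def Z_def)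
  also have "\<dots> = (\<Sum>y\<in>Y 1. card (Z 1 y)) + (\<Sum>x\<in>UNIV - {0} - {1}. \<Sum>y\<in>Y x. card (Z x y))"
    by (rule sum.remove) auto
  also have "(\<Sum>y\<in>Y 1. card (Z 1 y)) = (\<Sum>y\<in>Y 1. 2 * k - 4)"
  proof (rule sum.cong)
    fix y assume y: "y \<in> Y 1"
    hence "2 * card {z. polar y z = 0} = 2 ^ m" by (intro card_polar_kernel) (auto simp: Y_def)
    thus "card (Z 1 y) = 2 * k - 4" using Z[of 1 y] y k by simp
  qed simp
  also have "\<dots> = (4 * k - 2) * (2 * k - 4)"
    using k by (simp add: Y_def card_Diff_subset CARD_eq)
  also have "(\<Sum>x\<in>UNIV - {0} - {1}. \<Sum>y\<in>Y x. card (Z x y))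
    = (\<Sum>x\<in>UNIV - {0::'a} - {1}. (2 * k - 4) * (k - 2))"
  proof (rule sum.cong)
    fix x :: 'a assume "x \<in> UNIV - {0} - {1}"
    hence x: "x \<noteq> 0" "x \<noteq> 1" by auto
    note kx = card_polar_kernel[OF x]
    have ne: "x + 1 \<noteq> 1" "1 \<noteq> x + 1" "x + 1 \<noteq> 0" "x + 1 \<noteq> x" using x by (auto simp: add_eq_0_iff_eq)
    have sub: "{1, x + 1} \<subseteq> Y x" using x ne by (auto simp: Y_def polar_add_right)
    have cY: "card (Y x) = 2 * k - 2"
      unfolding Y_def using kx k x by (subst card_Diff_subset) auto
    have "(\<Sum>y\<in>Y x. card (Z x y)) = (\<Sum>y\<in>Y x - {1, x + 1}. card (Z x y)) + (\<Sum>y\<in>{1, x + 1}. card (Z x y))"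
      by (rule sum.subset_diff[OF sub]) simp
    also have "(\<Sum>y\<in>{1, x + 1}. card (Z x y)) = (\<Sum>y\<in>{1, x + 1}. 2 * k - 4)"
    proof (rule sum.cong)
      fix y assume y: "y \<in> {1, x + 1}"
      hence "{z. polar x z = 0 \<and> polar y z = 0} = {z. polar x z = 0}"
        by (auto simp: polar_add_left)
      thus "card (Z x y) = 2 * k - 4" using Z[OF x(1)] y sub kx k by auto
    qed simp
    also have "\<dots> = 2 * (2 * k - 4)" using x by simp
    also have "(\<Sum>y\<in>Y x - {1, x + 1}. card (Z x y)) = (\<Sum>y\<in>Y x - {1, x + 1}. k - 4)"
    proof (rule sum.cong)
      fix y assume y: "y \<in> Y x - {1, x + 1}"
      have "4 * card {z. polar x z = 0 \<and> polar y z = 0} = 2 ^ m"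
        using y by (intro card_polar_kernel2 x) (auto simp: Y_def add.commute)
      thus "card (Z x y) = k - 4" using Z[OF x(1), of y] y k by simp
    qed simp
    also have "\<dots> = (2 * k - 4) * (k - 4)"
      using sub cY x by (simp add: card_Diff_subset)
    \<comment> \<open>Subtraction is truncated here; writing k = j + 4 removes it.\<close>
    also have "(2 * k - 4) * (k - 4) + 2 * (2 * k - 4) = (2 * k - 4) * (k - 2)"
    proof -
      obtain j where "k = j + 4" using k(2) by (metis add.commute le_Suc_ex)
      thus ?thesis by (simp add: algebra_simps)
    qed
    finally show "(\<Sum>y\<in>Y x. card (Z x y)) = (2 * k - 4) * (k - 2)" .
  qed simp
  also have "\<dots> = (4 * k - 2) * ((2 * k - 4) * (k - 2))"
    using k by (simp add: card_Diff_subset CARD_eq)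
  also have "(4 * k - 2) * (2 * k - 4) + (4 * k - 2) * ((2 * k - 4) * (k - 2))
    = (4 * k - 2) * ((2 * k - 4) * (k - 1))"
  proof -
    obtain j where "k = j + 4" using k(2) by (metis add.commute le_Suc_ex)
    thus ?thesis by (simp add: algebra_simps)
  qed
  finally show ?thesis .
qed

end

section \<open>Field automorphisms\<close>

lemma map_poly_mult_hom:
  fixes f :: "'a::comm_semiring_0 \<Rightarrow> 'b::comm_semiring_0"
  assumes "f 0 = 0" "\<And>x y. f (x + y) = f x + f y" "\<And>x y. f (x * y) = f x * f y"
  shows "map_poly f (p * q) = map_poly f p * map_poly f q"
proof (rule poly_eqI)
  fix n
  have "f (sum g I) = (\<Sum>i\<in>I. f (g i))" for g :: "nat \<Rightarrow> 'a" and I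
    by (induction I rule: infinite_finite_induct) (simp_all add: assms)
  thus "coeff (map_poly f (p * q)) n = coeff (map_poly f p * map_poly f q) n"
    by (simp add: coeff_mult coeff_map_poly assms)
qed

lemma field_automorphismD:
  assumes "field_automorphism (\<sigma> :: 'a::field \<Rightarrow> 'a)"
  shows "\<sigma> (x + y) = \<sigma> x + \<sigma> y" "\<sigma> (x * y) = \<sigma> x * \<sigma> y" "\<sigma> 0 = 0" "\<sigma> 1 = 1" "inj \<sigma>" "surj \<sigma>" "bij \<sigma>"
    "\<sigma> (x ^ n) = \<sigma> x ^ n"
proof -
  have add: "\<sigma> (x + y) = \<sigma> x + \<sigma> y" and mult: "\<sigma> (x * y) = \<sigma> x * \<sigma> y" and bij: "bij \<sigma>" for x y
    using assms by (simp_all add: field_automorphism_def)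
  show "\<sigma> (x + y) = \<sigma> x + \<sigma> y" "\<sigma> (x * y) = \<sigma> x * \<sigma> y" "inj \<sigma>" "surj \<sigma>" "bij \<sigma>"
    using add mult bij by (simp_all add: bij_is_inj bij_is_surj)
  show 0: "\<sigma> 0 = 0" using add[of 0 0] by (metis add_0 add_cancel_right_right)
  have "\<sigma> 1 \<noteq> 0" using bij 0 by (metis bij_is_inj inj_eq one_neq_zero)
  thus 1: "\<sigma> 1 = 1" using mult[of 1 1] by simp
  show "\<sigma> (x ^ n) = \<sigma> x ^ n" by (induction n) (simp_all add: 1 mult)
qed

lemma id_automorphism: "field_automorphism (\<lambda>x::'a::field. x)"
  by (simp add: field_automorphism_def bij_id[unfolded id_def])

lemma inv_field_automorphism:
  assumes "field_automorphism \<sigma>" shows "field_automorphism (inv \<sigma>)"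
  unfolding field_automorphism_def
proof (intro conjI allI)
  note \<sigma> = field_automorphismD[OF assms]
  show "bij (inv \<sigma>)" using \<sigma> by (simp add: bij_imp_bij_inv)
  fix x y
  have "\<sigma> (inv \<sigma> x + inv \<sigma> y) = x + y" "\<sigma> (inv \<sigma> x * inv \<sigma> y) = x * y"
    using \<sigma> by (simp_all add: surj_f_inv_f)
  thus "inv \<sigma> (x + y) = inv \<sigma> x + inv \<sigma> y" "inv \<sigma> (x * y) = inv \<sigma> x * inv \<sigma> y"
    using \<sigma>(5) by (metis inv_f_f)+
qed

lemma sq_less_pow2: "m \<ge> 5 \<Longrightarrow> m ^ 2 < (2::nat) ^ m"
proof (induction m rule: dec_induct)
  case (step n)
  have "(Suc n)\<^sup>2 \<le> 2 * n\<^sup>2"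
  proof -
    obtain j where "n = 5 + j" using step by (metis le_Suc_ex)
    thus ?thesis by (simp add: power2_eq_square algebra_simps)
  qed
  thus ?case using step by simp
qed simp

context char_two_field
begin

lemma frobenius_inj: "(x::'a) ^ (2 ^ i) = y ^ (2 ^ i) \<Longrightarrow> x = y"
proof -
  assume "x ^ (2 ^ i) = y ^ (2 ^ i)"
  hence "(x + y) ^ (2 ^ i) = 0" by (simp add: sum_pow2)
  hence "x + y = 0" by simp
  thus "x = y" by (simp only: add_eq_0_iff_eq)
qed

lemma frobenius_automorphism: "field_automorphism (\<lambda>x::'a. x ^ (2 ^ i))"
proof -
  have "inj (\<lambda>x::'a. x ^ (2 ^ i))" using frobenius_inj by (auto simp: inj_def)
  thus ?thesis
    by (simp add: field_automorphism_def bij_def finite_UNIV_inj_surj sum_pow2 power_mult_distrib)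
qed

lemma frobenius_mod: "(x::'a) ^ (2 ^ (i mod m)) = x ^ (2 ^ i)"
proof -
  have "x ^ (2 ^ (m * k)) = x" for x :: 'a and k
    by (induction k) (simp_all add: power_add power_mult)
  hence "x ^ (2 ^ (m * (i div m) + i mod m)) = x ^ (2 ^ (i mod m))"
    by (simp only: power_add power_mult[of x])
  thus ?thesis by simp
qed

text \<open>The product p of the factors X + x^(2^i) is invariant under squaring of its
  coefficients, so these are 0 or 1 and are fixed by \<sigma>. Therefore \<sigma> permutes the roots
  of p. The exponent i may still depend on x.\<close>

lemma automorphism_conjugate:
  assumes \<sigma>: "field_automorphism (\<sigma> :: 'a \<Rightarrow> 'a)"
  shows "\<exists>i<m. \<sigma> x = x ^ (2 ^ i)"
proof -
  define g where "g i = [:x ^ (2 ^ i), 1:]" for i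
  define p where "p = (\<Prod>i<m. g i)"
  have map_prod: "map_poly f (\<Prod>i\<in>I. g i) = (\<Prod>i\<in>I. map_poly f (g i))"
    if "f 0 = 0" "f 1 = 1" "\<And>x y. f (x + y) = f x + f y" "\<And>x y. f (x * y) = f x * f y"
    for f :: "'a \<Rightarrow> 'a" and I
    by (induction I rule: infinite_finite_induct) (simp_all add: that map_poly_mult_hom)
  have "map_poly (\<lambda>a. a\<^sup>2) p = (\<Prod>i<m. map_poly (\<lambda>a. a\<^sup>2) (g i))"
    unfolding p_def by (rule map_prod) (simp_all add: sum_sq power_mult_distrib)
  also have "\<dots> = (\<Prod>i<m. g (Suc i))"
    by (rule prod.cong) (simp_all add: g_def map_poly_pCons power_mult mult.commute[of 2])
  \<comment> \<open>Squaring shifts the factors; multiplying by \<open>g 0\<close> completes the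
    shifted product to one over m + 1 factors, whose last factor is \<open>g 0\<close>
    again.\<close>
  finally have "g 0 * map_poly (\<lambda>a. a\<^sup>2) p = (\<Prod>i<Suc m. g i)"
    by (simp only: prod.lessThan_Suc_shift)
  also have "\<dots> = p * g 0" by (simp add: p_def g_def)
  finally have "g 0 * map_poly (\<lambda>a. a\<^sup>2) p = g 0 * p" by (simp add: mult.commute)
  moreover have "g 0 \<noteq> 0" by (simp add: g_def)
  ultimately have "map_poly (\<lambda>a. a\<^sup>2) p = p" by simp
  hence "(coeff p n)\<^sup>2 = coeff p n" for n by (metis coeff_map_poly zero_power2)
  hence coeff: "\<sigma> (coeff p n) = coeff p n" for n
    by (metis field_automorphismD(3,4)[OF \<sigma>] idem_cases)
  have "poly p (\<sigma> x) = \<sigma> (poly p x)"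
  proof -
    have "\<sigma> (sum f I) = (\<Sum>i\<in>I. \<sigma> (f i))" for f :: "nat \<Rightarrow> 'a" and I
      by (induction I rule: infinite_finite_induct) (simp_all add: field_automorphismD[OF \<sigma>])
    thus ?thesis by (simp add: poly_altdef field_automorphismD[OF \<sigma>] coeff)
  qed
  also have "poly p x = 0"
    using m_pos by (auto simp: p_def g_def poly_prod intro!: bexI[of _ 0])
  finally have "(\<Prod>i<m. x ^ (2 ^ i) + \<sigma> x) = 0"
    by (simp add: p_def g_def poly_prod field_automorphismD[OF \<sigma>])
  then obtain i where "i < m" "x ^ (2 ^ i) + \<sigma> x = 0" by auto
  thus ?thesis by (metis add_eq_0_iff_eq)
qed

text \<open>For x outside E the elements 1 and x are independent over E, so the field contains a
  copy of E \<times> E.\<close>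

lemma proper_subfield_card:
  assumes E: "\<And>x y. x \<in> E \<Longrightarrow> y \<in> E \<Longrightarrow> x + y \<in> E" "\<And>x y. x \<in> E \<Longrightarrow> y \<in> E \<Longrightarrow> x / y \<in> (E::'a set)"
    and "x \<notin> E"
  shows "(card E)\<^sup>2 \<le> 2 ^ m"
proof -
  have "inj_on (\<lambda>(a, b). a + x * b) (E \<times> E)"
  proof (rule inj_onI, clarify)
    fix a b c d assume *: "a \<in> E" "b \<in> E" "c \<in> E" "d \<in> E" "a + x * b = c + x * d"
    hence "(a + x * b) + (c + x * d) = 0" by simp
    hence "x * (b + d) + (a + c) = 0" by (simp add: distrib_left add_ac)
    hence **: "x * (b + d) = a + c" by (simp only: add_eq_0_iff_eq)
    have "b = d"
    proof (rule ccontr)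
      assume "b \<noteq> d"
      hence "x = (a + c) / (b + d)" using ** by (simp add: field_simps add_eq_0_iff_eq)
      thus False using assms(3) E * by blast
    qed
    thus "a = c \<and> b = d" using ** by (simp add: add_eq_0_iff_eq)
  qed
  hence "card (E \<times> E) \<le> CARD('a)" by (intro card_inj_on_le) auto
  thus ?thesis by (simp add: card_cartesian_product power2_eq_square CARD_eq)
qed

text \<open>If no single exponent served all x, the field would be covered by the m proper subfields
  on which \<sigma> agrees with a given power of Frobenius. One of them would have at least 2^m / m
  elements, but its square is at most 2^m, so 2^m \<le> m^2, which fails from m = 5 on.\<close>

lemma automorphism_frobenius:
  assumes \<sigma>: "field_automorphism (\<sigma> :: 'a \<Rightarrow> 'a)" and m: "m \<ge> 5"
  shows "\<exists>i<m. \<sigma> = (\<lambda>x. x ^ (2 ^ i))"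
proof (rule ccontr)
  assume no: "\<not> ?thesis"
  define E where "E i = {x. \<sigma> x = x ^ (2 ^ i)}" for i
  have card_E: "(card (E i))\<^sup>2 \<le> 2 ^ m" if i: "i < m" for i
  proof -
    obtain x where "x \<notin> E i" using no i unfolding E_def by blast
    moreover have "\<sigma> (x / y) = \<sigma> x / \<sigma> y" for x y
    proof (cases "y = 0")
      case False
      have "\<sigma> (x / y) * \<sigma> y = \<sigma> x" using False by (simp flip: field_automorphismD(2)[OF \<sigma>])
      moreover have "\<sigma> y \<noteq> 0" using False field_automorphismD(3,5)[OF \<sigma>] by (metis inj_eq)
      ultimately show ?thesis by (simp add: field_simps)
    qed (simp add: field_automorphismD[OF \<sigma>])
    ultimately show ?thesis
      by (intro proper_subfield_card[of "E i" x])
        (auto simp: E_def field_automorphismD[OF \<sigma>] sum_pow2 power_divide)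
  qed
  have "UNIV = (\<Union>i<m. E i)" using automorphism_conjugate[OF \<sigma>] by (auto simp: E_def)
  hence sum_E: "CARD('a) \<le> (\<Sum>i<m. card (E i))" by (metis card_UN_le finite_lessThan)
  have "\<exists>i<m. 2 ^ m \<le> m * card (E i)"
  proof (rule ccontr)
    assume "\<not> ?thesis"
    hence "(\<Sum>i<m. m * card (E i)) < (\<Sum>i<m. 2 ^ m)"
      using m_pos by (intro sum_strict_mono) (auto simp: not_le)
    hence "(\<Sum>i<m. card (E i)) < 2 ^ m" by (simp flip: sum_distrib_left)
    thus False using sum_E by (simp add: CARD_eq)
  qed
  then obtain i where i: "i < m" "2 ^ m \<le> m * card (E i)" by blast
  have "(2 ^ m)\<^sup>2 \<le> (m * card (E i))\<^sup>2" using i by (intro power_mono) auto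
  also have "\<dots> \<le> m\<^sup>2 * 2 ^ m" using card_E[OF i(1)] by (simp add: power_mult_distrib)
  finally have "(2::nat) ^ m \<le> m\<^sup>2" by (simp add: power2_eq_square)
  thus False using sq_less_pow2[OF m] by simp
qed

section \<open>The Galois action on the isotropic groups\<close>

lemma trace_frobenius: "abs_trace ((x::'a) ^ (2 ^ i)) = abs_trace x"
proof (induction i)
  case (Suc i)
  have "x ^ (2 ^ Suc i) = (x ^ (2 ^ i))\<^sup>2" by (simp only: power_Suc2 power_mult)
  thus ?case using Suc by (simp only: trace_sq)
qed simp

lemma polar_frobenius: "polar (x ^ (2 ^ i)) (y ^ (2 ^ i)) = polar x y"
proof -
  have "(x ^ (2 ^ i))\<^sup>2 * y ^ (2 ^ i) + x ^ (2 ^ i) * (y ^ (2 ^ i))\<^sup>2 = (x\<^sup>2 * y + x * y\<^sup>2) ^ (2 ^ i)"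
    by (simp add: sum_pow2 power_mult_distrib flip: power_mult) (simp add: mult.commute)
  thus ?thesis by (simp add: polar_def trace_frobenius)
qed

lemma isotropic_spaces_image_frobenius:
  assumes "A \<in> isotropic_spaces" shows "(\<lambda>x. x ^ (2 ^ i)) ` A \<in> isotropic_spaces"
proof -
  have "inj_on (\<lambda>x::'a. x ^ (2 ^ i)) A" using frobenius_inj by (auto simp: inj_on_def)
  thus ?thesis using assms
    by (auto simp: isotropic_spaces_def card_image polar_frobenius additive_subgroup_def image_iff
        simp flip: sum_pow2)
qed

lemma isotropic_spaces_image:
  assumes "A \<in> isotropic_spaces" "field_automorphism \<sigma>" "m \<ge> 5" shows "\<sigma> ` A \<in> isotropic_spaces"
proof -
  obtain i where "\<sigma> = (\<lambda>x. x ^ (2 ^ i))" using automorphism_frobenius[OF assms(2,3)] by blast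
  thus ?thesis using isotropic_spaces_image_frobenius[OF assms(1)] by simp
qed

text \<open>As m is prime, d is invertible modulo m, so Frobenius itself is an iterate of its d-th
  power.\<close>

lemma frobenius_iterate_closed:
  fixes S :: "'a set"
  assumes "prime m" "0 < d" "d < m" and S: "\<And>x. x \<in> S \<Longrightarrow> x ^ (2 ^ d) \<in> S"
  shows "x \<in> S \<Longrightarrow> x ^ (2 ^ i) \<in> S"
proof -
  have *: "x ^ (2 ^ (d * k)) \<in> S" if "x \<in> S" for x k
    using that by (induction k) (simp_all add: power_add power_mult S mult.commute[of "2 ^ d"])
  have "coprime d m" using assms(1-3) by (metis coprime_commute nat_dvd_not_less prime_imp_coprime)
  then obtain k l where kl: "d * k = m * l + 1"
    using bezout_nat[of d m] assms(2) by (auto simp: coprime_iff_gcd_eq_1)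
  assume x: "x \<in> S"
  have "d * (k * i) = (d * k) * i" by simp
  also have "\<dots> = m * (l * i) + i" by (simp only: kl add_mult_distrib mult.assoc mult_1)
  finally have "(d * (k * i)) mod m = i mod m" by simp
  hence "x ^ (2 ^ (d * (k * i))) = x ^ (2 ^ i)" by (metis frobenius_mod)
  thus ?thesis using *[OF x, of "k * i"] by simp
qed

text \<open>If two of the m conjugates agree, x is fixed by a nontrivial power of Frobenius, hence
  by Frobenius, so that x^2 = x.\<close>

lemma frobenius_orbit:
  assumes m: "prime m" and x: "x \<noteq> 0" "x \<noteq> (1::'a)"
  shows "card ((\<lambda>i. x ^ (2 ^ i)) ` {..<m}) = m"
proof -
  have ne: "False" if ij: "i < j" "j < m" "x ^ (2 ^ i) = x ^ (2 ^ j)" for i j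
  proof -
    have "x ^ (2 ^ (j - i)) = x"
    proof (rule frobenius_inj[of _ i])
      have "(x ^ (2 ^ (j - i))) ^ (2 ^ i) = x ^ (2 ^ j)"
        using ij(1) by (simp flip: power_mult power_add)
      thus "(x ^ (2 ^ (j - i))) ^ (2 ^ i) = x ^ (2 ^ i)" using ij by simp
    qed
    hence "x ^ (2 ^ 1) \<in> {x}"
      by (rule_tac frobenius_iterate_closed[OF m, of "j - i" "{x}" x 1]) (use ij(1,2) in simp_all)
    thus False using x idem_cases[of x] by simp
  qed
  have "inj_on (\<lambda>i. x ^ (2 ^ i)) {..<m}"
    by (intro inj_onI) (metis lessThan_iff linorder_neqE_nat ne)
  thus ?thesis by (simp add: card_image)
qed

text \<open>A group stable under one nontrivial power is stable under all, so A - {0, 1} is a union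
  of orbits of length m. It has six or seven elements: this forces m = 5, and two disjoint orbits
  would then need ten.\<close>

lemma frobenius_stabilizer_trivial:
  assumes m: "prime m" "m \<ge> 5" "m \<noteq> 7" and d: "0 < d" "d < m" and A: "A \<in> isotropic_spaces"
  shows "(\<lambda>x. x ^ (2 ^ d)) ` A \<noteq> A"
proof
  assume stable: "(\<lambda>x. x ^ (2 ^ d)) ` A = A"
  have closed: "x ^ (2 ^ i) \<in> A" if "x \<in> A" for x i
  proof (rule frobenius_iterate_closed[OF m(1) d])
    fix y assume "y \<in> A"
    hence "y ^ (2 ^ d) \<in> (\<lambda>x. x ^ (2 ^ d)) ` A" by (rule imageI)
    thus "y ^ (2 ^ d) \<in> A" using stable by simp
  qed (rule that)
  define orb :: "'a \<Rightarrow> 'a set" where "orb x = (\<lambda>i. x ^ (2 ^ i)) ` {..<m}" for x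
  have orb: "orb x \<subseteq> A - {0, 1}" "card (orb x) = m" if "x \<in> A - {0, 1}" for x
  proof -
    show "card (orb x) = m" unfolding orb_def using that by (intro frobenius_orbit m) auto
    show "orb x \<subseteq> A - {0, 1}" using closed that frobenius_inj[of x _ 1]
      by (auto simp: orb_def)
  qed
  have card_A: "card A = 8" using A by (simp add: isotropic_spaces_def)
  \<comment> \<open>Six or seven according to whether 1 belongs to A.\<close>
  have *: "card (A - {0, 1}) \<ge> 6" "card (A - {0, 1}) \<le> 7"
  proof -
    show "card (A - {0, 1}) \<ge> 6" using card_A diff_card_le_card_Diff[of "{0, 1}" A] by simp
    have "0 \<in> A" using A by (simp add: isotropic_spaces_def additive_subgroup_def)
    hence "card (A - {0}) = 7" using card_A by simp
    thus "card (A - {0, 1}) \<le> 7" by (metis Diff_insert2 card_Diff1_le finite insert_commute)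
  qed
  then obtain x where x: "x \<in> A - {0, 1}" by (metis card.empty ex_in_conv not_numeral_le_zero)
  have "m \<le> 7" using orb[OF x] * card_mono[of "A - {0, 1}" "orb x"] by simp
  hence "m = 5 \<or> m = 6" using m by linarith
  hence m5: "m = 5" using odd_m by auto
  have "card (A - {0, 1} - orb x) \<ge> 1"
    using diff_card_le_card_Diff[of "orb x" "A - {0, 1}"] orb[OF x] * m5 by simp
  then obtain y where y: "y \<in> A - {0, 1}" "y \<notin> orb x" by (metis DiffD1 DiffD2 card.empty ex_in_conv not_one_le_zero)
  have "orb x \<inter> orb y = {}"
  proof (rule ccontr)
    assume "orb x \<inter> orb y \<noteq> {}"
    then obtain i j where ij: "i < m" "x ^ (2 ^ j) = y ^ (2 ^ i)" by (auto simp: orb_def)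
    \<comment> \<open>The power 2^(m - i) undoes the power 2^i and leads from the common conjugate
      back to y.\<close>
    have "y = y ^ (2 ^ (i + (m - i)))" using ij by simp
    also have "\<dots> = x ^ (2 ^ (j + (m - i)))" using ij(2) by (simp add: power_add power_mult)
    also have "\<dots> = x ^ (2 ^ ((j + (m - i)) mod m))" by (simp only: frobenius_mod)
    also have "\<dots> \<in> orb x" using m_pos unfolding orb_def by (intro imageI) simp
    finally show False using y by simp
  qed
  hence "card (orb x \<union> orb y) = 10" using orb x y m5 by (subst card_Un_disjoint) (auto simp: orb_def)
  moreover have "orb x \<union> orb y \<subseteq> A - {0, 1}" using orb x y by blast
  hence "card (orb x \<union> orb y) \<le> card (A - {0, 1})" by (intro card_mono) auto
  ultimately show False using * by simp
qed

text \<open>Arbitrary automorphisms are used to match \<open>PGammaL3\<close>;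
  \<open>automorphism_frobenius\<close> makes the classes computable.\<close>

definition galois_rel :: "('a set \<times> 'a set) set" where
  "galois_rel = {(A, B). A \<in> isotropic_spaces \<and> B \<in> isotropic_spaces \<and> (\<exists>\<sigma>. field_automorphism \<sigma> \<and> B = \<sigma> ` A)}"

lemma equiv_galois_rel: "equiv isotropic_spaces galois_rel"
proof (rule equivI)
  show "galois_rel \<subseteq> isotropic_spaces \<times> isotropic_spaces" by (auto simp: galois_rel_def)
  show "refl_on isotropic_spaces galois_rel"
    by (rule refl_onI) (use id_automorphism in \<open>auto simp: galois_rel_def intro!: exI[of _ "\<lambda>x. x"]\<close>)
  show "sym galois_rel"
  proof (rule symI)
    fix A B assume "(A, B) \<in> galois_rel"
    then obtain \<sigma> where *: "A \<in> isotropic_spaces" "B \<in> isotropic_spaces" "field_automorphism \<sigma>" "B = \<sigma> ` A"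
      by (auto simp: galois_rel_def)
    have "field_automorphism (inv \<sigma>)" by (rule inv_field_automorphism[OF *(3)])
    moreover have "A = inv \<sigma> ` B" using * field_automorphismD(5)[OF *(3)] by (simp add: image_inv_f_f)
    ultimately show "(B, A) \<in> galois_rel" using * by (auto simp: galois_rel_def)
  qed
  show "trans galois_rel"
  proof (rule transI)
    fix A B C assume "(A, B) \<in> galois_rel" "(B, C) \<in> galois_rel"
    then obtain \<sigma> \<tau> where *: "A \<in> isotropic_spaces" "C \<in> isotropic_spaces" "field_automorphism \<sigma>"
        "field_automorphism \<tau>" "C = \<tau> ` \<sigma> ` A"
      by (auto simp: galois_rel_def)
    moreover have "field_automorphism (\<tau> \<circ> \<sigma>)"
      using field_automorphismD[OF *(3)] field_automorphismD[OF *(4)]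
      by (auto simp: field_automorphism_def intro: bij_comp)
    ultimately show "(A, C) \<in> galois_rel" by (auto simp: galois_rel_def image_comp)
  qed
qed

lemma card_galois_class:
  assumes m: "prime m" "m \<ge> 5" "m \<noteq> 7" and A: "A \<in> isotropic_spaces"
  shows "card (galois_rel `` {A}) = m"
proof -
  have "galois_rel `` {A} = (\<lambda>i. (\<lambda>x. x ^ (2 ^ i)) ` A) ` {..<m}"
  proof safe
    fix B assume "(A, B) \<in> galois_rel"
    then obtain \<sigma> where "field_automorphism \<sigma>" "B = \<sigma> ` A" by (auto simp: galois_rel_def)
    thus "B \<in> (\<lambda>i. (\<lambda>x. x ^ (2 ^ i)) ` A) ` {..<m}"
      using automorphism_frobenius[OF _ m(2)] by blast
  next
    fix i assume "i < m"
    thus "(A, (\<lambda>x. x ^ (2 ^ i)) ` A) \<in> galois_rel"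
      using A isotropic_spaces_image_frobenius frobenius_automorphism by (auto simp: galois_rel_def)
  qed
  moreover have "inj_on (\<lambda>i. (\<lambda>x. x ^ (2 ^ i)) ` A) {..<m}"
  proof -
    have ne: False if ij: "i < j" "j < m" "(\<lambda>x. x ^ (2 ^ i)) ` A = (\<lambda>x. x ^ (2 ^ j)) ` A" for i j
    proof -
      have "(\<lambda>x. x ^ (2 ^ i)) ` (\<lambda>x. x ^ (2 ^ (j - i))) ` A = (\<lambda>x. x ^ (2 ^ i)) ` A"
        using ij by (simp add: image_image flip: power_mult power_add)
      moreover have "inj (\<lambda>x::'a. x ^ (2 ^ i))" using frobenius_inj by (auto simp: inj_def)
      ultimately have "(\<lambda>x. x ^ (2 ^ (j - i))) ` A = A" by (simp add: inj_image_eq_iff)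
      thus False using frobenius_stabilizer_trivial[OF m, of "j - i"] ij A by simp
    qed
    thus ?thesis by (intro inj_onI) (metis lessThan_iff linorder_neqE_nat)
  qed
  ultimately show ?thesis by (simp add: card_image)
qed

lemma card_galois_classes:
  assumes m: "prime m" "m \<ge> 5" "m \<noteq> 7"
  shows "m * card (isotropic_spaces // galois_rel) = card isotropic_spaces"
proof -
  have U: "\<Union>(isotropic_spaces // galois_rel) = isotropic_spaces"
    by (rule Union_quotient[OF equiv_galois_rel])
  have "m * card (isotropic_spaces // galois_rel) = card (\<Union>(isotropic_spaces // galois_rel))"
  proof (rule card_partition)
    show "card c = m" if "c \<in> isotropic_spaces // galois_rel" for c
      using that card_galois_class[OF m] by (auto simp: quotient_def)
    show "c \<inter> c' = {}" if "c \<in> isotropic_spaces // galois_rel" "c' \<in> isotropic_spaces // galois_rel" "c \<noteq> c'" for c c'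
      using quotient_disj[OF equiv_galois_rel that(1,2)] that(3) by blast
  qed auto
  thus ?thesis by (simp only: U)
qed

end

section \<open>Points and lines of the plane in coordinates\<close>

abbreviation vec3 :: "'a \<Rightarrow> 'a \<Rightarrow> 'a \<Rightarrow> 'a::zero ^ 3" where
  "vec3 x y z \<equiv> vector [x, y, z]"

lemma vec3_eq_iff: "u = v \<longleftrightarrow> u $ 1 = v $ 1 \<and> u $ 2 = v $ 2 \<and> u $ 3 = (v $ 3 :: 'a)" for u v :: "'a ^ 3"
  by (simp add: vec_eq_iff forall_3)

lemma span_single: "vec.span {v} = range (\<lambda>k. k *s (v :: 'a::field ^ 3))"
  by (rule vec.span_singleton)

lemma points_iff: "P \<in> points \<longleftrightarrow> (\<exists>v. v \<noteq> 0 \<and> P = vec.span {v :: 'a::{field,finite} ^ 3})"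
proof
  assume "P \<in> points"
  hence P: "vec.subspace P" "vec.dim P = 1" by (simp_all add: points_def)
  obtain B where B: "B \<subseteq> P" "vec.independent B" "P \<subseteq> vec.span B" "card B = vec.dim P"
    using vec.basis_exists[of P] by metis
  then obtain v where "B = {v}" using P by (metis card_1_singletonE)
  moreover have "vec.span B = P" using B P vec.span_minimal by blast
  ultimately show "\<exists>v. v \<noteq> 0 \<and> P = vec.span {v}" using B by (auto simp: vec.dependent_single)
next
  assume "\<exists>v. v \<noteq> 0 \<and> P = vec.span {v}"
  then obtain v where "v \<noteq> 0" "P = vec.span {v}" by blast
  thus "P \<in> points" by (simp add: points_def vec.dim_span vec.dim_eq_card_independent vec.dependent_single)
qed

lemma span_in_points: "v \<noteq> 0 \<Longrightarrow> vec.span {v} \<in> points"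
  using points_iff by blast

lemma points_eq_span: "P \<in> points \<Longrightarrow> v \<in> P \<Longrightarrow> v \<noteq> 0 \<Longrightarrow> P = vec.span {v}"
proof -
  assume "P \<in> points" "v \<in> P" "v \<noteq> 0"
  then obtain w k where w: "w \<noteq> 0" "P = vec.span {w}" "v = k *s w" by (auto simp: points_iff span_single)
  have k: "k \<noteq> 0" using \<open>v \<noteq> 0\<close> w by auto
  have "c *s w \<in> range (\<lambda>k. k *s v)" for c
    using k by (intro image_eqI[of _ _ "c / k"]) (simp_all add: w)
  moreover have "c *s v \<in> range (\<lambda>k. k *s w)" for c
    by (intro image_eqI[of _ _ "c * k"]) (simp_all add: w)
  ultimately show ?thesis unfolding w(2) span_single by blast
qed

lemma points_eqI: "P \<in> points \<Longrightarrow> Q \<in> points \<Longrightarrow> v \<in> P \<Longrightarrow> v \<in> Q \<Longrightarrow> v \<noteq> 0 \<Longrightarrow> P = Q"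
  using points_eq_span by metis

lemma points_nonzero: "P \<in> points \<Longrightarrow> \<exists>v\<in>P. v \<noteq> 0"
  by (auto simp: points_iff intro: vec.span_base)

lemma zero_in_points: "P \<in> points \<Longrightarrow> 0 \<in> P"
  by (auto simp: points_def intro: vec.subspace_0)

text \<open>Different points share only the zero vector, so a set of points is determined by the
  vectors it covers. This justifies working with cones instead of point sets.\<close>

lemma point_set_eqI:
  assumes "K \<subseteq> points" "K' \<subseteq> points" "\<Union>K = \<Union>K'" shows "K = K'"
proof -
  have *: "K1 \<subseteq> K2" if "K1 \<subseteq> points" "K2 \<subseteq> points" "\<Union>K1 = \<Union>K2" for K1 K2 :: "'a point set"
  proof
    fix P assume P: "P \<in> K1"
    hence "P \<in> points" using that(1) by (rule_tac subsetD)
    then obtain v where v: "v \<in> P" "v \<noteq> 0" using points_nonzero by blast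
    hence "v \<in> \<Union>K2" using P that(3) by blast
    then obtain Q where Q: "Q \<in> K2" "v \<in> Q" by blast
    hence "Q \<in> points" using that(2) by (rule_tac subsetD)
    hence "P = Q" using points_eqI \<open>P \<in> points\<close> v Q by metis
    thus "P \<in> K2" using Q by simp
  qed
  show ?thesis using *[of K K'] *[of K' K] assms by simp
qed

lemma lines_iff:
  "L \<in> lines \<longleftrightarrow> (\<exists>u v. v \<noteq> 0 \<and> (\<forall>k. u \<noteq> k *s v) \<and> L = {a *s u + b *s v | a b. True})"
  for L :: "'a::{field,finite} line"
proof -
  have span2: "vec.span {u, v} = {a *s u + b *s v | a b. True}" for u v :: "'a ^ 3"
  proof -
    have "vec.span {u, v} = {x. \<exists>k. x - k *s u \<in> range (\<lambda>k. k *s v)}"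
      by (simp only: vec.span_insert[of u "{v}"] span_single)
    also have "\<dots> = {a *s u + b *s v | a b. True}"
    proof safe
      fix x k l assume "x - k *s u = l *s v"
      hence "x = k *s u + l *s v" by (simp add: diff_eq_eq add.commute)
      thus "\<exists>a b. x = a *s u + b *s v \<and> True" by blast
    next
      fix a b
      show "\<exists>k. a *s u + b *s v - k *s u \<in> range (\<lambda>k. k *s v)" by (rule exI[of _ a]) (simp only: add_diff_cancel_left', rule rangeI)
    qed
    finally show ?thesis .
  qed
  have ind: "vec.independent {u, v} \<and> u \<noteq> v \<longleftrightarrow> v \<noteq> 0 \<and> (\<forall>k. u \<noteq> k *s v)" for u v :: "'a ^ 3"
  proof -
    have "u = 1 *s v" if "u = v" using that by simp
    hence *: "(\<forall>k. u \<noteq> k *s v) \<longleftrightarrow> u \<noteq> v \<and> u \<notin> range (\<lambda>k. k *s v)" by blast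
    show ?thesis unfolding *
      by (simp add: vec.independent_insert span_single vec.dependent_single)
  qed
  show ?thesis
  proof
    assume "L \<in> lines"
    hence L: "vec.subspace L" "vec.dim L = 2" by (simp_all add: lines_def)
    obtain B where B: "B \<subseteq> L" "vec.independent B" "L \<subseteq> vec.span B" "card B = vec.dim L"
      using vec.basis_exists[of L] by metis
    then obtain u v where uv: "B = {u, v}" "u \<noteq> v" using L by (metis card_2_iff)
    moreover have "vec.span B = L" using B L vec.span_minimal by blast
    ultimately show "\<exists>u v. v \<noteq> 0 \<and> (\<forall>k. u \<noteq> k *s v) \<and> L = {a *s u + b *s v | a b. True}"
      using B ind[of u v] span2[of u v] by (intro exI[of _ u] exI[of _ v]) simp
  next
    assume "\<exists>u v. v \<noteq> 0 \<and> (\<forall>k. u \<noteq> k *s v) \<and> L = {a *s u + b *s v | a b. True}"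
    then obtain u v where "v \<noteq> 0 \<and> (\<forall>k. u \<noteq> k *s v)" "L = {a *s u + b *s v | a b. True}" by blast
    hence "vec.independent {u, v}" "u \<noteq> v" "L = vec.span {u, v}"
      using ind[of u v] span2[of u v] by auto
    thus "L \<in> lines" by (simp add: lines_def vec.dim_span vec.dim_eq_card_independent)
  qed
qed

lemma linear_vec_iff:
  "Vector_Spaces.linear (*s) (*s) f \<longleftrightarrow> (\<forall>u v. f (u + v) = f u + f v) \<and> (\<forall>c v. f (c *s v) = c *s f v)"
  for f :: "'a::field ^ 3 \<Rightarrow> 'a ^ 3"
  by (simp add: Vector_Spaces.linear_iff vec.vector_space_axioms)

text \<open>The image consists of the multiples of f v by values of \<sigma>, and \<sigma> is
  onto.\<close>

lemma image_span_single:
  assumes "field_automorphism \<sigma>" "semilinear \<sigma> f" shows "f ` vec.span {v} = vec.span {f v}"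
proof -
  have "f ` vec.span {v} = range (\<lambda>k. \<sigma> k *s f v)"
    using assms(2) by (simp add: span_single image_image semilinear_def)
  also have "\<dots> = (\<lambda>k. k *s f v) ` range \<sigma>" by (simp add: image_image)
  also have "range \<sigma> = UNIV" by (rule field_automorphismD(6)[OF assms(1)])
  finally show ?thesis by (simp add: span_single)
qed

lemma semilinear_zero: "semilinear \<sigma> f \<Longrightarrow> f 0 = 0"
  unfolding semilinear_def by (metis add_cancel_left_left)

lemma image_points:
  assumes "field_automorphism \<sigma>" "semilinear \<sigma> f" "inj f" "P \<in> points" shows "f ` P \<in> points"
proof -
  obtain v where v: "v \<noteq> 0" "P = vec.span {v}" using assms(4) points_iff by blast
  have "f v \<noteq> 0" using v assms(3) semilinear_zero[OF assms(2)] by (metis injD)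
  thus ?thesis using image_span_single[OF assms(1,2)] v span_in_points by metis
qed

lemma linear_semilinear: "Vector_Spaces.linear (*s) (*s) f \<longleftrightarrow> semilinear (\<lambda>x. x) f"
  by (simp add: linear_vec_iff semilinear_def)

lemma image_lines:
  assumes "Vector_Spaces.linear (*s) (*s) f" "bij f" "L \<in> lines" shows "f ` L \<in> lines"
proof -
  obtain u v where *: "v \<noteq> 0" "\<forall>k. u \<noteq> k *s v" "L = {a *s u + b *s v | a b. True}"
    using assms(3) unfolding lines_iff by blast
  have f: "f (a *s u) = a *s f u" "f (u + v) = f u + f v" for a u v using assms(1) by (auto simp: linear_vec_iff)
  have inj: "f x = f y \<Longrightarrow> x = y" for x y using assms(2) by (metis bij_is_inj injD)
  have "f 0 = 0" using semilinear_zero assms(1) linear_semilinear by blast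
  hence "f v \<noteq> 0" using *(1) inj[of v 0] by auto
  moreover have "f u \<noteq> k *s f v" for k using *(2) inj[of u "k *s v"] by (auto simp: f)
  moreover have "f ` L = {a *s f u + b *s f v | a b. True}" 
  proof -
    have set_eq: "{a *s u + b *s v | a b. True} = range (\<lambda>p. fst p *s u + snd p *s v)" for u v :: "'a ^ 3"
    proof safe
      fix a b
      show "a *s u + b *s v \<in> range (\<lambda>p. fst p *s u + snd p *s v)"
        by (rule image_eqI[of _ _ "(a, b)"]) simp_all
    qed blast
    show ?thesis unfolding *(3) set_eq by (simp add: image_image f)
  qed
  ultimately show ?thesis unfolding lines_iff by blast
qed

lemma PGL3_obtain:
  assumes "g \<in> PGL3"
  obtains f where "Vector_Spaces.linear (*s) (*s) f" "bij f" "g = (`) f"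
  using assms by (auto simp: PGL3_def)

lemma Union_image_image: "\<Union>((`) f ` K) = f ` \<Union>K"
  by auto

lemma PGL3_subset: "PGL3 \<subseteq> PGammaL3"
  using id_automorphism unfolding PGL3_def PGammaL3_def linear_semilinear by blast

subsection \<open>Isomorphism is an equivalence relation\<close>

lemma PGammaL3_id: "(\<lambda>P. P) \<in> PGammaL3"
proof -
  have "semilinear (\<lambda>x. x) (\<lambda>x :: 'a ^ 3. x)" by (simp add: semilinear_def)
  moreover have "(\<lambda>P. P) = (`) (\<lambda>x :: 'a ^ 3. x)" by (simp add: fun_eq_iff)
  moreover have "bij (\<lambda>x :: 'a ^ 3. x)" by (simp add: bij_id[unfolded id_def])
  ultimately show ?thesis using id_automorphism unfolding PGammaL3_def by blast
qed

lemma PGammaL3_comp: "g \<in> PGammaL3 \<Longrightarrow> g' \<in> PGammaL3 \<Longrightarrow> g' \<circ> g \<in> PGammaL3"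
proof -
  assume "g \<in> PGammaL3" "g' \<in> PGammaL3"
  then obtain f f' \<sigma> \<sigma>' where *: "field_automorphism \<sigma>" "semilinear \<sigma> f" "bij f" "g = (`) f"
    "field_automorphism \<sigma>'" "semilinear \<sigma>' f'" "bij f'" "g' = (`) f'"
    by (auto simp: PGammaL3_def)
  have "field_automorphism (\<sigma>' \<circ> \<sigma>)" "semilinear (\<sigma>' \<circ> \<sigma>) (f' \<circ> f)" "bij (f' \<circ> f)"
    using * by (auto simp: field_automorphism_def semilinear_def intro: bij_comp)
  moreover have "g' \<circ> g = (`) (f' \<circ> f)" using * by (auto simp: fun_eq_iff image_comp)
  ultimately show ?thesis unfolding PGammaL3_def by blast
qed

lemma inv_semilinear:
  assumes "field_automorphism \<sigma>" "semilinear \<sigma> f" "bij f" shows "semilinear (inv \<sigma>) (inv f)"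
proof -
  have s: "f (inv f v) = v" "inv f (f v) = v" "\<sigma> (inv \<sigma> c) = c" for v c
    using assms(3) field_automorphismD(6)[OF assms(1)] by (simp_all add: bij_is_inj bij_is_surj surj_f_inv_f)
  have "f (inv f u + inv f v) = u + v" "f (inv \<sigma> c *s inv f v) = c *s v" for u v c
    using assms(2) by (simp_all add: semilinear_def s)
  thus ?thesis unfolding semilinear_def by (metis s(2))
qed

lemma PGammaL3_inv:
  assumes "g \<in> PGammaL3" shows "\<exists>g'\<in>PGammaL3. \<forall>P. g' (g P) = P"
proof -
  obtain f \<sigma> where *: "field_automorphism \<sigma>" "semilinear \<sigma> f" "bij f" "g = (`) f"
    using assms by (auto simp: PGammaL3_def)
  have "(`) (inv f) \<in> PGammaL3"
    using inv_field_automorphism[OF *(1)] inv_semilinear[OF *(1-3)] *(3) bij_imp_bij_inv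
    unfolding PGammaL3_def by blast
  moreover have "inv f ` g P = P" for P using * by (simp add: image_inv_f_f bij_is_inj)
  ultimately show ?thesis by blast
qed

lemma isomorphic_refl: "(K, K) \<in> isomorphic"
  using PGammaL3_id by (auto simp: isomorphic_def intro!: bexI[of _ "\<lambda>P. P"])

lemma isomorphic_sym: "(K, K') \<in> isomorphic \<Longrightarrow> (K', K) \<in> isomorphic"
proof -
  assume "(K, K') \<in> isomorphic"
  then obtain g where g: "g \<in> PGammaL3" "K' = g ` K" by (auto simp: isomorphic_def)
  obtain g' where g': "g' \<in> PGammaL3" "\<forall>P. g' (g P) = P" using PGammaL3_inv[OF g(1)] by blast
  have "g' ` K' = K" using g' by (simp add: g image_image)
  thus ?thesis using g' by (auto simp: isomorphic_def)
qed

lemma isomorphic_trans: "(K, K') \<in> isomorphic \<Longrightarrow> (K', K'') \<in> isomorphic \<Longrightarrow> (K, K'') \<in> isomorphic"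
proof -
  assume "(K, K') \<in> isomorphic" "(K', K'') \<in> isomorphic"
  then obtain g g' where "g \<in> PGammaL3" "K' = g ` K" "g' \<in> PGammaL3" "K'' = g' ` K'"
    by (auto simp: isomorphic_def)
  hence "g' \<circ> g \<in> PGammaL3" "(g' \<circ> g) ` K = K''" using PGammaL3_comp by (auto simp: image_comp)
  thus ?thesis unfolding isomorphic_def by blast
qed

section \<open>Cones of conics with common nucleus\<close>

fun qf :: "'a::field conic_param \<Rightarrow> 'a ^ 3 \<Rightarrow> 'a" where
  "qf (\<alpha>, \<beta>, \<mu>) v = \<alpha> * (v $ 1)\<^sup>2 + v $ 1 * v $ 2 + \<beta> * (v $ 2)\<^sup>2 + \<mu> * (v $ 3)\<^sup>2"

text \<open>The vectors covered by \<open>conics_union C\<close>; the first part is the nucleus F0,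
  as \<open>F0_eq\<close> shows.\<close>

definition arc_cone :: "'a::field conic_param set \<Rightarrow> ('a ^ 3) set" where
  "arc_cone C = {v. v $ 1 = 0 \<and> v $ 2 = 0} \<union> {v. \<exists>c\<in>C. qf c v = 0}"

lemma qf_scale: "qf c (k *s v) = k\<^sup>2 * qf c v"
  by (cases c) (simp add: algebra_simps power2_eq_square)

lemma conic_points_qf: "conic_points c = {P \<in> points. \<forall>v\<in>P. qf c v = 0}"
  by (cases c) simp

lemma span_in_conic: "v \<noteq> 0 \<Longrightarrow> qf c v = 0 \<Longrightarrow> vec.span {v} \<in> conic_points c"
  using span_in_points[of v] by (auto simp: conic_points_qf span_single qf_scale)

lemma F0_eq: "F0 = {v :: 'a::{field,finite} ^ 3. v $ 1 = 0 \<and> v $ 2 = 0}"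
proof -
  have "v \<in> range (\<lambda>k. k *s vec3 0 0 1)" if "v $ 1 = 0" "v $ 2 = 0" for v :: "'a ^ 3"
    by (rule image_eqI[of _ _ "v $ 3"]) (simp_all add: vec3_eq_iff that)
  thus ?thesis unfolding F0_def span_single by auto
qed

lemma F0_in_points: "F0 \<in> points"
proof -
  have "vec3 0 0 1 \<noteq> (0 :: 'a ^ 3)" by (simp add: vec3_eq_iff)
  thus ?thesis unfolding F0_def by (rule span_in_points)
qed

lemma conics_union_points: "conics_union C \<subseteq> points"
  using F0_in_points by (auto simp: conics_union_def conic_points_qf)

lemma Union_conics_union: "\<Union>(conics_union C) = arc_cone C"
proof -
  have *: "v \<in> \<Union>(conics_union C)" if "c \<in> C" "qf c v = 0" for c v
  proof (cases "v = 0")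
    case True
    thus ?thesis using zero_in_points[OF F0_in_points] by (auto simp: conics_union_def)
  next
    case False
    hence "vec.span {v} \<in> conics_union C" using that span_in_conic[OF False, of c] by (auto simp: conics_union_def)
    thus ?thesis using vec.span_base[of v "{v}"] by blast
  qed
  have F0: "\<Union>(conics_union C) \<supseteq> {v. v $ 1 = 0 \<and> v $ 2 = 0}"
    unfolding conics_union_def F0_eq[symmetric] by blast
  have "\<Union>(conics_union C) \<subseteq> arc_cone C"
    unfolding arc_cone_def F0_eq[symmetric] by (auto simp: conics_union_def conic_points_qf)
  moreover have "arc_cone C \<subseteq> \<Union>(conics_union C)" using * F0 by (auto simp only: arc_cone_def)
  ultimately show ?thesis by (rule equalityI)
qed

lemma image_conics_union_iff:
  assumes "field_automorphism \<sigma>" "semilinear \<sigma> f" "bij f"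
  shows "(`) f ` conics_union C = conics_union C' \<longleftrightarrow> f ` arc_cone C = arc_cone C'"
proof -
  have "(`) f ` conics_union C \<subseteq> points"
    using image_points[OF assms(1,2)] assms(3) conics_union_points[of C] by (auto simp: bij_is_inj)
  thus ?thesis using point_set_eqI[of "(`) f ` conics_union C" "conics_union C'"] conics_union_points
    unfolding Union_conics_union[symmetric] by (metis Union_image_image)
qed

text \<open>Normalized homogeneous coordinates \<open>(x, y)\<close> of the lines through \<open>F0\<close>.\<close>

definition dirs :: "('a::field \<times> 'a) set" where
  "dirs = insert (1, 0) (range (\<lambda>t. (t, 1)))"

lemma dirs_cases:
  assumes "(d, e) \<in> dirs"
  obtains "d = 1" "e = 0" | "e = 1"
  using assms by (auto simp: dirs_def)

lemma dirs_nonzero: "(0, 0) \<notin> dirs" by (auto simp: dirs_def)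

lemma card_dirs: "card (dirs :: ('a::{field,finite} \<times> 'a) set) = CARD('a) + 1"
proof -
  have "(1, 0) \<notin> range (\<lambda>t::'a. (t, 1::'a))" by auto
  thus ?thesis unfolding dirs_def by (simp add: card_image inj_on_def)
qed

lemma dirs_exists:
  assumes "(x, y) \<noteq> (0, 0 :: 'a::field)"
  shows "\<exists>k d e. k \<noteq> 0 \<and> (d, e) \<in> dirs \<and> x = k * d \<and> y = k * e"
proof (cases "y = 0")
  case True
  thus ?thesis using assms by (intro exI[of _ x] exI[of _ 1] exI[of _ 0]) (auto simp: dirs_def)
next
  case False
  thus ?thesis by (intro exI[of _ y] exI[of _ "x / y"] exI[of _ 1]) (auto simp: dirs_def)
qed

lemma dirs_unique: "(d, e) \<in> dirs \<Longrightarrow> (d', e') \<in> dirs \<Longrightarrow> d' = k * d \<Longrightarrow> e' = k * (e::'a::field) \<Longrightarrow> k = 1"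
  by (auto simp: dirs_def)

section \<open>Intersections of closed sets of conics with lines\<close>

context char_two_field
begin

text \<open>With s = x / y, a zero with y \<noteq> 0 would give (a s)^2 + a s + a b = 0, in which
  the first two terms have the same trace.\<close>

lemma anisotropic:
  assumes "abs_trace (a * b) = 1" "a * x\<^sup>2 + x * y + b * y\<^sup>2 = (0::'a)" shows "x = 0 \<and> y = 0"
proof (cases "y = 0")
  case True
  have "a \<noteq> 0" using assms(1) by auto
  thus ?thesis using assms(2) True by simp
next
  case False
  define s where "s = x / y"
  have "x = s * y" using False by (simp add: s_def)
  hence "(a * s\<^sup>2 + s + b) * y\<^sup>2 = 0"
    using assms(2) by (simp add: power2_eq_square algebra_simps)
  hence "a * (a * s\<^sup>2 + s + b) = 0" using False by simp
  hence "(a * s)\<^sup>2 + a * s + a * b = 0" by (simp add: power2_eq_square algebra_simps)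
  hence "abs_trace ((a * s)\<^sup>2 + a * s + a * b) = 0" by simp
  thus ?thesis using assms(1) by (simp add: trace_add trace_sq)
qed

text \<open>For a \<noteq> 0, multiplication by a turns a t^2 + t + b into (a t)^2 + a t + a b,
  which \<open>artin_schreier\<close> solves when Tr(a b) = 0; if a t = k is one solution, k + 1 is
  the other. For a = 0 one root is the direction (1, 0).\<close>

lemma card_dirs_roots:
  "card {p \<in> dirs. a * (fst p)\<^sup>2 + fst p * snd p + b * (snd p)\<^sup>2 = (0::'a)} =
    (if abs_trace (a * b) = 1 then 0 else 2)"
proof (cases "abs_trace (a * b) = 1")
  case True
  have e: "{p \<in> dirs. a * (fst p)\<^sup>2 + fst p * snd p + b * (snd p)\<^sup>2 = 0} = {}"
  proof (rule ccontr)
    assume "\<not> ?thesis"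
    then obtain p where p: "p \<in> dirs" "a * (fst p)\<^sup>2 + fst p * snd p + b * (snd p)\<^sup>2 = 0" by blast
    have "p = (0, 0)" using anisotropic[OF True p(2)] by (simp add: prod_eq_iff)
    thus False using p(1) dirs_nonzero by blast
  qed
  show ?thesis unfolding e using True by simp
next
  case False
  have "\<exists>p p'. p \<noteq> p' \<and> {p \<in> dirs. a * (fst p)\<^sup>2 + fst p * snd p + b * (snd p)\<^sup>2 = 0} = {p, p'}"
  proof (cases "a = 0")
    case True
    have "{p \<in> dirs. a * (fst p)\<^sup>2 + fst p * snd p + b * (snd p)\<^sup>2 = 0} = {(1, 0), (b, 1)}"
    proof (intro equalityI subsetI)
      fix p assume "p \<in> {p \<in> dirs. a * (fst p)\<^sup>2 + fst p * snd p + b * (snd p)\<^sup>2 = 0}"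
      hence p: "(fst p, snd p) \<in> dirs" "fst p * snd p + b * (snd p)\<^sup>2 = 0" by (simp_all add: True)
      from p(1) have "p = (1, 0) \<or> p = (b, 1)"
        by (cases rule: dirs_cases) (use p(2) in \<open>simp_all add: prod_eq_iff add_eq_0_iff_eq\<close>)
      thus "p \<in> {(1, 0), (b, 1)}" by simp
    qed (auto simp: True dirs_def)
    thus ?thesis by (intro exI[of _ "(1, 0)"] exI[of _ "(b, 1)"]) simp
  next
    case a: False
    have "abs_trace (a * b) = 0" using False trace_cases by blast
    then obtain k where k: "k\<^sup>2 + k = a * b" using artin_schreier by blast
    have root: "a * t\<^sup>2 + t + b = 0 \<longleftrightarrow> t = k / a \<or> t = (k + 1) / a" for t
    proof -
      have "a * t\<^sup>2 + t + b = 0 \<longleftrightarrow> a * (a * t\<^sup>2 + t + b) = 0" using a by simp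
      also have "a * (a * t\<^sup>2 + t + b) = (a * t + k) * (a * t + k + 1)"
        by (simp add: distrib_left distrib_right k[symmetric] power2_eq_square mult_ac add_ac)
      also have "\<dots> = 0 \<longleftrightarrow> a * t = k \<or> a * t = k + 1"
        by (simp add: add.assoc add_eq_0_iff_eq)
      also have "\<dots> \<longleftrightarrow> t = k / a \<or> t = (k + 1) / a" using a by (auto simp: field_simps)
      finally show ?thesis .
    qed
    have "{p \<in> dirs. a * (fst p)\<^sup>2 + fst p * snd p + b * (snd p)\<^sup>2 = 0} = {(k / a, 1), ((k + 1) / a, 1)}"
    proof (intro equalityI subsetI)
      fix p assume "p \<in> {p \<in> dirs. a * (fst p)\<^sup>2 + fst p * snd p + b * (snd p)\<^sup>2 = 0}"
      hence p: "(fst p, snd p) \<in> dirs" "a * (fst p)\<^sup>2 + fst p * snd p + b * (snd p)\<^sup>2 = 0" by simp_all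
      from p(1) have "snd p = 1" by (cases rule: dirs_cases) (use p(2) a in simp_all)
      hence "fst p = k / a \<or> fst p = (k + 1) / a" using p(2) root[of "fst p"] by simp
      thus "p \<in> {(k / a, 1), ((k + 1) / a, 1)}" using \<open>snd p = 1\<close> by (auto simp: prod_eq_iff)
    next
      fix p :: "'a \<times> 'a" assume "p \<in> {(k / a, 1), ((k + 1) / a, 1)}"
      hence p: "snd p = 1" "fst p = k / a \<or> fst p = (k + 1) / a" by auto
      hence "p \<in> dirs" by (simp add: dirs_def image_iff prod_eq_iff)
      thus "p \<in> {p \<in> dirs. a * (fst p)\<^sup>2 + fst p * snd p + b * (snd p)\<^sup>2 = 0}"
        using p(1) p(2)[folded root] by simp
    qed
    moreover have "k / a \<noteq> (k + 1) / a" using a by simp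
    ultimately show ?thesis by (intro exI[of _ "(k / a, 1)"] exI[of _ "((k + 1) / a, 1)"]) simp
  qed
  then obtain p p' where "p \<noteq> p'"
    "{p \<in> dirs. a * (fst p)\<^sup>2 + fst p * snd p + b * (snd p)\<^sup>2 = 0} = {p, p'}" by blast
  thus ?thesis using False by (simp only: if_False) simp
qed

lemma closed_conicsD:
  assumes "closed_conics C" "c \<in> C"
  shows "admissible c" "c' \<in> C \<Longrightarrow> conic_mu c = conic_mu c' \<Longrightarrow> c = c'" "c' \<in> C \<Longrightarrow> c \<noteq> c' \<Longrightarrow> c \<oplus> c' \<in> C"
  using assms by (auto simp: closed_conics_def dest: inj_onD)

text \<open>Combining the two equations so that z^2 cancels leaves E x^2 + s x y + G y^2 = 0. The
  parameters of the composition are E' / s and G' / s, and E G + E' G' = (\<alpha> \<beta> +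
  \<alpha>' \<beta>') s^2. Hence Tr(E G / s^2) = 1 + 1 + 1 = 1 and the binary form is
  anisotropic.\<close>

lemma closed_conics_disjoint:
  assumes C: "closed_conics (C :: 'a conic_param set)" "c \<in> C" "c' \<in> C" "c \<noteq> c'" and v: "qf c v = 0" "qf c' v = 0"
  shows "v = 0"
proof -
  obtain \<alpha> \<beta> \<mu> \<alpha>' \<beta>' \<mu>' where c: "c = (\<alpha>, \<beta>, \<mu>)" "c' = (\<alpha>', \<beta>', \<mu>')" by (cases c, cases c') auto
  define s E G where "s = \<mu> + \<mu>'" and "E = \<alpha> * \<mu>' + \<alpha>' * \<mu>" and "G = \<beta> * \<mu>' + \<beta>' * \<mu>"
  have adm: "abs_trace (\<alpha> * \<beta>) = 1" "\<mu> \<noteq> 0" "abs_trace (\<alpha>' * \<beta>') = 1" "\<mu>' \<noteq> 0"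
    using closed_conicsD(1)[OF C(1,2)] closed_conicsD(1)[OF C(1,3)] by (simp_all add: c)
  have "\<mu> \<noteq> \<mu>'" using closed_conicsD(2)[OF C(1-3)] C(4) by (auto simp: c)
  hence s: "s \<noteq> 0" by (simp add: s_def add_eq_0_iff_eq)
  define E' G' where "E' = \<alpha> * \<mu> + \<alpha>' * \<mu>'" and "G' = \<beta> * \<mu> + \<beta>' * \<mu>'"
  have "admissible (c \<oplus> c')"
    by (rule closed_conicsD(1)[OF C(1) closed_conicsD(3)[OF C]])
  hence tr: "abs_trace (E' / s * (G' / s)) = 1" by (simp add: c E'_def G'_def s_def)
  have "E * G + E' * G' = (\<alpha> * \<beta> + \<alpha>' * \<beta>') * s\<^sup>2"
    unfolding E_def G_def E'_def G'_def s_def sum_sq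
    by (simp add: power2_eq_square distrib_left distrib_right mult_ac add_ac)
  hence "E / s * (G / s) + E' / s * (G' / s) = \<alpha> * \<beta> + \<alpha>' * \<beta>'"
    using s by (simp add: power2_eq_square field_simps)
  hence "abs_trace (E / s * (G / s)) + abs_trace (E' / s * (G' / s)) = abs_trace (\<alpha> * \<beta>) + abs_trace (\<alpha>' * \<beta>')"
    by (metis trace_add)
  hence tr1: "abs_trace (E / s * (G / s)) = 1" using tr adm by (simp add: add_eq_0_iff_eq)
  have "\<mu>' * qf c v + \<mu> * qf c' v = E * (v $ 1)\<^sup>2 + s * (v $ 1 * v $ 2) + G * (v $ 2)\<^sup>2"
    unfolding c E_def G_def s_def by (simp add: distrib_left distrib_right mult_ac add_ac)
  hence "E * (v $ 1)\<^sup>2 + s * (v $ 1 * v $ 2) + G * (v $ 2)\<^sup>2 = 0" using v by simp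
  hence "(E * (v $ 1)\<^sup>2 + s * (v $ 1 * v $ 2) + G * (v $ 2)\<^sup>2) / s = 0" by simp
  hence "E / s * (v $ 1)\<^sup>2 + v $ 1 * v $ 2 + G / s * (v $ 2)\<^sup>2 = 0"
    using s by (simp add: add_divide_distrib)
  hence "v $ 1 = 0 \<and> v $ 2 = 0" by (rule anisotropic[OF tr1])
  moreover from this have "v $ 3 = 0" using v adm by (simp add: c)
  ultimately show ?thesis by (simp add: vec3_eq_iff)
qed

lemma ex_conic_third:
  assumes "\<mu> \<noteq> 0" shows "\<exists>z. qf (\<alpha>, \<beta>, \<mu>) (vec3 x y (z::'a)) = 0"
proof -
  obtain z where "z\<^sup>2 = (\<alpha> * x\<^sup>2 + x * y + \<beta> * y\<^sup>2) / \<mu>" using ex_sqrt by blast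
  thus ?thesis using assms by (intro exI[of _ z]) simp
qed

lemma conic_third_unique:
  assumes "\<mu> \<noteq> 0" "qf (\<alpha>, \<beta>, \<mu>) u = 0" "qf (\<alpha>, \<beta>, \<mu>) v = 0" "u $ 1 = v $ 1" "u $ 2 = (v $ 2 :: 'a)"
  shows "u = v"
proof -
  have "\<mu> * (u $ 3)\<^sup>2 = \<mu> * (v $ 3)\<^sup>2" using assms by (simp add: add_eq_0_iff_eq)
  thus ?thesis using assms by (simp add: vec3_eq_iff sq_eq_iff)
qed

lemma conic_not_axis: "\<mu> \<noteq> 0 \<Longrightarrow> qf (\<alpha>, \<beta>, \<mu>) v = 0 \<Longrightarrow> v $ 1 = 0 \<Longrightarrow> v $ 2 = 0 \<Longrightarrow> v = (0 :: 'a ^ 3)"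
  by (simp add: vec3_eq_iff)

text \<open>A line through the nucleus is tangent to every conic: for a given direction, z is a
  unique square root. The points of contact differ because the conics are disjoint.\<close>

lemma card_line_through_F0:
  assumes C: "closed_conics (C :: 'a conic_param set)" and de: "(d, e) \<in> dirs"
  shows "card {P \<in> conics_union C. P \<subseteq> {v. v $ 1 * e = v $ 2 * d}} = 1 + card C"
proof -
  let ?L = "{v. v $ 1 * e = v $ 2 * d}"
  have mu: "\<exists>\<alpha> \<beta> \<mu>. c = (\<alpha>, \<beta>, \<mu>) \<and> \<mu> \<noteq> 0" if "c \<in> C" for c
    using closed_conicsD(1)[OF C that] by (cases c) simp
  hence "\<forall>c\<in>C. \<exists>z. qf c (vec3 d e z) = 0" using ex_conic_third by metis
  then obtain r where r: "\<And>c. c \<in> C \<Longrightarrow> qf c (vec3 d e (r c)) = 0" by metis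
  define p where "p c = vec3 d e (r c)" for c
  have p0: "p c \<noteq> 0" for c using de dirs_nonzero by (auto simp: p_def vec3_eq_iff)
  have p: "vec.span {p c} \<in> conic_points c" if "c \<in> C" for c
    using r[OF that] p0[of c] by (intro span_in_conic) (simp_all add: p_def)
  have uniq: "P = vec.span {p c}" if cP: "c \<in> C" "P \<in> conic_points c" "P \<subseteq> ?L" for c P
  proof -
    obtain v where v: "v \<noteq> 0" "P = vec.span {v}" using cP(2) by (auto simp: conic_points_qf points_iff)
    hence vP: "v \<in> P" by (simp add: vec.span_base)
    hence v1: "v $ 1 * e = v $ 2 * d" "qf c v = 0" using cP by (auto simp: conic_points_qf)
    obtain \<alpha> \<beta> \<mu> where c: "c = (\<alpha>, \<beta>, \<mu>)" "\<mu> \<noteq> 0" using mu[OF cP(1)] by blast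
    have "(v $ 1, v $ 2) \<noteq> (0, 0)" using conic_not_axis[of \<mu> \<alpha> \<beta> v] c v1 v by auto
    hence "\<exists>k. k \<noteq> 0 \<and> v $ 1 = k * d \<and> v $ 2 = k * e" using de v1(1) by (auto simp: dirs_def)
    then obtain k where k: "k \<noteq> 0" "v $ 1 = k * d" "v $ 2 = k * e" by blast
    have "(1 / k) *s v = p c"
      using r[OF cP(1)] v1(2) k c by (intro conic_third_unique[of \<mu> \<alpha> \<beta>]) (simp_all add: p_def qf_scale del: qf.simps)
    hence "p c \<in> P" using v by (metis span_single rangeI)
    thus ?thesis using cP p0 by (intro points_eq_span) (auto simp: conic_points_qf)
  qed
  have sub: "vec.span {p c} \<subseteq> ?L" for c by (auto simp: span_single p_def)
  have F0sub: "F0 \<subseteq> ?L" by (auto simp: F0_eq)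
  have "{P \<in> conics_union C. P \<subseteq> ?L} = insert F0 ((\<lambda>c. vec.span {p c}) ` C)"
    using uniq p sub F0sub unfolding conics_union_def by blast
  moreover have "F0 \<notin> (\<lambda>c. vec.span {p c}) ` C"
  proof
    assume "F0 \<in> (\<lambda>c. vec.span {p c}) ` C"
    then obtain c where "F0 = vec.span {p c}" by blast
    hence "p c \<in> F0" by (metis insertI1 vec.span_base)
    thus False using de dirs_nonzero by (auto simp: F0_eq p_def)
  qed
  moreover have "inj_on (\<lambda>c. vec.span {p c}) C"
  proof (rule inj_onI, rule ccontr)
    fix c c' assume *: "c \<in> C" "c' \<in> C" "vec.span {p c} = vec.span {p c'}" "c \<noteq> c'"
    have "p c \<in> vec.span {p c'}" using *(3) by (metis insertI1 vec.span_base)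
    hence "qf c' (p c) = 0" using p[OF *(2)] by (auto simp: conic_points_qf)
    thus False using closed_conics_disjoint[OF C *(1,2,4), of "p c"] r[OF *(1)] p0 by (simp add: p_def)
  qed
  ultimately show ?thesis by (simp add: card_image)
qed

text \<open>Substituting z = a x + b y into a conic leaves a binary form with outer coefficients
  \<alpha> + \<mu> a^2 and \<beta> + \<mu> b^2, whose zeros \<open>card_dirs_roots\<close> counts;
  as the conics are disjoint, the counts add up.\<close>

lemma card_line_off_F0:
  assumes C: "closed_conics (C :: 'a conic_param set)"
  shows "card {P \<in> conics_union C. P \<subseteq> {v. v $ 3 = a * v $ 1 + b * v $ 2}} =
    (\<Sum>(\<alpha>, \<beta>, \<mu>)\<in>C. if abs_trace ((\<alpha> + \<mu> * a\<^sup>2) * (\<beta> + \<mu> * b\<^sup>2)) = 1 then 0 else 2)"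
proof -
  let ?L = "{v. v $ 3 = a * v $ 1 + b * v $ 2}"
  define p where "p t = vec3 (fst t) (snd t) (a * fst t + b * snd t)" for t
  define S where "S c = {P \<in> conic_points c. P \<subseteq> ?L}" for c
  define T where "T c = {t \<in> dirs. qf c (p t) = 0}" for c
  have p0: "p t \<noteq> 0" if "t \<in> dirs" for t
    using that dirs_nonzero by (cases t) (auto simp: p_def vec3_eq_iff)
  have "S c = (\<lambda>t. vec.span {p t}) ` T c" for c
  proof (rule equalityI)
    show "(\<lambda>t. vec.span {p t}) ` T c \<subseteq> S c"
    proof safe
      fix t assume t: "t \<in> T c"
      hence "vec.span {p t} \<in> conic_points c" using p0 by (intro span_in_conic) (auto simp: T_def)
      moreover have "vec.span {p t} \<subseteq> ?L" by (auto simp: span_single p_def algebra_simps)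
      ultimately show "vec.span {p t} \<in> S c" by (simp add: S_def)
    qed
    show "S c \<subseteq> (\<lambda>t. vec.span {p t}) ` T c"
    proof
      fix P assume P: "P \<in> S c"
      then obtain v where v: "v \<noteq> 0" "P = vec.span {v}" by (auto simp: S_def conic_points_qf points_iff)
      hence "v \<in> P" by (simp add: vec.span_base)
      hence v1: "v $ 3 = a * v $ 1 + b * v $ 2" "qf c v = 0" using P by (auto simp: S_def conic_points_qf)
      hence "(v $ 1, v $ 2) \<noteq> (0, 0)" using v by (auto simp: vec3_eq_iff)
      then obtain k d e where k: "k \<noteq> 0" "(d, e) \<in> dirs" "v $ 1 = k * d" "v $ 2 = k * e"
        using dirs_exists by blast
      have pv: "p (d, e) = (1 / k) *s v" using k v1 by (simp add: p_def vec3_eq_iff field_simps)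
      hence "(d, e) \<in> T c" using k v1 by (simp add: T_def qf_scale)
      moreover have "p (d, e) \<in> P" using v pv by (metis span_single rangeI)
      hence "P = vec.span {p (d, e)}" using P p0[OF k(2)] by (intro points_eq_span) (auto simp: S_def conic_points_qf)
      ultimately show "P \<in> (\<lambda>t. vec.span {p t}) ` T c" by blast
    qed
  qed
  moreover have inj: "inj_on (\<lambda>t. vec.span {p t}) (T c)" for c
  proof (rule inj_onI)
    fix t t' assume *: "t \<in> T c" "t' \<in> T c" "vec.span {p t} = vec.span {p t'}"
    have "p t' \<in> vec.span {p t}" using *(3) by (metis insertI1 vec.span_base)
    then obtain k where k: "p t' = k *s p t" by (auto simp: span_single)
    hence "fst t' = k * fst t" "snd t' = k * snd t" by (simp_all add: p_def vec3_eq_iff)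
    moreover from this have "k = 1" using * by (cases t, cases t') (auto simp: T_def intro: dirs_unique)
    ultimately show "t = t'" by (simp add: prod_eq_iff)
  qed
  ultimately have card_S: "card (S c) = card (T c)" for c by (simp add: card_image)
  have card_T: "card (T (\<alpha>, \<beta>, \<mu>)) = (if abs_trace ((\<alpha> + \<mu> * a\<^sup>2) * (\<beta> + \<mu> * b\<^sup>2)) = 1 then 0 else 2)" for \<alpha> \<beta> \<mu>
  proof -
    have "qf (\<alpha>, \<beta>, \<mu>) (p t) = (\<alpha> + \<mu> * a\<^sup>2) * (fst t)\<^sup>2 + fst t * snd t + (\<beta> + \<mu> * b\<^sup>2) * (snd t)\<^sup>2" for t
      by (simp add: p_def sum_sq power_mult_distrib distrib_left distrib_right mult_ac add_ac)
    thus ?thesis unfolding T_def by (simp only: card_dirs_roots)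
  qed
  have "F0 \<notin> {P. P \<subseteq> ?L}"
  proof
    assume "F0 \<in> {P. P \<subseteq> ?L}"
    moreover have "vec3 0 0 1 \<in> F0" by (simp add: F0_eq)
    ultimately have "vec3 0 0 (1::'a) \<in> ?L" by blast
    thus False by simp
  qed
  hence "{P \<in> conics_union C. P \<subseteq> ?L} = (\<Union>c\<in>C. S c)"
    unfolding conics_union_def S_def by blast
  also have "card \<dots> = (\<Sum>c\<in>C. card (S c))"
  proof (rule card_UN_disjoint)
    show "\<forall>c\<in>C. \<forall>c'\<in>C. c \<noteq> c' \<longrightarrow> S c \<inter> S c' = {}"
    proof (intro ballI impI, rule ccontr)
      fix c c' assume *: "c \<in> C" "c' \<in> C" "c \<noteq> c'" "S c \<inter> S c' \<noteq> {}"
      then obtain P where P: "P \<in> conic_points c" "P \<in> conic_points c'" by (auto simp: S_def)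
      hence "P \<in> points" by (simp add: conic_points_qf)
      then obtain v where v: "v \<in> P" "v \<noteq> 0" using points_nonzero by blast
      hence "qf c v = 0" "qf c' v = 0" using P by (simp_all add: conic_points_qf)
      thus False using closed_conics_disjoint[OF C *(1-3), of v] v by simp
    qed
  qed simp_all
  also have "\<dots> = (\<Sum>(\<alpha>, \<beta>, \<mu>)\<in>C. if abs_trace ((\<alpha> + \<mu> * a\<^sup>2) * (\<beta> + \<mu> * b\<^sup>2)) = 1 then 0 else 2)"
    by (rule sum.cong) (auto simp: card_S card_T split del: if_split)
  finally show ?thesis .
qed

lemma line_cases:
  assumes "L \<in> lines"
  shows "(\<exists>d e. (d, e) \<in> dirs \<and> L = {v. v $ 1 * e = v $ 2 * (d::'a)}) \<or>
    (\<exists>a b. L = {v. v $ 3 = a * v $ 1 + b * v $ 2})"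
proof -
  obtain u v where uv: "v \<noteq> 0" "\<forall>k. u \<noteq> k *s v" "L = {a *s u + b *s v | a b. True}"
    using assms unfolding lines_iff by blast
  \<comment> \<open>The cross product of u and v, without signs in characteristic 2. Its third entry
    vanishes exactly for the lines through F0.\<close>
  define n1 n2 n3 where n: "n1 = u $ 2 * v $ 3 + u $ 3 * v $ 2" "n2 = u $ 3 * v $ 1 + u $ 1 * v $ 3"
    "n3 = u $ 1 * v $ 2 + u $ 2 * v $ 1"
  have L: "w \<in> L \<longleftrightarrow> (\<exists>a b. \<forall>i. w $ i = a * u $ i + b * v $ i)" for w
    unfolding uv(3) by (auto simp: vec_eq_iff)
  have sub: "n1 * w $ 1 + n2 * w $ 2 + n3 * w $ 3 = 0" if "w \<in> L" for w
  proof -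
    obtain a b where "\<forall>i. w $ i = a * u $ i + b * v $ i" using \<open>w \<in> L\<close> L by blast
    thus ?thesis by (simp add: n distrib_left distrib_right mult_ac add_ac)
  qed
  show ?thesis
  proof (cases "n3 = 0")
    case False
    have "w \<in> L" if "w $ 3 = (n1 / n3) * w $ 1 + (n2 / n3) * w $ 2" for w
    proof -
      \<comment> \<open>Cramer's rule on the first two coordinates, with determinant
        \<open>n3\<close>. If \<open>n3\<close> is 0, another pair of coordinates is used below,
        with determinant \<open>n2\<close> or \<open>n1\<close>.\<close>
      define a b where ab: "a = (w $ 1 * v $ 2 + w $ 2 * v $ 1) / n3" "b = (u $ 1 * w $ 2 + u $ 2 * w $ 1) / n3"
      have "n3 * w $ i = n3 * (a * u $ i + b * v $ i)" for i
      proof -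
        have *: "n3 * (a * u $ i + b * v $ i) = (w $ 1 * v $ 2 + w $ 2 * v $ 1) * u $ i + (u $ 1 * w $ 2 + u $ 2 * w $ 1) * v $ i"
          using False by (simp add: ab distrib_left)
        have "n3 * w $ 3 = n1 * w $ 1 + n2 * w $ 2" using that False by (simp add: field_simps)
        hence "\<forall>i. n3 * w $ i = (w $ 1 * v $ 2 + w $ 2 * v $ 1) * u $ i + (u $ 1 * w $ 2 + u $ 2 * w $ 1) * v $ i"
          unfolding forall_3 by (simp add: n distrib_left distrib_right mult_ac add_ac)
        thus ?thesis using * by simp
      qed
      thus ?thesis using False L by auto
    qed
    moreover have "w $ 3 = (n1 / n3) * w $ 1 + (n2 / n3) * w $ 2" if "w \<in> L" for w
    proof -
      have "n3 * w $ 3 = n1 * w $ 1 + n2 * w $ 2" using sub[OF that] by (simp only: add_eq_0_iff_eq)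
      thus ?thesis using False by (simp add: field_simps)
    qed
    ultimately have "L = {w. w $ 3 = (n1 / n3) * w $ 1 + (n2 / n3) * w $ 2}" by blast
    thus ?thesis by blast
  next
    case True
    have "\<exists>k d e. (d, e) \<in> dirs \<and> k \<noteq> 0 \<and> n2 = k * d \<and> n1 = k * e"
    proof -
      have "n1 \<noteq> 0 \<or> n2 \<noteq> 0"
      proof (rule ccontr)
        assume "\<not> ?thesis"
        hence 0: "u $ 2 * v $ 3 = u $ 3 * v $ 2" "u $ 3 * v $ 1 = u $ 1 * v $ 3" "u $ 1 * v $ 2 = u $ 2 * v $ 1"
          using n True by (simp_all add: add_eq_0_iff_eq)
        obtain i where i: "v $ i \<noteq> 0" using uv(1) by (auto simp: vec_eq_iff)
        have "\<forall>j. u $ j * v $ i = u $ i * v $ j"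
          using 0 exhaust_3[of i] unfolding forall_3 by (auto simp: mult.commute)
        hence "u = (u $ i / v $ i) *s v" using i by (simp add: vec_eq_iff field_simps)
        thus False using uv(2) by blast
      qed
      hence "(n2, n1) \<noteq> (0, 0)" by auto
      from dirs_exists[OF this] show ?thesis by blast
    qed
    then obtain k d e where k: "(d, e) \<in> dirs" "k \<noteq> 0" "n2 = k * d" "n1 = k * e" by blast
    have eq: "w $ 1 * e = w $ 2 * d \<longleftrightarrow> n1 * w $ 1 + n2 * w $ 2 = 0" for w
      using k(2) by (auto simp: k(3,4) add_eq_0_iff_eq mult_ac)
    have "w \<in> L" if w: "n1 * w $ 1 + n2 * w $ 2 = 0" for w
    proof (cases "n1 = 0")
      case n1: True
      hence n2: "n2 \<noteq> 0" using k dirs_nonzero by auto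
      hence w2: "w $ 2 = 0" using w n1 by simp
      define a b where ab: "a = (w $ 3 * v $ 1 + w $ 1 * v $ 3) / n2" "b = (u $ 3 * w $ 1 + u $ 1 * w $ 3) / n2"
      have "n2 * w $ i = n2 * (a * u $ i + b * v $ i)" for i
      proof -
        have *: "n2 * (a * u $ i + b * v $ i) = (w $ 3 * v $ 1 + w $ 1 * v $ 3) * u $ i + (u $ 3 * w $ 1 + u $ 1 * w $ 3) * v $ i"
          using n2 by (simp add: ab distrib_left)
        have z: "w $ 3 * n3 = 0" "w $ 1 * n1 = 0" using True n1 by simp_all
        have "(w $ 3 * v $ 1 + w $ 1 * v $ 3) * u $ 2 + (u $ 3 * w $ 1 + u $ 1 * w $ 3) * v $ 2 = w $ 3 * n3 + w $ 1 * n1"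
          by (simp add: n distrib_left distrib_right mult_ac add_ac)
        hence "(w $ 3 * v $ 1 + w $ 1 * v $ 3) * u $ 2 + (u $ 3 * w $ 1 + u $ 1 * w $ 3) * v $ 2 = n2 * w $ 2"
          using z w2 by simp
        hence "\<forall>i. n2 * w $ i = (w $ 3 * v $ 1 + w $ 1 * v $ 3) * u $ i + (u $ 3 * w $ 1 + u $ 1 * w $ 3) * v $ i"
          unfolding forall_3 by (simp add: n distrib_left distrib_right mult_ac add_ac)
        thus ?thesis using * by simp
      qed
      thus ?thesis using n2 L by auto
    next
      case n1: False
      define a b where ab: "a = (w $ 2 * v $ 3 + w $ 3 * v $ 2) / n1" "b = (u $ 2 * w $ 3 + u $ 3 * w $ 2) / n1"
      have "n1 * w $ i = n1 * (a * u $ i + b * v $ i)" for i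
      proof -
        have *: "n1 * (a * u $ i + b * v $ i) = (w $ 2 * v $ 3 + w $ 3 * v $ 2) * u $ i + (u $ 2 * w $ 3 + u $ 3 * w $ 2) * v $ i"
          using n1 by (simp add: ab distrib_left)
        have z: "w $ 3 * n3 = 0" using True by simp
        have "(w $ 2 * v $ 3 + w $ 3 * v $ 2) * u $ 1 + (u $ 2 * w $ 3 + u $ 3 * w $ 2) * v $ 1 = w $ 2 * n2 + w $ 3 * n3"
          by (simp add: n distrib_left distrib_right mult_ac add_ac)
        also have "\<dots> = n1 * w $ 1" using z w by (simp add: add_eq_0_iff_eq mult.commute)
        finally have "\<forall>i. n1 * w $ i = (w $ 2 * v $ 3 + w $ 3 * v $ 2) * u $ i + (u $ 2 * w $ 3 + u $ 3 * w $ 2) * v $ i"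
          unfolding forall_3 by (simp add: n distrib_left distrib_right mult_ac add_ac)
        thus ?thesis using * by simp
      qed
      thus ?thesis using n1 L by auto
    qed
    hence "L = {w. w $ 1 * e = w $ 2 * d}" using sub True eq by auto
    thus ?thesis using k(1) by blast
  qed
qed

section \<open>Additive maps on subgroups of order eight\<close>


text \<open>This is one member of a dual basis for the trace form. If there were no such c, Tr(c x)
  would vanish on the common kernel of Tr(c y) and Tr(c z), and two uses of
  \<open>character_dependent\<close> would put x into the span of y and z.\<close>

lemma ex_dual:
  assumes "x \<notin> {0, y, z, y + (z::'a)}"
  shows "\<exists>c. abs_trace (c * x) = 1 \<and> abs_trace (c * y) = 0 \<and> abs_trace (c * z) = 0"
proof (rule ccontr)
  assume no: "\<not> ?thesis"
  note ch = character_trace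
  have nz: False if "u \<noteq> 0" "\<forall>c. abs_trace (c * u) = 0" for u :: 'a
    using ex_trace_mult[OF that(1)] that(2) by (metis zero_neq_one)
  let ?G = "{c\<in>UNIV. abs_trace (c * y) = 0}"
  have G: "additive_subgroup ?G" by (rule subgroup_kernel[OF additive_subgroup_UNIV ch])
  have all: "u = 0 \<or> u = y" if u: "\<forall>c\<in>?G. abs_trace (c * u) = 0" for u
  proof -
    have "(\<forall>c\<in>UNIV. abs_trace (c * u) = 0) \<or> (\<forall>c\<in>UNIV. abs_trace (c * u) + abs_trace (c * y) = 0)"
      by (rule character_dependent[OF additive_subgroup_UNIV ch ch]) (use u in simp)
    thus ?thesis
    proof
      assume "\<forall>c\<in>UNIV. abs_trace (c * u) = 0"
      thus ?thesis using nz[of u] by blast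
    next
      assume "\<forall>c\<in>UNIV. abs_trace (c * u) + abs_trace (c * y) = 0"
      hence "\<forall>c. abs_trace (c * (u + y)) = 0" by (simp add: distrib_left trace_add)
      hence "u + y = 0" using nz by blast
      thus ?thesis by (simp add: add_eq_0_iff_eq)
    qed
  qed
  have "(\<forall>c\<in>?G. abs_trace (c * x) = 0) \<or> (\<forall>c\<in>?G. abs_trace (c * x) + abs_trace (c * z) = 0)"
    by (rule character_dependent[OF G ch ch]) (use no trace_cases in blast)
  thus False
  proof
    assume "\<forall>c\<in>?G. abs_trace (c * x) = 0"
    thus False using all[of x] assms by blast
  next
    assume "\<forall>c\<in>?G. abs_trace (c * x) + abs_trace (c * z) = 0"
    hence "\<forall>c\<in>?G. abs_trace (c * (x + z)) = 0" by (simp add: distrib_left trace_add)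
    hence "x + z = 0 \<or> x + z = y" by (rule all)
    hence "x = z \<or> x = y + z" by (metis add_eq_0_iff_eq add.commute add_self_left)
    thus False using assms by blast
  qed
qed

lemma additive_zero_gen3:
  assumes T: "\<And>u v. u \<in> gen3 x y z \<Longrightarrow> v \<in> gen3 x y z \<Longrightarrow> T (u + v) = T u + (T v :: 'a)"
    and 0: "T x = 0" "T y = 0" "T z = 0" and u: "u \<in> gen3 x y (z::'a)"
  shows "T u = 0"
proof -
  have in2: "{0, x, y, x + y} \<subseteq> gen3 x y z" by (auto simp: gen3_def adj_def)
  have z: "z \<in> gen3 x y z" by (auto simp: gen3_def adj_def)
  have "T (0 + 0) = T 0 + T 0" using in2 by (intro T) auto
  hence T0: "T 0 = 0" by simp
  have "T (x + y) = T x + T y" using in2 by (intro T) auto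
  hence T2: "T g = 0" if "g \<in> {0, x, y, x + y}" for g using that 0 T0 by auto
  have "T (z + g) = T z + T g" if "g \<in> {0, x, y, x + y}" for g using that in2 z by (intro T) auto
  thus ?thesis using u T2 0 by (auto simp: gen3_def adj_def)
qed

text \<open>The three values of \<phi> on a basis are matched by a combination of the dual basis;
  being 0 or 1, these values can be pulled out of the trace.\<close>

lemma ex_trace_representation:
  assumes A: "additive_subgroup (A :: 'a set)" "card A = 8"
    and \<phi>: "\<And>u v. u \<in> A \<Longrightarrow> v \<in> A \<Longrightarrow> \<phi> (u + v) = \<phi> u + \<phi> v" "\<And>u. u \<in> A \<Longrightarrow> \<phi> u = 0 \<or> \<phi> u = (1::'a)"
  shows "\<exists>c. \<forall>u\<in>A. \<phi> u = abs_trace (c * u)"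
proof -
  obtain x y z where xyz: "x \<in> A - {0}" "y \<in> A - {0, x}" "z \<in> A - {0, x, y, x + y}" "A = gen3 x y z"
    using subgroup8_basis[OF A] .
  have swap: "a + b = d \<longleftrightarrow> a = b + d" for a b d :: 'a by (metis add.commute add_self_left)
  have "x \<notin> {0, y, z, y + z}" "y \<notin> {0, x, z, x + z}" "z \<notin> {0, x, y, x + y}"
    using xyz by (auto simp: swap[symmetric] add.commute)
  then obtain c1 c2 c3 where c:
    "abs_trace (c1 * x) = 1 \<and> abs_trace (c1 * y) = 0 \<and> abs_trace (c1 * z) = 0"
    "abs_trace (c2 * y) = 1 \<and> abs_trace (c2 * x) = 0 \<and> abs_trace (c2 * z) = 0"
    "abs_trace (c3 * z) = 1 \<and> abs_trace (c3 * x) = 0 \<and> abs_trace (c3 * y) = 0"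
    using ex_dual by metis
  define c where "c = \<phi> x * c1 + \<phi> y * c2 + \<phi> z * c3"
  have tr: "abs_trace (\<phi> u * c' * v) = \<phi> u * abs_trace (c' * v)" if "u \<in> A" for u c' v
    using \<phi>(2)[OF that] by auto
  have trc: "abs_trace (c * u) = \<phi> x * abs_trace (c1 * u) + \<phi> y * abs_trace (c2 * u) + \<phi> z * abs_trace (c3 * u)" for u
    using xyz by (simp add: c_def distrib_right trace_add tr)
  have "\<phi> u + abs_trace (c * u) = 0" if "u \<in> A" for u
  proof (rule additive_zero_gen3[where T = "\<lambda>u. \<phi> u + abs_trace (c * u)" and x = x and y = y and z = z])
    show "u \<in> gen3 x y z" using that xyz(4) by simp
    show "\<phi> (u + v) + abs_trace (c * (u + v)) = (\<phi> u + abs_trace (c * u)) + (\<phi> v + abs_trace (c * v))"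
      if "u \<in> gen3 x y z" "v \<in> gen3 x y z" for u v
      using that \<phi>(1)[of u v] xyz(4) by (simp add: distrib_left trace_add add_ac)
  qed (simp_all add: trc c)
  thus ?thesis by (auto simp: add_eq_0_iff_eq)
qed

text \<open>Newton interpolation with additive polynomials: f1 vanishes at 0 and x, and f2 on the
  whole group generated by x and y. An additive map that vanishes on a basis vanishes on A.\<close>

lemma additive_interpolation:
  assumes A: "additive_subgroup (A :: 'a set)" "card A = 8"
    and P: "\<And>u v. u \<in> A \<Longrightarrow> v \<in> A \<Longrightarrow> P (u + v) = P u + (P v :: 'a)"
  shows "\<exists>a0 a1 a2. \<forall>u\<in>A. P u = a0 * u + a1 * u ^ 2 + a2 * u ^ 4"
proof -
  obtain x y z where xyz: "x \<in> A - {0}" "y \<in> A - {0, x}" "z \<in> A - {0, x, y, x + y}" "A = gen3 x y z"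
    using subgroup8_basis[OF A] .
  define f1 where "f1 u = u\<^sup>2 + x * u" for u
  define f2 where "f2 u = (f1 u)\<^sup>2 + f1 y * f1 u" for u
  have f1: "f1 u = u * (u + x)" for u by (simp add: f1_def power2_eq_square distrib_left mult.commute)
  have f2: "f2 u = f1 u * f1 (u + y)" for u by (simp add: f2_def f1_def sum_sq power2_eq_square distrib_left distrib_right mult_ac add_ac)
  have "f1 y \<noteq> 0" using xyz(2) by (simp add: f1 add_eq_0_iff_eq)
  have swap: "a + b = d \<longleftrightarrow> a = b + d" for a b d :: 'a by (metis add.commute add_self_left)
  have "f2 z \<noteq> 0" using xyz(3) swap[of x z y] by (auto simp: f1 f2 add_eq_0_iff_eq add.commute)
  have zero: "f1 x = 0" "f2 x = 0" "f2 y = 0" by (simp_all add: f1_def f2_def power2_eq_square)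
  \<comment> \<open>The conditions at x, y and z form a triangular system.\<close>
  define c0 c1 c2 where "c0 = P x / x" and "c1 = (P y + c0 * y) / f1 y"
    and "c2 = (P z + c0 * z + c1 * f1 z) / f2 z"
  have "P u + (c0 * u + c1 * f1 u + c2 * f2 u) = 0" if "u \<in> A" for u
  proof (rule additive_zero_gen3[where T = "\<lambda>u. P u + (c0 * u + c1 * f1 u + c2 * f2 u)" and x = x and y = y and z = z])
    show "u \<in> gen3 x y z" using that xyz(4) by simp
    show "P (u + v) + (c0 * (u + v) + c1 * f1 (u + v) + c2 * f2 (u + v)) =
        P u + (c0 * u + c1 * f1 u + c2 * f2 u) + (P v + (c0 * v + c1 * f1 v + c2 * f2 v))"
      if "u \<in> gen3 x y z" "v \<in> gen3 x y z" for u v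
    proof -
      have f1_add: "f1 (u + v) = f1 u + f1 v" for u v by (simp add: f1_def sum_sq distrib_left add_ac)
      have "f2 (u + v) = f2 u + f2 v" by (simp add: f2_def f1_add sum_sq distrib_left add_ac)
      thus ?thesis using P[of u v] that xyz(4) by (simp add: f1_add distrib_left add_ac)
    qed
    show "P x + (c0 * x + c1 * f1 x + c2 * f2 x) = 0" using xyz(1) by (simp add: zero c0_def)
    show "P y + (c0 * y + c1 * f1 y + c2 * f2 y) = 0" using \<open>f1 y \<noteq> 0\<close> by (simp add: zero c1_def add_ac)
    show "P z + (c0 * z + c1 * f1 z + c2 * f2 z) = 0" using \<open>f2 z \<noteq> 0\<close> by (simp add: c2_def add_ac)
  qed
  hence "P u = c0 * u + c1 * f1 u + c2 * f2 u" if "u \<in> A" for u using that add_eq_0_iff_eq by blast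
  moreover have "c0 * u + c1 * f1 u + c2 * f2 u =
    (c0 + c1 * x + c2 * f1 y * x) * u + (c1 + c2 * x\<^sup>2 + c2 * f1 y) * u ^ 2 + c2 * u ^ 4" for u
    unfolding f2_def f1_def[of u] sum_sq
    by (simp add: power2_eq_square power4_eq_xxxx distrib_left distrib_right mult_ac add_ac)
  ultimately show ?thesis by metis
qed

section \<open>The arcs attached to isotropic subspaces\<close>

definition mathon_conics :: "'a set \<Rightarrow> 'a \<Rightarrow> 'a conic_param set" where
  "mathon_conics A c = (\<lambda>\<mu>. (1 + \<mu> ^ 3 + c * \<mu>, 1, \<mu>)) ` (A - {0})"

text \<open>Since Tr(1) = 1, this is the trace condition for the conics of
  \<open>mathon_conics A c\<close>; at 0 it holds trivially.\<close>

definition twist :: "'a set \<Rightarrow> 'a \<Rightarrow> bool" where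
  "twist A c \<longleftrightarrow> (\<forall>\<mu>\<in>A. abs_trace (\<mu> ^ 3 + c * \<mu>) = 0)"

lemma ex_twist: "A \<in> isotropic_spaces \<Longrightarrow> \<exists>c. twist A c"
proof -
  assume A: "A \<in> isotropic_spaces"
  have "\<exists>c. \<forall>u\<in>A. abs_trace (u ^ 3) = abs_trace (c * u)"
    by (rule ex_trace_representation)
      (use A trace_cases in \<open>auto simp: isotropic_spaces_def trace_cube_add\<close>)
  then obtain c where "\<forall>u\<in>A. abs_trace (u ^ 3) = abs_trace (c * u)" by blast
  hence "twist A c" by (simp add: twist_def trace_add)
  thus ?thesis ..
qed

lemma inj_mathon_param: "inj_on (\<lambda>\<mu>. (f \<mu>, g \<mu>, \<mu>)) B"
  by (auto intro: inj_onI)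

lemma closed_mathon_conics:
  assumes A: "additive_subgroup A" and c: "twist A c"
  shows "closed_conics (mathon_conics A c)"
  unfolding closed_conics_def
proof (intro conjI ballI impI)
  show "admissible p" if "p \<in> mathon_conics A c" for p
    using that c by (auto simp: mathon_conics_def twist_def trace_add add.assoc)
  show "inj_on conic_mu (mathon_conics A c)" by (auto simp: mathon_conics_def intro: inj_onI)
  fix p p' assume "p \<in> mathon_conics A c" "p' \<in> mathon_conics A c" "p \<noteq> p'"
  then obtain \<mu> \<mu>' where *: "p = (1 + \<mu> ^ 3 + c * \<mu>, 1, \<mu>)" "p' = (1 + \<mu>' ^ 3 + c * \<mu>', 1, \<mu>')"
    "\<mu> \<in> A" "\<mu>' \<in> A" "\<mu> \<noteq> \<mu>'" by (auto simp: mathon_conics_def)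
  define s where "s = \<mu> + \<mu>'"
  have s: "s \<noteq> 0" "s \<in> A" using * A by (auto simp: s_def add_eq_0_iff_eq additive_subgroup_def)
  \<comment> \<open>Multiplied by \<mu>, the first parameter becomes \<mu> + \<mu>^4 + c \<mu>^2,
    each term of which is additive in characteristic 2.\<close>
  have "(1 + \<mu> ^ 3 + c * \<mu>) * \<mu> + (1 + \<mu>' ^ 3 + c * \<mu>') * \<mu>' = (1 + s ^ 3 + c * s) * s"
  proof -
    have "(\<mu> + \<mu>') ^ 4 = \<mu> ^ 4 + \<mu>' ^ 4" using sum_pow2[of \<mu> \<mu>' 2] by simp
    hence "s + s ^ 4 + c * s\<^sup>2 = (\<mu> + \<mu> ^ 4 + c * \<mu>\<^sup>2) + (\<mu>' + \<mu>' ^ 4 + c * \<mu>'\<^sup>2)"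
      by (simp add: s_def sum_sq distrib_left add_ac)
    thus ?thesis by (simp add: power4_eq_xxxx power3_eq_cube power2_eq_square distrib_left distrib_right mult_ac add_ac)
  qed
  hence "p \<oplus> p' = (1 + s ^ 3 + c * s, 1, s)" using s by (simp add: * s_def[symmetric])
  thus "p \<oplus> p' \<in> mathon_conics A c" using s by (auto simp: mathon_conics_def)
qed

lemma subgroup8_card_diff: "additive_subgroup A \<Longrightarrow> card A = 8 \<Longrightarrow> card (A - {0}) = 7"
  by (simp add: additive_subgroup_def)

lemma card_mathon_conics: "additive_subgroup A \<Longrightarrow> card A = 8 \<Longrightarrow> card (mathon_conics A c) = 7"
  unfolding mathon_conics_def using subgroup8_card_diff by (simp add: card_image inj_mathon_param)

text \<open>The line z = a x + b y meets the conic with parameter \<mu> in two points exactly if l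
  \<mu> = 1, and l is additive. So either none or four of the seven conics are secant to it, which
  gives 0 or 8 points. A line through F0 has 1 + 7. For m = 3 the degree would equal q.\<close>

lemma maximal_arc_mathon_conics:
  assumes A: "additive_subgroup A" "card A = 8" and c: "twist A c" and m: "m \<noteq> 3"
  shows "maximal_arc 8 (conics_union (mathon_conics A c))"
  unfolding maximal_arc_def
proof (intro conjI ballI)
  let ?C = "mathon_conics A c"
  note C = closed_mathon_conics[OF A(1) c]
  show "conics_union ?C \<subseteq> points" by (rule conics_union_points)
  show "conics_union ?C \<noteq> {}" by (simp add: conics_union_def)
  show "(8::nat) \<noteq> CARD('a)"
  proof
    assume "8 = CARD('a)"
    hence "(2::nat) ^ 3 = 2 ^ m" by (simp add: CARD_eq)
    thus False using m by (metis power_inject_exp one_less_numeral_iff semiring_norm(76))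
  qed
  have line: "card {P \<in> conics_union ?C. P \<subseteq> {v. v $ 3 = a * v $ 1 + b * v $ 2}} \<in> {0, 8}" for a b
  proof -
    define l where "l \<mu> = abs_trace (a\<^sup>2 * \<mu> + b\<^sup>2 * (\<mu> + \<mu> ^ 4 + c * \<mu>\<^sup>2) + a\<^sup>2 * b\<^sup>2 * \<mu>\<^sup>2)" for \<mu>
    have tr: "abs_trace ((1 + \<mu> ^ 3 + c * \<mu> + \<mu> * a\<^sup>2) * (1 + \<mu> * b\<^sup>2)) = 1 + l \<mu>" if "\<mu> \<in> A" for \<mu>
    proof -
      have "(1 + \<mu> ^ 3 + c * \<mu> + \<mu> * a\<^sup>2) * (1 + \<mu> * b\<^sup>2) =
        1 + (\<mu> ^ 3 + c * \<mu>) + (a\<^sup>2 * \<mu> + b\<^sup>2 * (\<mu> + \<mu> ^ 4 + c * \<mu>\<^sup>2) + a\<^sup>2 * b\<^sup>2 * \<mu>\<^sup>2)"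
        by (simp add: power4_eq_xxxx power3_eq_cube power2_eq_square distrib_left distrib_right mult_ac add_ac)
      thus ?thesis using c that by (simp add: trace_add twist_def l_def)
    qed
    have "card {P \<in> conics_union ?C. P \<subseteq> {v. v $ 3 = a * v $ 1 + b * v $ 2}} =
      (\<Sum>\<mu>\<in>A - {0}. if abs_trace ((1 + \<mu> ^ 3 + c * \<mu> + \<mu> * a\<^sup>2) * (1 + \<mu> * b\<^sup>2)) = 1 then 0 else 2)"
      unfolding card_line_off_F0[OF C]
      unfolding mathon_conics_def by (subst sum.reindex[OF inj_mathon_param]) simp
    also have "\<dots> = (\<Sum>\<mu>\<in>A - {0}. if l \<mu> = 1 then 2 else 0)"
    proof (rule sum.cong)
      fix \<mu> assume "\<mu> \<in> A - {0}"
      moreover have "l \<mu> = 0 \<or> l \<mu> = 1" unfolding l_def by (rule trace_cases)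
      ultimately show "(if abs_trace ((1 + \<mu> ^ 3 + c * \<mu> + \<mu> * a\<^sup>2) * (1 + \<mu> * b\<^sup>2)) = 1 then 0 else 2) = (if l \<mu> = 1 then 2 else (0::nat))"
        using tr[of \<mu>] by (auto simp del: mult_eq_1_iff)
    qed simp
    also have "\<dots> = (\<Sum>\<mu>\<in>{\<mu>\<in>A - {0}. l \<mu> = 1}. 2)"
      by (simp only: sum.inter_filter[OF finite])
    \<comment> \<open>As l 0 = 0, the element 0 can be readmitted, so that the set is a fibre over
      the whole group.\<close>
    also have "{\<mu>\<in>A - {0}. l \<mu> = 1} = {\<mu>\<in>A. l \<mu> = 1}" by (auto simp: l_def)
    finally have card: "card {P \<in> conics_union ?C. P \<subseteq> {v. v $ 3 = a * v $ 1 + b * v $ 2}} = 2 * card {\<mu>\<in>A. l \<mu> = 1}"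
      by simp
    show ?thesis
    proof (cases "\<exists>\<mu>\<in>A. l \<mu> = 1")
      case True
      then obtain z where z: "z \<in> A" "l z = 1" by blast
      have "2 * card {\<mu>\<in>A. l \<mu> = 1} = card A"
      proof (rule card_kernel(2)[of A l, OF A(1) _ _ z])
        show "l \<mu> = 0 \<or> l \<mu> = 1" for \<mu> unfolding l_def by (rule trace_cases)
        fix x y :: 'a
        have "(x + y) ^ 4 = x ^ 4 + y ^ 4" using sum_pow2[of x y 2] by simp
        thus "l (x + y) = l x + l y" unfolding l_def
          by (simp add: sum_sq distrib_left trace_add add_ac)
      qed
      thus ?thesis using card A by simp
    next
      case False
      hence "{\<mu>\<in>A. l \<mu> = 1} = {}" by blast
      thus ?thesis using card by simp
    qed
  qed
  show "card {P \<in> conics_union ?C. P \<subseteq> L} \<in> {0, 8}" if "L \<in> lines" for L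
    using line_cases[OF that]
  proof (elim disjE exE conjE)
    fix d e assume "(d, e) \<in> dirs" "L = {v. v $ 1 * e = v $ 2 * d}"
    thus ?thesis using card_line_through_F0[OF C] card_mathon_conics[OF A, of c] by simp
  qed (use line in simp)
  show "conics_union ?C \<noteq> points"
  proof
    assume eq: "conics_union ?C = points"
    \<comment> \<open>The line z = 0 misses all the conics by the trace condition, and misses F0,
      but it contains a point of the plane.\<close>
    have "card {P \<in> conics_union ?C. P \<subseteq> {v. v $ 3 = 0 * v $ 1 + 0 * v $ 2}} =
      (\<Sum>(\<alpha>, \<beta>, \<mu>)\<in>?C. if abs_trace ((\<alpha> + \<mu> * 0\<^sup>2) * (\<beta> + \<mu> * 0\<^sup>2)) = 1 then 0 else 2)"
      by (rule card_line_off_F0[OF C])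
    also have "\<dots> = 0" using C by (auto simp: closed_conics_def split: prod.splits)
    finally have "{P \<in> points. P \<subseteq> {v :: 'a ^ 3. v $ 3 = 0}} = {}" by (simp add: eq)
    moreover have "vec.span {vec3 1 0 (0::'a)} \<in> points" by (rule span_in_points) (simp add: vec3_eq_iff)
    moreover have "vec.span {vec3 1 0 (0::'a)} \<subseteq> {v. v $ 3 = 0}" by (auto simp: span_single)
    ultimately show False by blast
  qed
qed simp

section \<open>Conics contained in an arc\<close>


text \<open>The direction (1, 0) is a zero only if h4 = 0, and then the dehomogenized polynomial has
  degree at most 3. Either way a nonzero form has at most four zeros.\<close>

lemma poly4_zero:
  fixes h0 h1 h2 h3 h4 :: 'a
  assumes T: "T \<subseteq> dirs" "card T \<ge> 5"
    and H: "\<And>x y. (x, y) \<in> T \<Longrightarrow> h4 * x ^ 4 + h3 * (x ^ 3 * y) + h2 * (x\<^sup>2 * y\<^sup>2) + h1 * (x * y ^ 3) + h0 * y ^ 4 = 0"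
  shows "h0 = 0 \<and> h1 = 0 \<and> h2 = 0 \<and> h3 = 0 \<and> h4 = 0"
proof (rule ccontr)
  assume no: "\<not> ?thesis"
  define p where "p = [:h0, h1, h2, h3, h4:]"
  define R where "R = {t. poly p t = 0}"
  have p0: "p \<noteq> 0" using no by (simp add: p_def)
  have "T \<subseteq> (if h4 = 0 then {(1, 0)} else {}) \<union> (\<lambda>t. (t, 1)) ` R"
  proof
    fix u assume u: "u \<in> T"
    obtain x y where xy: "u = (x, y)" by (cases u)
    hence "(x, y) \<in> dirs" using u T by blast
    thus "u \<in> (if h4 = 0 then {(1, 0)} else {}) \<union> (\<lambda>t. (t, 1)) ` R"
    proof (cases rule: dirs_cases)
      case 1
      thus ?thesis using H[of x y] u xy by simp
    next
      case 2
      have "poly p x = 0" using H[of x y] u xy 2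
        by (simp add: p_def power4_eq_xxxx power3_eq_cube power2_eq_square distrib_left mult_ac add_ac)
      thus ?thesis using xy 2 by (auto simp: R_def)
    qed
  qed
  hence "card T \<le> card ((if h4 = 0 then {(1, 0)} else {}) \<union> (\<lambda>t. (t, 1::'a)) ` R)"
    by (intro card_mono) auto
  also have "\<dots> \<le> card (if h4 = 0 then {(1, 0)} else {} :: ('a \<times> 'a) set) + card ((\<lambda>t. (t, 1::'a)) ` R)"
    by (rule card_Un_le)
  also have "\<dots> \<le> (if h4 = 0 then 1 else 0) + card R"
    by (intro add_mono card_image_le) auto
  also have "card R \<le> degree p" unfolding R_def by (rule card_poly_roots_bound[OF p0])
  also have "degree p \<le> (if h4 = 0 then 3 else 4)" by (simp add: p_def)
  finally show False using T(2) by (auto split: if_splits)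
qed

lemma cubic_zero:
  fixes c0 c1 c2 c3 :: 'a
  assumes "card S \<ge> 4" "\<And>x. x \<in> S \<Longrightarrow> c3 * x ^ 3 + c2 * x\<^sup>2 + c1 * x + c0 = 0"
  shows "c0 = 0 \<and> c1 = 0 \<and> c2 = 0 \<and> c3 = 0"
proof (rule ccontr)
  assume no: "\<not> ?thesis"
  define p where "p = [:c0, c1, c2, c3:]"
  have "p \<noteq> 0" using no by (simp add: p_def)
  hence "card {x. poly p x = 0} \<le> degree p" by (rule card_poly_roots_bound)
  also have "degree p \<le> 3" by (simp add: p_def)
  finally have "card {x. poly p x = 0} \<le> 3" .
  moreover have "S \<subseteq> {x. poly p x = 0}"
    using assms(2) by (auto simp: p_def power3_eq_cube power2_eq_square distrib_left mult_ac add_ac)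
  hence "card S \<le> card {x. poly p x = 0}" by (intro card_mono) auto
  ultimately show False using assms(1) by simp
qed

text \<open>Bezout's theorem for two conics, one of which has nucleus \<open>F0\<close>: eliminating the third
  coordinate yields a binary quartic form.\<close>

lemma quadric_through_five_points:
  fixes \<mu> :: 'a
  assumes \<mu>: "\<mu> \<noteq> 0" and V: "card V \<ge> 5"
    and indep: "\<And>u v k. u \<in> V \<Longrightarrow> v \<in> V \<Longrightarrow> u = k *s v \<Longrightarrow> u = v" and 0: "0 \<notin> V"
    and on_conic: "\<And>v. v \<in> V \<Longrightarrow> qf (\<alpha>, \<beta>, \<mu>) v = 0"
    and Q: "\<And>v. v \<in> V \<Longrightarrow> a * (v $ 1)\<^sup>2 + b * (v $ 2)\<^sup>2 + c * (v $ 3)\<^sup>2 + d * (v $ 1 * v $ 2)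
      + e * (v $ 1 * v $ 3) + f * (v $ 2 * v $ 3) = 0"
  shows "e = 0 \<and> f = 0 \<and> \<mu> * a = c * \<alpha> \<and> \<mu> * b = c * \<beta> \<and> \<mu> * d = c"
proof -
  define A B D where "A = \<mu> * a + c * \<alpha>" and "B = \<mu> * b + c * \<beta>" and "D = \<mu> * d + c"
  \<comment> \<open>The result of eliminating z: multiply the second equation by \<mu>, replace
    \<mu> z^2 by \<alpha> x^2 + x y + \<beta> y^2, isolate the terms linear in z, square, and
    replace \<mu> z^2 once more.\<close>
  define H where "H x y = (A\<^sup>2 + \<mu> * e\<^sup>2 * \<alpha>) * x ^ 4 + \<mu> * e\<^sup>2 * (x ^ 3 * y)
    + (D\<^sup>2 + \<mu> * e\<^sup>2 * \<beta> + \<mu> * f\<^sup>2 * \<alpha>) * (x\<^sup>2 * y\<^sup>2) + \<mu> * f\<^sup>2 * (x * y ^ 3) + (B\<^sup>2 + \<mu> * f\<^sup>2 * \<beta>) * y ^ 4" for x y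
  have H: "H (v $ 1) (v $ 2) = 0" if v: "v \<in> V" for v
  proof -
    define x y z where xyz: "x = v $ 1" "y = v $ 2" "z = v $ 3"
    define w where "w = \<alpha> * x\<^sup>2 + x * y + \<beta> * y\<^sup>2"
    have w: "w = \<mu> * z\<^sup>2" using on_conic[OF v] by (simp add: w_def xyz add_eq_0_iff_eq)
    have "a * x\<^sup>2 + b * y\<^sup>2 + c * z\<^sup>2 + d * (x * y) + (e * x + f * y) * z = 0"
      using Q[OF v] by (simp add: xyz distrib_right distrib_left add_ac mult_ac)
    hence "a * x\<^sup>2 + b * y\<^sup>2 + c * z\<^sup>2 + d * (x * y) = (e * x + f * y) * z"
      by (simp only: add_eq_0_iff_eq)
    hence "\<mu> * (a * x\<^sup>2 + b * y\<^sup>2 + c * z\<^sup>2 + d * (x * y)) = \<mu> * ((e * x + f * y) * z)" by simp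
    moreover have "\<mu> * (a * x\<^sup>2 + b * y\<^sup>2 + c * z\<^sup>2 + d * (x * y)) = A * x\<^sup>2 + B * y\<^sup>2 + D * (x * y)"
    proof -
      have "\<mu> * (a * x\<^sup>2 + b * y\<^sup>2 + c * z\<^sup>2 + d * (x * y)) = \<mu> * a * x\<^sup>2 + \<mu> * b * y\<^sup>2 + c * w + \<mu> * d * (x * y)"
        by (simp add: w distrib_left mult_ac)
      thus ?thesis by (simp add: w_def A_def B_def D_def distrib_left distrib_right mult_ac add_ac)
    qed
    ultimately have "(A * x\<^sup>2 + B * y\<^sup>2 + D * (x * y))\<^sup>2 = (\<mu> * ((e * x + f * y) * z))\<^sup>2" by simp
    also have "\<dots> = \<mu> * (e\<^sup>2 * x\<^sup>2 + f\<^sup>2 * y\<^sup>2) * w"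
      by (simp add: w power_mult_distrib sum_sq) (simp add: power2_eq_square mult_ac)
    finally have "A\<^sup>2 * x ^ 4 + B\<^sup>2 * y ^ 4 + D\<^sup>2 * (x\<^sup>2 * y\<^sup>2) + \<mu> * (e\<^sup>2 * x\<^sup>2 + f\<^sup>2 * y\<^sup>2) * w = 0"
      by (simp add: sum_sq power_mult_distrib add_eq_0_iff_eq flip: power_mult)
    moreover have "H x y = A\<^sup>2 * x ^ 4 + B\<^sup>2 * y ^ 4 + D\<^sup>2 * (x\<^sup>2 * y\<^sup>2) + \<mu> * (e\<^sup>2 * x\<^sup>2 + f\<^sup>2 * y\<^sup>2) * w"
      by (simp add: H_def w_def power4_eq_xxxx power3_eq_cube power2_eq_square distrib_left distrib_right mult_ac add_ac)
    ultimately show ?thesis by (simp add: xyz)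
  qed
  have "\<exists>t k. t \<in> dirs \<and> k \<noteq> 0 \<and> v $ 1 = k * fst t \<and> v $ 2 = k * snd t" if v: "v \<in> V" for v
  proof -
    have "(v $ 1, v $ 2) \<noteq> (0, 0)" using conic_not_axis[OF \<mu> on_conic[OF v]] v 0 by auto
    from dirs_exists[OF this] obtain k x y where "k \<noteq> 0" "(x, y) \<in> dirs" "v $ 1 = k * x" "v $ 2 = k * y" by blast
    thus ?thesis by (intro exI[of _ "(x, y)"] exI[of _ k]) simp
  qed
  then obtain t k where tk: "\<And>v. v \<in> V \<Longrightarrow> t v \<in> dirs" "\<And>v. v \<in> V \<Longrightarrow> k v \<noteq> 0"
    "\<And>v. v \<in> V \<Longrightarrow> v $ 1 = k v * fst (t v)" "\<And>v. v \<in> V \<Longrightarrow> v $ 2 = k v * snd (t v)" by metis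
  \<comment> \<open>A line through the nucleus contains one point of the conic, so equal directions
    mean proportional vectors.\<close>
  have "inj_on t V"
  proof (rule inj_onI)
    fix u v assume *: "u \<in> V" "v \<in> V" "t u = t v"
    have "u = (k u / k v) *s v"
      using * tk[OF *(1)] tk[OF *(2)] on_conic
      by (intro conic_third_unique[OF \<mu>, of \<alpha> \<beta>]) (simp_all add: qf_scale del: qf.simps)
    thus "u = v" using indep * by blast
  qed
  hence "card (t ` V) \<ge> 5" using V by (simp add: card_image)
  moreover have "t ` V \<subseteq> dirs" using tk(1) by blast
  moreover have "H x y = 0" if xy: "(x, y) \<in> t ` V" for x y
  proof -
    obtain v where v: "v \<in> V" "t v = (x, y)" using xy by auto
    have "H (k v * x) (k v * y) = (k v) ^ 4 * H x y"
      by (simp add: H_def power4_eq_xxxx power3_eq_cube power2_eq_square distrib_left distrib_right mult_ac)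
    thus ?thesis using H[OF v(1)] tk[OF v(1)] v(2) by simp
  qed
  ultimately have z: "B\<^sup>2 + \<mu> * f\<^sup>2 * \<beta> = 0 \<and> \<mu> * f\<^sup>2 = 0 \<and> D\<^sup>2 + \<mu> * e\<^sup>2 * \<beta> + \<mu> * f\<^sup>2 * \<alpha> = 0 \<and>
      \<mu> * e\<^sup>2 = 0 \<and> A\<^sup>2 + \<mu> * e\<^sup>2 * \<alpha> = 0"
    unfolding H_def by (intro poly4_zero[of "t ` V"])
  \<comment> \<open>The coefficients of x^3 y and x y^3 are \<mu> e^2 and \<mu> f^2; without e and
    f, the other three are the squares of A, D and B.\<close>
  hence "e = 0" "f = 0" using \<mu> by simp_all
  moreover from this have "A = 0" "B = 0" "D = 0" using z by simp_all
  ultimately show ?thesis by (simp add: A_def B_def D_def add_eq_0_iff_eq)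
qed

lemma vec3_decompose: "v = v $ 1 *s vec3 1 0 0 + v $ 2 *s vec3 0 1 0 + v $ 3 *s vec3 0 0 (1::'a)"
  by (subst vec3_eq_iff) simp

text \<open>The axis is the single point F0. It accounts for the summand 1 in 7 * 4 + 1.\<close>

lemma card_axis:
  assumes indep: "\<And>u v k. u \<in> V \<Longrightarrow> v \<in> V \<Longrightarrow> u = k *s v \<Longrightarrow> u = (v :: 'a ^ 3)" and 0: "0 \<notin> V"
  shows "card {v \<in> V. v $ 1 = 0 \<and> v $ 2 = 0} \<le> 1"
proof -
  have "u = v" if "u \<in> V" "v \<in> V" "u $ 1 = 0" "u $ 2 = 0" "v $ 1 = 0" "v $ 2 = 0" for u v
  proof -
    have "v $ 3 \<noteq> 0" using that 0 by (metis vec3_eq_iff zero_index)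
    hence "u = (u $ 3 / v $ 3) *s v" using that by (simp add: vec3_eq_iff)
    thus ?thesis using indep that by blast
  qed
  thus ?thesis by (auto simp: card_le_Suc0_iff_eq)
qed

text \<open>The image of a conic of \<open>C'\<close> has \<open>q + 1 > 7 * 4 + 1\<close> points in the arc of \<open>C\<close>.\<close>

lemma linear_image_conic:
  assumes C: "card (C :: 'a conic_param set) \<le> 7" "0 \<notin> conic_mu ` C"
    and f: "Vector_Spaces.linear (*s) (*s) f" "bij f" "f ` arc_cone C = arc_cone C'"
    and pqr: "p = f (vec3 1 0 0)" "q = f (vec3 0 1 0)" "r = f (vec3 0 0 1)"
    and c': "(\<alpha>', \<beta>', \<mu>') \<in> C'" "\<mu>' \<noteq> 0" and m: "m \<ge> 5"
  shows "\<exists>\<alpha> \<beta> \<mu>. (\<alpha>, \<beta>, \<mu>) \<in> C \<and> (let k = p $ 1 * q $ 2 + p $ 2 * q $ 1 in k \<noteq> 0 \<and>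
    k * \<alpha> = qf (\<alpha>', \<beta>', \<mu>') p \<and> k * \<beta> = qf (\<alpha>', \<beta>', \<mu>') q \<and> k * \<mu> = \<mu>' * (r $ 3)\<^sup>2) \<and> r $ 1 = 0 \<and> r $ 2 = 0"
proof -
  let ?c' = "(\<alpha>', \<beta>', \<mu>')"
  have "\<forall>t. \<exists>z. qf ?c' (vec3 (fst t) (snd t) z) = 0" using ex_conic_third[OF c'(2)] by blast
  then obtain z where z: "\<And>t. qf ?c' (vec3 (fst t) (snd t) (z t)) = 0" by metis
  define u where "u t = vec3 (fst t) (snd t) (z t)" for t
  define w where "w t = inv f (u t)" for t
  have fw: "f (w t) = u t" for t using f(2) by (simp add: w_def surj_f_inv_f bij_is_surj)
  have lin: "f (k *s v) = k *s f v" "f (v + v') = f v + f v'" for k v v' using f(1) by (auto simp: linear_vec_iff)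
  have same_dir: "t = t'" if "t \<in> dirs" "t' \<in> dirs" "w t = k *s w t'" for t t' k
  proof -
    have "u t = k *s u t'" using arg_cong[OF that(3), of f] by (simp add: fw lin)
    hence *: "fst t = k * fst t'" "snd t = k * snd t'" by (simp_all add: u_def vec3_eq_iff)
    have "(fst t', snd t') \<in> dirs" "(fst t, snd t) \<in> dirs" using that by simp_all
    hence "k = 1" using * by (rule dirs_unique)
    thus ?thesis using * by (simp add: prod_eq_iff)
  qed
  \<comment> \<open>One vector for each of the q + 1 points of the given conic of C', pulled back
    along f.\<close>
  define V where "V = w ` dirs"
  have "inj_on w dirs" by (rule inj_onI) (use same_dir[of _ _ 1] in simp)
  hence card_V: "card V = 2 ^ m + 1" by (simp add: V_def card_image card_dirs CARD_eq)
  have indep: "u = v" if uv: "u \<in> V" "v \<in> V" "u = k *s v" for u v k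
  proof -
    obtain t t' where "t \<in> dirs" "t' \<in> dirs" "u = w t" "v = w t'" using uv(1,2) by (auto simp: V_def)
    thus ?thesis using same_dir[of t t' k] uv(3) by simp
  qed
  have V0: "0 \<notin> V"
  proof
    assume "0 \<in> V"
    then obtain t where t: "t \<in> dirs" "w t = 0" by (auto simp: V_def)
    have "f 0 = 0" using lin(1)[of 0 0] by simp
    hence "u t = 0" using fw[of t] t by simp
    hence "t = (0, 0)" by (simp add: u_def vec3_eq_iff prod_eq_iff)
    thus False using t dirs_nonzero by blast
  qed
  have V_sub: "V \<subseteq> {v \<in> V. v $ 1 = 0 \<and> v $ 2 = 0} \<union> (\<Union>c\<in>C. {v \<in> V. qf c v = 0})"
  proof
    fix v assume v: "v \<in> V"
    then obtain t where t: "v = w t" by (auto simp: V_def)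
    have "f v \<in> arc_cone C'" using c' z[of t] unfolding t fw arc_cone_def u_def by blast
    hence "f v \<in> f ` arc_cone C" by (simp only: f(3))
    hence "v \<in> arc_cone C" using f(2) by (metis bij_is_inj inj_image_mem_iff)
    thus "v \<in> {v \<in> V. v $ 1 = 0 \<and> v $ 2 = 0} \<union> (\<Union>c\<in>C. {v \<in> V. qf c v = 0})"
      using v unfolding arc_cone_def by blast
  qed
  have "\<exists>c\<in>C. card {v \<in> V. qf c v = 0} \<ge> 5"
  proof (rule ccontr)
    assume "\<not> ?thesis"
    hence le4: "card {v \<in> V. qf c v = 0} \<le> 4" if "c \<in> C" for c using that by force
    have "card V \<le> card ({v \<in> V. v $ 1 = 0 \<and> v $ 2 = 0} \<union> (\<Union>c\<in>C. {v \<in> V. qf c v = 0}))"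
      by (rule card_mono[OF _ V_sub]) simp
    also have "\<dots> \<le> card {v \<in> V. v $ 1 = 0 \<and> v $ 2 = 0} + card (\<Union>c\<in>C. {v \<in> V. qf c v = 0})"
      by (rule card_Un_le)
    also have "\<dots> \<le> 1 + (\<Sum>c\<in>C. card {v \<in> V. qf c v = 0})"
      by (intro add_mono card_axis card_UN_le) (use indep V0 in auto)
    also have "(\<Sum>c\<in>C. card {v \<in> V. qf c v = 0}) \<le> (\<Sum>c\<in>C. 4)" using le4 by (rule sum_mono)
    also have "\<dots> \<le> 28" using C(1) by simp
    finally have "(2::nat) ^ m \<le> 28" using card_V by simp
    moreover have "(2::nat) ^ 5 \<le> 2 ^ m" using m by (intro power_increasing) auto
    ultimately show False by simp
  qed
  then obtain c where c: "c \<in> C" "card {v \<in> V. qf c v = 0} \<ge> 5" by blast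
  obtain \<alpha> \<beta> \<mu> where abm: "c = (\<alpha>, \<beta>, \<mu>)" by (cases c)
  have \<mu>: "\<mu> \<noteq> 0" using C(2) c abm by (metis conic_mu.simps image_eqI)
  \<comment> \<open>The coefficients of the pulled-back quadratic form: its values on the standard
    basis, and those of its polar form x y' + x' y on pairs of basis vectors.\<close>
  let ?a = "qf ?c' p" and ?b = "qf ?c' q" and ?g = "qf ?c' r"
  let ?d = "p $ 1 * q $ 2 + p $ 2 * q $ 1" and ?e = "p $ 1 * r $ 2 + p $ 2 * r $ 1" and ?h = "q $ 1 * r $ 2 + q $ 2 * r $ 1"
  have fv: "f v = v $ 1 *s p + v $ 2 *s q + v $ 3 *s r" for v
    by (subst vec3_decompose[of v]) (simp only: lin pqr)
  have expand: "qf ?c' (f v) = ?a * (v $ 1)\<^sup>2 + ?b * (v $ 2)\<^sup>2 + ?g * (v $ 3)\<^sup>2 + ?d * (v $ 1 * v $ 2)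
      + ?e * (v $ 1 * v $ 3) + ?h * (v $ 2 * v $ 3)" for v
    by (simp add: fv sum_sq power_mult_distrib distrib_left distrib_right)
      (simp add: power2_eq_square mult_ac add_ac)
  have "?e = 0 \<and> ?h = 0 \<and> \<mu> * ?a = ?g * \<alpha> \<and> \<mu> * ?b = ?g * \<beta> \<and> \<mu> * ?d = ?g"
  proof (rule quadric_through_five_points[where V = "{v \<in> V. qf c v = 0}", OF \<mu> c(2)])
    fix v assume v: "v \<in> {v \<in> V. qf c v = 0}"
    thus "qf (\<alpha>, \<beta>, \<mu>) v = 0" by (simp add: abm)
    obtain t where "v = w t" using v by (auto simp: V_def)
    hence "qf ?c' (f v) = 0" using z[of t] by (simp only: fw u_def)
    thus "?a * (v $ 1)\<^sup>2 + ?b * (v $ 2)\<^sup>2 + ?g * (v $ 3)\<^sup>2 + ?d * (v $ 1 * v $ 2)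
      + ?e * (v $ 1 * v $ 3) + ?h * (v $ 2 * v $ 3) = 0" by (simp only: expand)
  qed (use indep V0 in auto)
  hence eqs: "?e = 0" "?h = 0" "\<mu> * ?a = \<mu> * (?d * \<alpha>)" "\<mu> * ?b = \<mu> * (?d * \<beta>)" "?g = \<mu> * ?d"
    by (auto simp: mult_ac)
  \<comment> \<open>Otherwise the pulled-back form would vanish identically, although its value at
    the preimage of (0, 0, 1) is \<mu>'.\<close>
  have k: "?d \<noteq> 0"
  proof
    assume d0: "?d = 0"
    have "?a = 0" "?b = 0" "?g = 0" using eqs(3-5) \<mu> by (simp_all only: d0) simp_all
    hence "qf ?c' (f v) = 0" for v unfolding expand eqs(1,2) d0 by simp
    hence "qf ?c' (f (inv f (vec3 0 0 1))) = 0" .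
    hence "qf ?c' (vec3 0 0 1) = 0" using f(2) by (simp only: surj_f_inv_f bij_is_surj)
    thus False using c'(2) by simp
  qed
  \<comment> \<open>\<open>?e\<close> and \<open>?h\<close> are the determinants of the first two
    coordinates of r with those of p and q, which are independent since \<open>?d\<close> is
    nonzero. So f fixes the nucleus.\<close>
  have r: "r $ 1 = 0 \<and> r $ 2 = 0"
  proof -
    have "?d * r $ 1 = q $ 1 * ?e + p $ 1 * ?h" "?d * r $ 2 = q $ 2 * ?e + p $ 2 * ?h"
      by (simp_all add: distrib_left distrib_right mult_ac add_ac)
    hence "?d * r $ 1 = 0" "?d * r $ 2 = 0" by (simp_all only: eqs(1,2)) simp_all
    thus ?thesis using k by (simp only: mult_eq_0_iff) simp
  qed
  hence "?g = \<mu>' * (r $ 3)\<^sup>2" by simp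
  moreover have "?d * \<alpha> = ?a" "?d * \<beta> = ?b" using eqs(3,4) \<mu> by (metis mult_left_cancel)+
  ultimately show ?thesis using c(1) abm k r eqs(5)
    unfolding Let_def by (intro exI[of _ \<alpha>] exI[of _ \<beta>] exI[of _ \<mu>]) (simp add: mult.commute del: qf.simps)
qed

section \<open>Telling the normal forms apart\<close>

lemma mathon_conics_iff:
  "(\<alpha>, \<beta>, \<mu>) \<in> mathon_conics A c \<longleftrightarrow> \<mu> \<in> A - {0} \<and> \<alpha> = 1 + \<mu> ^ 3 + c * \<mu> \<and> \<beta> = 1"
  unfolding mathon_conics_def by blast

lemma mathon_conics_mu: "0 \<notin> conic_mu ` mathon_conics A c"
  by (auto simp: mathon_conics_def)

lemma card_mathon_conics_le: "additive_subgroup A \<Longrightarrow> card A = 8 \<Longrightarrow> card (mathon_conics A c) \<le> 7"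
  by (simp add: card_mathon_conics)

text \<open>\<open>linear_image_conic\<close> ties the parameters of corresponding conics by
  identities that are of degree at most 3 in \<mu>' and hold for seven values, so coefficients may
  be compared. The identity for \<beta> gives q1 = 0 and k = q2^2, whence p1^2 = k. The cubic
  coefficient in the identity for \<alpha> then reads k s^3 = k, where s is the common ratio of the
  parameters.\<close>

lemma mathon_conics_rigid:
  assumes A: "additive_subgroup A" "card A = 8" and A': "additive_subgroup A'" "card A' = 8"
    and f: "Vector_Spaces.linear (*s) (*s) f" "bij f" "f ` arc_cone (mathon_conics A c) = arc_cone (mathon_conics A' c')"
    and m: "m \<ge> 5"
  shows "A = A'"
proof -
  define p q r where pqr: "p = f (vec3 1 0 0)" "q = f (vec3 0 1 0)" "r = f (vec3 0 0 1)"
  define k where "k = p $ 1 * q $ 2 + p $ 2 * q $ 1"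
  have ex: "\<exists>\<mu>. \<mu> \<in> A - {0} \<and> k \<noteq> 0 \<and> k * (1 + \<mu> ^ 3 + c * \<mu>) = qf (1 + \<mu>' ^ 3 + c' * \<mu>', 1, \<mu>') p \<and>
    k = qf (1 + \<mu>' ^ 3 + c' * \<mu>', 1, \<mu>') q \<and> k * \<mu> = \<mu>' * (r $ 3)\<^sup>2" if "\<mu>' \<in> A' - {0}" for \<mu>'
  proof -
    have "(1 + \<mu>' ^ 3 + c' * \<mu>', 1, \<mu>') \<in> mathon_conics A' c'" "\<mu>' \<noteq> 0"
      using that by (simp_all add: mathon_conics_iff)
    from linear_image_conic[OF card_mathon_conics_le[OF A] mathon_conics_mu f pqr this m]
    obtain \<alpha> \<beta> \<mu> where "(\<alpha>, \<beta>, \<mu>) \<in> mathon_conics A c" "k \<noteq> 0"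
      "k * \<alpha> = qf (1 + \<mu>' ^ 3 + c' * \<mu>', 1, \<mu>') p" "k * \<beta> = qf (1 + \<mu>' ^ 3 + c' * \<mu>', 1, \<mu>') q"
      "k * \<mu> = \<mu>' * (r $ 3)\<^sup>2" unfolding Let_def k_def[symmetric] by blast
    thus ?thesis unfolding mathon_conics_iff by (intro exI[of _ \<mu>]) (simp del: qf.simps)
  qed
  have card: "card (A' - {0}) \<ge> 4" using subgroup8_card_diff[OF A'] by simp
  then obtain \<mu>0 where "\<mu>0 \<in> A' - {0}" by (metis card.empty ex_in_conv not_numeral_le_zero)
  hence k: "k \<noteq> 0" using ex by blast
  define s where "s = (r $ 3)\<^sup>2 / k"
  have s: "\<mu>' * s \<in> A - {0}" "k * (1 + (\<mu>' * s) ^ 3 + c * (\<mu>' * s)) = qf (1 + \<mu>' ^ 3 + c' * \<mu>', 1, \<mu>') p"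
    "k = qf (1 + \<mu>' ^ 3 + c' * \<mu>', 1, \<mu>') q" if \<mu>': "\<mu>' \<in> A' - {0}" for \<mu>'
  proof -
    obtain \<mu> where *: "\<mu> \<in> A - {0}" "k * (1 + \<mu> ^ 3 + c * \<mu>) = qf (1 + \<mu>' ^ 3 + c' * \<mu>', 1, \<mu>') p"
      "k = qf (1 + \<mu>' ^ 3 + c' * \<mu>', 1, \<mu>') q" "k * \<mu> = \<mu>' * (r $ 3)\<^sup>2" using ex[OF \<mu>'] by blast
    have "\<mu> = \<mu>' * s" using *(4) k by (simp add: s_def field_simps)
    thus "\<mu>' * s \<in> A - {0}" "k * (1 + (\<mu>' * s) ^ 3 + c * (\<mu>' * s)) = qf (1 + \<mu>' ^ 3 + c' * \<mu>', 1, \<mu>') p"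
      "k = qf (1 + \<mu>' ^ 3 + c' * \<mu>', 1, \<mu>') q" using * by simp_all
  qed
  \<comment> \<open>The conjuncts are the coefficients in the order of \<open>cubic_zero\<close>;
    the quadratic one is 0.\<close>
  have q: "(k + (q $ 1)\<^sup>2 + q $ 1 * q $ 2 + (q $ 2)\<^sup>2) = 0 \<and> c' * (q $ 1)\<^sup>2 + (q $ 3)\<^sup>2 = 0 \<and> 0 = (0::'a) \<and> (q $ 1)\<^sup>2 = 0"
  proof (rule cubic_zero[OF card])
    fix x assume "x \<in> A' - {0}"
    hence "k + qf (1 + x ^ 3 + c' * x, 1, x) q = 0" using s(3) by (simp only: add_eq_0_iff_eq)
    thus "(q $ 1)\<^sup>2 * x ^ 3 + 0 * x\<^sup>2 + (c' * (q $ 1)\<^sup>2 + (q $ 3)\<^sup>2) * x + (k + (q $ 1)\<^sup>2 + q $ 1 * q $ 2 + (q $ 2)\<^sup>2) = 0"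
      by (simp add: distrib_left distrib_right mult_ac add_ac)
  qed
  hence q1: "q $ 1 = 0" and kq: "k = (q $ 2)\<^sup>2" by (auto simp: add_eq_0_iff_eq)
  have pq: "(p $ 1)\<^sup>2 = k"
  proof -
    have "p $ 1 * q $ 2 = q $ 2 * q $ 2" using kq by (simp add: k_def q1 power2_eq_square)
    thus ?thesis using kq k by auto
  qed
  have "(k + (p $ 1)\<^sup>2 + p $ 1 * p $ 2 + (p $ 2)\<^sup>2) = 0 \<and> k * c * s + c' * (p $ 1)\<^sup>2 + (p $ 3)\<^sup>2 = 0 \<and> 0 = (0::'a) \<and> k * s ^ 3 + (p $ 1)\<^sup>2 = 0"
  proof (rule cubic_zero[OF card])
    fix x assume "x \<in> A' - {0}"
    hence "k * (1 + (x * s) ^ 3 + c * (x * s)) + qf (1 + x ^ 3 + c' * x, 1, x) p = 0" using s(2) by (simp only: add_eq_0_iff_eq)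
    thus "(k * s ^ 3 + (p $ 1)\<^sup>2) * x ^ 3 + 0 * x\<^sup>2 + (k * c * s + c' * (p $ 1)\<^sup>2 + (p $ 3)\<^sup>2) * x
       + (k + (p $ 1)\<^sup>2 + p $ 1 * p $ 2 + (p $ 2)\<^sup>2) = 0"
      by (simp add: distrib_left distrib_right power_mult_distrib mult_ac add_ac)
  qed
  hence "k * s ^ 3 = k" by (simp add: pq add_eq_0_iff_eq)
  hence "s ^ 3 = 1 ^ 3" using k by simp
  hence "s = 1" by (rule cube_inj)
  hence "A' - {0} \<subseteq> A - {0}" using s(1) by auto
  moreover have "0 \<in> A" "0 \<in> A'" using A A' by (simp_all add: additive_subgroup_def)
  ultimately have "A' \<subseteq> A" by blast
  thus ?thesis using A A' by (metis card_subset_eq finite)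
qed

text \<open>In a pencil \<alpha> is the same for all conics, so comparing cubic coefficients yields
  k s^3 = 0, although the ratio s of the parameters is nonzero. Four parameters suffice for a
  cubic.\<close>

lemma mathon_conics_not_pencil:
  assumes A: "additive_subgroup A" "card A = 8" and B: "card (B - {0}) \<ge> 4"
    and f: "Vector_Spaces.linear (*s) (*s) f" "bij f"
    and m: "m \<ge> 5"
  shows "f ` arc_cone (mathon_conics A c) \<noteq> arc_cone {(\<alpha>, 1, \<mu>) | \<mu>. \<mu> \<in> B - {0}}"
proof
  assume eq: "f ` arc_cone (mathon_conics A c) = arc_cone {(\<alpha>, 1, \<mu>) | \<mu>. \<mu> \<in> B - {0}}"
  define p q r where pqr: "p = f (vec3 1 0 0)" "q = f (vec3 0 1 0)" "r = f (vec3 0 0 1)"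
  define k where "k = p $ 1 * q $ 2 + p $ 2 * q $ 1"
  have ex: "\<exists>\<mu>. \<mu> \<in> A - {0} \<and> k \<noteq> 0 \<and> k * (1 + \<mu> ^ 3 + c * \<mu>) = qf (\<alpha>, 1, \<mu>') p \<and> k * \<mu> = \<mu>' * (r $ 3)\<^sup>2"
    if "\<mu>' \<in> B - {0}" for \<mu>'
  proof -
    have "(\<alpha>, 1, \<mu>') \<in> {(\<alpha>, 1, \<mu>) | \<mu>. \<mu> \<in> B - {0}}" "\<mu>' \<noteq> 0" using that by simp_all
    from linear_image_conic[OF card_mathon_conics_le[OF A] mathon_conics_mu f eq pqr this m]
    obtain \<alpha>' \<beta>' \<mu> where "(\<alpha>', \<beta>', \<mu>) \<in> mathon_conics A c" "k \<noteq> 0"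
      "k * \<alpha>' = qf (\<alpha>, 1, \<mu>') p" "k * \<mu> = \<mu>' * (r $ 3)\<^sup>2" unfolding Let_def k_def[symmetric] by blast
    thus ?thesis unfolding mathon_conics_iff by (intro exI[of _ \<mu>]) (simp del: qf.simps)
  qed
  obtain \<mu>0 where "\<mu>0 \<in> B - {0}" using B by (metis card.empty ex_in_conv not_numeral_le_zero)
  then obtain \<mu>1 where \<mu>1: "\<mu>1 \<in> A - {0}" "k \<noteq> 0" "k * \<mu>1 = \<mu>0 * (r $ 3)\<^sup>2" using ex by blast
  hence k: "k \<noteq> 0" and r3: "r $ 3 \<noteq> 0" by auto
  define s where "s = (r $ 3)\<^sup>2 / k"
  have "(k + \<alpha> * (p $ 1)\<^sup>2 + p $ 1 * p $ 2 + (p $ 2)\<^sup>2) = 0 \<and> k * c * s + (p $ 3)\<^sup>2 = 0 \<and> 0 = (0::'a) \<and> k * s ^ 3 = 0"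
  proof (rule cubic_zero[OF B])
    fix x assume "x \<in> B - {0}"
    then obtain \<mu> where *: "k * (1 + \<mu> ^ 3 + c * \<mu>) = qf (\<alpha>, 1, x) p" "k * \<mu> = x * (r $ 3)\<^sup>2" using ex by blast
    have "\<mu> = x * s" using *(2) k by (simp add: s_def field_simps)
    hence "k * (1 + (x * s) ^ 3 + c * (x * s)) + qf (\<alpha>, 1, x) p = 0" using *(1) by (simp only: add_eq_0_iff_eq)
    thus "(k * s ^ 3) * x ^ 3 + 0 * x\<^sup>2 + (k * c * s + (p $ 3)\<^sup>2) * x
       + (k + \<alpha> * (p $ 1)\<^sup>2 + p $ 1 * p $ 2 + (p $ 2)\<^sup>2) = 0"
      by (simp add: distrib_left distrib_right power_mult_distrib mult_ac add_ac)
  qed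
  thus False using k r3 by (simp add: s_def)
qed

end

section \<open>Normal form of closed sets of seven conics\<close>

definition arc_equiv :: "'a::{field,finite} conic_param set \<Rightarrow> 'a conic_param set \<Rightarrow> bool" where
  "arc_equiv C C' \<longleftrightarrow> (\<exists>f. Vector_Spaces.linear (*s) (*s) f \<and> bij f \<and> f ` arc_cone C = arc_cone C')"

lemma arc_equiv_sym: "arc_equiv C C' \<Longrightarrow> arc_equiv C' C"
proof -
  assume "arc_equiv C C'"
  then obtain f where f: "semilinear (\<lambda>x. x) f" "bij f" "f ` arc_cone C = arc_cone C'"
    by (auto simp: arc_equiv_def linear_semilinear)
  have "inv (\<lambda>x::'a. x) = (\<lambda>x. x)" by (rule inv_equality) simp_all
  hence "semilinear (\<lambda>x. x) (inv f)" using inv_semilinear[OF id_automorphism f(1,2)] by simp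
  moreover have "inv f ` arc_cone C' = arc_cone C" using f(2) by (simp add: f(3)[symmetric] image_inv_f_f bij_is_inj)
  ultimately show ?thesis using f(2) bij_imp_bij_inv unfolding arc_equiv_def linear_semilinear by blast
qed

lemma arc_equiv_trans: "arc_equiv C C' \<Longrightarrow> arc_equiv C' C'' \<Longrightarrow> arc_equiv C C''"
proof -
  assume "arc_equiv C C'" "arc_equiv C' C''"
  then obtain f f' where f: "semilinear (\<lambda>x. x) f" "bij f" "f ` arc_cone C = arc_cone C'"
    "semilinear (\<lambda>x. x) f'" "bij f'" "f' ` arc_cone C' = arc_cone C''"
    by (auto simp: arc_equiv_def linear_semilinear)
  hence "semilinear (\<lambda>x. x) (f' \<circ> f)" "bij (f' \<circ> f)"
    by (auto simp: semilinear_def intro: bij_comp)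
  moreover have "(f' \<circ> f) ` arc_cone C = arc_cone C''" by (simp only: image_comp[symmetric] f(3,6))
  ultimately show ?thesis unfolding arc_equiv_def linear_semilinear by blast
qed

text \<open>The substitution \<open>x \<mapsto> m11 x + m12 y\<close>, \<open>y \<mapsto> m21 x + m22 y\<close>, \<open>z \<mapsto> a x + b y + e z\<close>.\<close>

fun conic_subst :: "'a::field \<Rightarrow> 'a \<Rightarrow> 'a \<Rightarrow> 'a \<Rightarrow> 'a \<Rightarrow> 'a \<Rightarrow> 'a \<Rightarrow> 'a conic_param \<Rightarrow> 'a conic_param" where
  "conic_subst m11 m12 m21 m22 a b e (\<alpha>, \<beta>, \<mu>) =
    (\<alpha> * m11\<^sup>2 + m11 * m21 + \<beta> * m21\<^sup>2 + \<mu> * a\<^sup>2, \<alpha> * m12\<^sup>2 + m12 * m22 + \<beta> * m22\<^sup>2 + \<mu> * b\<^sup>2, \<mu> * e\<^sup>2)"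

context char_two_field
begin

text \<open>Determinant 1 keeps the coefficient of x y equal to 1, and since squaring is additive
  the substitution for z only adds \<mu> a^2 and \<mu> b^2. The new cone is the preimage of the old
  one under f, hence the appeal to symmetry at the end.\<close>

lemma arc_equiv_subst:
  assumes det: "m11 * m22 + m12 * m21 = (1::'a)" and e: "e \<noteq> 0"
  shows "arc_equiv C (conic_subst m11 m12 m21 m22 a b e ` C)"
proof -
  define f :: "'a ^ 3 \<Rightarrow> 'a ^ 3" where "f v = vec3 (m11 * v $ 1 + m12 * v $ 2) (m21 * v $ 1 + m22 * v $ 2)
    (a * v $ 1 + b * v $ 2 + e * v $ 3)" for v
  have lin: "semilinear (\<lambda>x. x) f"
    unfolding semilinear_def
  proof (intro conjI allI)
    show "f (u + v) = f u + f v" for u v by (subst vec3_eq_iff) (simp add: f_def distrib_left add_ac)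
    show "f (c *s v) = c *s f v" for c v by (subst vec3_eq_iff) (simp add: f_def distrib_left mult_ac)
  qed
  have "inj f"
  proof (rule injI)
    fix u v assume "f u = f v"
    have v1: "m22 * (f v $ 1) + m12 * (f v $ 2) = v $ 1" for v
    proof -
      have "m22 * (f v $ 1) + m12 * (f v $ 2) = (m11 * m22 + m12 * m21) * v $ 1"
        by (simp add: f_def distrib_left distrib_right mult_ac add_ac)
      thus ?thesis by (simp add: det)
    qed
    have v2: "m21 * (f v $ 1) + m11 * (f v $ 2) = v $ 2" for v
    proof -
      have "m21 * (f v $ 1) + m11 * (f v $ 2) = (m11 * m22 + m12 * m21) * v $ 2"
        by (simp add: f_def distrib_left distrib_right mult_ac add_ac)
      thus ?thesis by (simp add: det)
    qed
    have v3: "(f v $ 3 + (a * v $ 1 + b * v $ 2)) / e = v $ 3" for v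
      using e by (simp add: f_def add_ac)
    have 1: "u $ 1 = v $ 1" using v1[of u] v1[of v] \<open>f u = f v\<close> by simp
    have 2: "u $ 2 = v $ 2" using v2[of u] v2[of v] \<open>f u = f v\<close> by simp
    have "u $ 3 = v $ 3" using v3[of u] v3[of v] \<open>f u = f v\<close> 1 2 by simp
    thus "u = v" using 1 2 by (simp add: vec3_eq_iff)
  qed
  hence bij: "bij f" by (simp add: bij_def finite_UNIV_inj_surj)
  have qf: "qf (conic_subst m11 m12 m21 m22 a b e c) v = qf c (f v)" for c v
  proof (cases c)
    case (fields \<alpha> \<beta> \<mu>)
    have "(m11 * v $ 1 + m12 * v $ 2) * (m21 * v $ 1 + m22 * v $ 2) =
      m11 * m21 * (v $ 1)\<^sup>2 + (m11 * m22 + m12 * m21) * (v $ 1 * v $ 2) + m12 * m22 * (v $ 2)\<^sup>2"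
      by (simp add: power2_eq_square distrib_left distrib_right mult_ac add_ac)
    hence "(m11 * v $ 1 + m12 * v $ 2) * (m21 * v $ 1 + m22 * v $ 2) =
      m11 * m21 * (v $ 1)\<^sup>2 + v $ 1 * v $ 2 + m12 * m22 * (v $ 2)\<^sup>2" by (simp add: det)
    thus ?thesis unfolding fields
      by (simp add: f_def sum_sq power_mult_distrib) (simp add: distrib_left distrib_right mult_ac add_ac)
  qed
  have axis: "f v $ 1 = 0 \<and> f v $ 2 = 0 \<longleftrightarrow> v $ 1 = 0 \<and> v $ 2 = 0" for v
  proof
    assume "f v $ 1 = 0 \<and> f v $ 2 = 0"
    \<comment> \<open>The image of (x, y, 0) lies on the axis, so it is also the image of a multiple
      of (0, 0, 1); injectivity then gives x = y = 0.\<close>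
    hence "f (v $ 1 *s vec3 1 0 0 + v $ 2 *s vec3 0 1 0) = f (((a * v $ 1 + b * v $ 2) / e) *s vec3 0 0 1)"
      using e by (subst vec3_eq_iff) (simp add: f_def)
    hence "v $ 1 *s vec3 1 0 0 + v $ 2 *s vec3 0 1 0 = ((a * v $ 1 + b * v $ 2) / e) *s vec3 0 0 (1::'a)"
      using \<open>inj f\<close> by (metis injD)
    thus "v $ 1 = 0 \<and> v $ 2 = 0" by (simp add: vec3_eq_iff)
  qed (simp add: f_def)
  have "arc_cone (conic_subst m11 m12 m21 m22 a b e ` C) = f -` arc_cone C"
    by (auto simp: arc_cone_def qf axis simp del: qf.simps)
  hence "f ` arc_cone (conic_subst m11 m12 m21 m22 a b e ` C) = arc_cone C"
    using bij by (simp add: surj_image_vimage_eq bij_is_surj)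
  hence "arc_equiv (conic_subst m11 m12 m21 m22 a b e ` C) C"
    using lin bij unfolding arc_equiv_def linear_semilinear by blast
  thus ?thesis by (rule arc_equiv_sym)
qed

definition conic_family :: "'a set \<Rightarrow> 'a \<Rightarrow> 'a \<Rightarrow> 'a \<Rightarrow> 'a \<Rightarrow> 'a \<Rightarrow> 'a \<Rightarrow> 'a conic_param set" where
  "conic_family A a0 a1 a2 b0 b1 b2 =
    (\<lambda>\<mu>. (a0 + a1 * \<mu> + a2 * \<mu> ^ 3, b0 + b1 * \<mu> + b2 * \<mu> ^ 3, \<mu>)) ` (A - {0})"

lemma closed_conics_family:
  assumes C: "closed_conics (C :: 'a conic_param set)" "card C = 7"
  shows "\<exists>A a0 a1 a2 b0 b1 b2. additive_subgroup A \<and> card A = 8 \<and> C = conic_family A a0 a1 a2 b0 b1 b2"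
proof -
  define A where "A = insert 0 (conic_mu ` C)"
  have inj: "inj_on conic_mu C" using C by (simp add: closed_conics_def)
  have mu0: "conic_mu c \<noteq> 0" if "c \<in> C" for c using closed_conicsD(1)[OF C(1) that] by (cases c) simp
  hence card_A: "card A = 8" using C(2) inj by (auto simp: A_def card_insert_if card_image)
  define g where "g = the_inv_into C conic_mu"
  have g: "g (conic_mu c) = c" if "c \<in> C" for c using that inj by (simp add: g_def the_inv_into_f_f)
  define al be where "al \<mu> = fst (g \<mu>)" and "be \<mu> = fst (snd (g \<mu>))" for \<mu>
  have mem: "(al \<mu>, be \<mu>, \<mu>) \<in> C" if "\<mu> \<in> A - {0}" for \<mu>
  proof -
    have "\<mu> \<in> conic_mu ` C" using that by (simp add: A_def)
    then obtain c where c: "c \<in> C" "conic_mu c = \<mu>" by blast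
    hence "g \<mu> = c" using g by blast
    hence "(al \<mu>, be \<mu>, \<mu>) = c" using c(2) unfolding al_def be_def by (cases c) auto
    thus ?thesis using c by simp
  qed
  have C_eq: "C = (\<lambda>\<mu>. (al \<mu>, be \<mu>, \<mu>)) ` (A - {0})"
  proof (intro equalityI subsetI)
    fix c assume c: "c \<in> C"
    hence "conic_mu c \<in> A - {0}" using mu0 by (simp add: A_def)
    moreover have "c = (al (conic_mu c), be (conic_mu c), conic_mu c)"
      using g[OF c] by (cases c) (simp add: al_def be_def)
    ultimately show "c \<in> (\<lambda>\<mu>. (al \<mu>, be \<mu>, \<mu>)) ` (A - {0})" by blast
  qed (use mem in blast)
  have comp: "u + v \<in> A - {0} \<and> al (u + v) * (u + v) = al u * u + al v * v \<and> be (u + v) * (u + v) = be u * u + be v * v"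
    if uv: "u \<in> A - {0}" "v \<in> A - {0}" "u \<noteq> v" for u v
  proof -
    have "(al u, be u, u) \<oplus> (al v, be v, v) \<in> C"
      by (rule closed_conicsD(3)[OF C(1) mem[OF uv(1)] mem[OF uv(2)]]) (use uv(3) in simp)
    hence *: "((al u * u + al v * v) / (u + v), (be u * u + be v * v) / (u + v), u + v) \<in> C" by simp
    have ne: "u + v \<noteq> 0" using uv by (simp add: add_eq_0_iff_eq)
    from * have "u + v \<in> A - {0}" "al (u + v) = (al u * u + al v * v) / (u + v)" "be (u + v) = (be u * u + be v * v) / (u + v)"
      using C_eq by auto
    thus ?thesis using ne by simp
  qed
  have A: "additive_subgroup A"
  proof (rule subgroupI)
    show "0 \<in> A" by (simp add: A_def)
    show "u + v \<in> A" if "u \<in> A" "v \<in> A" for u v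
    proof (cases "u = 0 \<or> v = 0 \<or> u = v")
      case True
      moreover have "0 \<in> A" by (simp add: A_def)
      ultimately show ?thesis using that by auto
    next
      case False thus ?thesis using comp[of u v] that by simp
    qed
  qed
  \<comment> \<open>Composition speaks only of distinct nonzero parameters. The remaining cases hold
    because the unspecified values \<open>al 0\<close> and \<open>be 0\<close> are multiplied by 0,
    and u + u = 0.\<close>
  have add: "al (u + v) * (u + v) = al u * u + al v * v" "be (u + v) * (u + v) = be u * u + be v * v"
    if "u \<in> A" "v \<in> A" for u v
  proof -
    consider "u = 0" | "v = 0" | "u = v" | "u \<noteq> 0" "v \<noteq> 0" "u \<noteq> v" by blast
    hence "al (u + v) * (u + v) = al u * u + al v * v \<and> be (u + v) * (u + v) = be u * u + be v * v"
      by cases (use comp[of u v] that in simp_all)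
    thus "al (u + v) * (u + v) = al u * u + al v * v" "be (u + v) * (u + v) = be u * u + be v * v" by simp_all
  qed
  obtain a0 a1 a2 where a: "\<forall>u\<in>A. al u * u = a0 * u + a1 * u ^ 2 + a2 * u ^ 4"
    using additive_interpolation[OF A card_A, of "\<lambda>u. al u * u"] add(1) by blast
  obtain b0 b1 b2 where b: "\<forall>u\<in>A. be u * u = b0 * u + b1 * u ^ 2 + b2 * u ^ 4"
    using additive_interpolation[OF A card_A, of "\<lambda>u. be u * u"] add(2) by blast
  have div: "x = c0 + c1 * u + c2 * u ^ 3" if "x * u = c0 * u + c1 * u ^ 2 + c2 * u ^ 4" "u \<noteq> 0" for x u c0 c1 c2 :: 'a
  proof -
    have "x * u = (c0 + c1 * u + c2 * u ^ 3) * u"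
      using that(1) by (simp add: power4_eq_xxxx power3_eq_cube power2_eq_square distrib_left distrib_right mult_ac)
    thus ?thesis using that(2) by simp
  qed
  have "C = conic_family A a0 a1 a2 b0 b1 b2"
    unfolding conic_family_def by (subst C_eq, rule image_cong) (use a b div in auto)
  thus ?thesis using A card_A by blast
qed

text \<open>The expression is additive in v, so at (x, y + z) its value would be 1 + 1 = 0. Order 8
  leaves room for y + z to differ from 0 and x.\<close>

lemma polar_not_constantly_one:
  assumes A: "additive_subgroup (A :: 'a set)" "card A = 8"
    and one: "\<And>u v. u \<in> A - {0} \<Longrightarrow> v \<in> A - {0} \<Longrightarrow> u \<noteq> v \<Longrightarrow> abs_trace (w * (u\<^sup>2 * v + u * v\<^sup>2)) = 1"
  shows False
proof -
  obtain x y z where xyz: "x \<in> A - {0}" "y \<in> A - {0, x}" "z \<in> A - {0, x, y, x + y}"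
    using subgroup8_basis[OF A] .
  have swap: "a + b = d \<longleftrightarrow> a = b + d" for a b d :: 'a by (metis add.commute add_self_left)
  have "y + z \<in> A" using xyz A by (simp add: additive_subgroup_def)
  moreover have "y + z \<noteq> 0" "x \<noteq> y + z" using xyz swap[of x y z] swap[of y z x] by (auto simp: add_eq_0_iff_eq add.commute)
  ultimately have "abs_trace (w * (x\<^sup>2 * (y + z) + x * (y + z)\<^sup>2)) = 1" using xyz by (intro one) auto
  moreover have "x\<^sup>2 * (y + z) + x * (y + z)\<^sup>2 = (x\<^sup>2 * y + x * y\<^sup>2) + (x\<^sup>2 * z + x * z\<^sup>2)"
    by (simp add: sum_sq distrib_left add_ac)
  hence "w * (x\<^sup>2 * (y + z) + x * (y + z)\<^sup>2) = w * (x\<^sup>2 * y + x * y\<^sup>2) + w * (x\<^sup>2 * z + x * z\<^sup>2)"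
    by (simp only: distrib_left)
  moreover have "abs_trace (w * (x\<^sup>2 * y + x * y\<^sup>2)) = 1" "abs_trace (w * (x\<^sup>2 * z + x * z\<^sup>2)) = 1"
    using xyz by (auto intro!: one)
  ultimately show False by (simp add: trace_add)
qed

text \<open>The trace condition says that Tr(w \<mu>^3) is a constant t plus an additive function on
  A - {0}. Polarizing, Tr(w (u^2 v + u v^2)) = t for all distinct nonzero u and v, which forces t =
  0. Hence Tr(a0 b0) = 1, b0 is invertible, and stretching A by e^2 with e^6 = w makes it
  isotropic.\<close>

lemma family_normal_form:
  assumes A: "additive_subgroup A" "card A = 8" and a2: "a2 \<noteq> 0"
    and tr: "\<And>\<mu>. \<mu> \<in> A - {0} \<Longrightarrow> abs_trace ((a0 + a1 * \<mu> + a2 * \<mu> ^ 3) * (b0 + b1 * \<mu>)) = 1"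
  shows "\<exists>A'\<in>isotropic_spaces. \<forall>c. arc_equiv (conic_family A a0 a1 a2 b0 b1 0) (mathon_conics A' c)"
proof -
  define w where "w = b0 * a2"
  define t where "t = 1 + abs_trace (a0 * b0)"
  define l where "l \<mu> = abs_trace ((a0 * b1 + a1 * b0) * \<mu> + a1 * b1 * \<mu>\<^sup>2 + a2 * b1 * \<mu> ^ 4)" for \<mu>
  have l_add: "l (u + v) = l u + l v" for u v
  proof -
    have "(u + v) ^ 4 = u ^ 4 + v ^ 4" using sum_pow2[of u v 2] by simp
    thus ?thesis unfolding l_def by (simp add: sum_sq distrib_left trace_add add_ac)
  qed
  have g: "abs_trace (w * \<mu> ^ 3) = t + l \<mu>" if "\<mu> \<in> A - {0}" for \<mu>
  proof -
    have "(a0 + a1 * \<mu> + a2 * \<mu> ^ 3) * (b0 + b1 * \<mu>) =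
      a0 * b0 + w * \<mu> ^ 3 + ((a0 * b1 + a1 * b0) * \<mu> + a1 * b1 * \<mu>\<^sup>2 + a2 * b1 * \<mu> ^ 4)"
      by (simp add: w_def power4_eq_xxxx power3_eq_cube power2_eq_square distrib_left distrib_right mult_ac add_ac)
    hence "abs_trace (a0 * b0) + abs_trace (w * \<mu> ^ 3) + l \<mu> = 1" using tr[OF that] by (simp add: l_def trace_add)
    hence "abs_trace (a0 * b0) + (abs_trace (a0 * b0) + abs_trace (w * \<mu> ^ 3) + l \<mu>) + l \<mu> = t + l \<mu>"
      by (simp add: t_def add_ac)
    thus ?thesis by (simp add: add_ac)
  qed
  have cube: "w * (u + v) ^ 3 = w * u ^ 3 + w * v ^ 3 + w * (u\<^sup>2 * v + u * v\<^sup>2)" for u v :: 'a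
    by (simp add: power3_eq_cube power2_eq_square distrib_left distrib_right mult_ac add_ac)
  have G: "abs_trace (w * (u\<^sup>2 * v + u * v\<^sup>2)) = t" if uv: "u \<in> A - {0}" "v \<in> A - {0}" "u \<noteq> v" for u v
  proof -
    have "u + v \<in> A - {0}" using uv A by (auto simp: additive_subgroup_def add_eq_0_iff_eq)
    hence "t + l (u + v) = abs_trace (w * u ^ 3) + abs_trace (w * v ^ 3) + abs_trace (w * (u\<^sup>2 * v + u * v\<^sup>2))"
      using g[of "u + v"] by (simp only: cube trace_add)
    hence "t + (l u + l v) = (t + l u) + (t + l v) + abs_trace (w * (u\<^sup>2 * v + u * v\<^sup>2))"
      using uv by (simp only: g l_add)
    hence "(t + (l u + l v)) + ((t + l u) + (t + l v)) = ((t + l u) + (t + l v)) + ((t + l u) + (t + l v) + abs_trace (w * (u\<^sup>2 * v + u * v\<^sup>2)))"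
      by (simp only: add.commute)
    thus ?thesis by (simp add: add_ac)
  qed
  have t0: "t = 0"
  proof (rule ccontr)
    assume "t \<noteq> 0"
    hence "t = 1" using trace_cases[of "a0 * b0"] by (auto simp: t_def)
    thus False using polar_not_constantly_one[OF A, of w] G by simp
  qed
  hence tr0: "abs_trace (a0 * b0) = 1" by (simp add: t_def add_eq_0_iff_eq)
  hence b0: "b0 \<noteq> 0" by auto
  hence w0: "w \<noteq> 0" using a2 by (simp add: w_def)
  \<comment> \<open>Replacing \<mu> by \<mu> e^2 multiplies \<mu>^3 by e^6, which has to absorb the
    factor b0 a2.\<close>
  obtain w3 where w3: "w3 ^ 3 = w" using ex_cube_root by blast
  obtain e where e: "e\<^sup>2 = w3" using ex_sqrt by blast
  have e6: "(e\<^sup>2) ^ 3 = b0 * a2" using w3 e by (simp add: w_def)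
  have e0: "e \<noteq> 0" using w0 e w3 by auto
  obtain s where s: "s\<^sup>2 = b0" using ex_sqrt by blast
  have s0: "s \<noteq> 0" using s b0 by auto
  have "abs_trace (b0 * a0 + 1) = 0" using tr0 by (simp add: trace_add mult.commute)
  \<comment> \<open>With this k the constant term b0 a0 + k^2 + k of the new \<alpha> becomes
    1.\<close>
  then obtain k where k: "k\<^sup>2 + k = b0 * a0 + 1" using artin_schreier by blast
  \<comment> \<open>Adding \<mu> b^2 cancels the linear term of \<beta> / b0.\<close>
  obtain b where b: "b\<^sup>2 = b1 / b0" using ex_sqrt by blast
  define A' where "A' = (\<lambda>\<mu>. \<mu> * e\<^sup>2) ` A"
  have inj: "inj_on (\<lambda>\<mu>. \<mu> * e\<^sup>2) A" using e0 by (auto intro: inj_onI)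
  have "A' \<in> isotropic_spaces"
  proof -
    have "polar (u * e\<^sup>2) (v * e\<^sup>2) = 0" if "u \<in> A" "v \<in> A" for u v
    proof -
      have "(u * e\<^sup>2)\<^sup>2 * (v * e\<^sup>2) + (u * e\<^sup>2) * (v * e\<^sup>2)\<^sup>2 = (e\<^sup>2) ^ 3 * (u\<^sup>2 * v + u * v\<^sup>2)"
        by (simp add: power3_eq_cube power2_eq_square distrib_left mult_ac)
      hence *: "polar (u * e\<^sup>2) (v * e\<^sup>2) = abs_trace (w * (u\<^sup>2 * v + u * v\<^sup>2))"
        by (simp only: polar_def w_def e6)
      show ?thesis
      proof (cases "u = 0 \<or> v = 0 \<or> u = v")
        case True
        thus ?thesis by auto
      next
        case False
        thus ?thesis unfolding * using G[of u v] that t0 by simp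
      qed
    qed
    moreover have "additive_subgroup A'"
    proof (rule subgroupI)
      show "0 \<in> A'" unfolding A'_def using A(1)
        by (intro image_eqI[of _ _ 0]) (simp_all add: additive_subgroup_def)
      fix x y assume "x \<in> A'" "y \<in> A'"
      then obtain u v where "u \<in> A" "v \<in> A" "x + y = (u + v) * e\<^sup>2" by (auto simp: A'_def distrib_right)
      thus "x + y \<in> A'" using A(1) by (auto simp: A'_def additive_subgroup_def)
    qed
    moreover have "card A' = 8" using A(2) inj by (simp add: A'_def card_image)
    ultimately show ?thesis by (auto simp: isotropic_spaces_def A'_def)
  qed
  moreover have "arc_equiv (conic_family A a0 a1 a2 b0 b1 0) (mathon_conics A' c)" for c
  proof -
    \<comment> \<open>Adding \<mu> a^2 makes the coefficient of \<mu> in the new \<alpha> equal to c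
      e^2, which is c in terms of the stretched parameter.\<close>
    obtain a where a: "a\<^sup>2 = b0 * a1 + b1 * (k / s)\<^sup>2 + c * e\<^sup>2" using ex_sqrt by blast
    let ?h = "conic_subst s 0 (k / s) (1 / s) a b e"
    have h: "?h (a0 + a1 * \<mu> + a2 * \<mu> ^ 3, b0 + b1 * \<mu> + 0 * \<mu> ^ 3, \<mu>) = (1 + (\<mu> * e\<^sup>2) ^ 3 + c * (\<mu> * e\<^sup>2), 1, \<mu> * e\<^sup>2)" for \<mu>
    proof -
      have sb: "b0 * (k / s)\<^sup>2 = k\<^sup>2" using s b0 by (simp add: power_divide)
      have "(a0 + a1 * \<mu> + a2 * \<mu> ^ 3) * s\<^sup>2 + s * (k / s) + (b0 + b1 * \<mu>) * (k / s)\<^sup>2 + \<mu> * a\<^sup>2 =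
        b0 * a0 + (b0 * (k / s)\<^sup>2 + k) + b0 * a2 * \<mu> ^ 3 + c * e\<^sup>2 * \<mu>"
        unfolding a s using s0 by (simp add: distrib_left distrib_right mult_ac add_ac)
      also have "\<dots> = 1 + b0 * a2 * \<mu> ^ 3 + c * e\<^sup>2 * \<mu>" unfolding sb k by (simp add: add_ac)
      also have "\<dots> = 1 + (\<mu> * e\<^sup>2) ^ 3 + c * (\<mu> * e\<^sup>2)"
        unfolding power_mult_distrib[of \<mu> "e\<^sup>2" 3] e6 by (simp add: mult_ac)
      finally have 1: "(a0 + a1 * \<mu> + a2 * \<mu> ^ 3) * s\<^sup>2 + s * (k / s) + (b0 + b1 * \<mu>) * (k / s)\<^sup>2 + \<mu> * a\<^sup>2 =
        1 + (\<mu> * e\<^sup>2) ^ 3 + c * (\<mu> * e\<^sup>2)" .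
      have "(1 / s)\<^sup>2 = 1 / b0" using s by (simp add: power_divide)
      hence 2: "(b0 + b1 * \<mu>) * (1 / s)\<^sup>2 + \<mu> * b\<^sup>2 = 1"
        using b0 by (simp add: b distrib_right add_divide_distrib add_ac mult_ac)
      show ?thesis using 1 2 by simp
    qed
    have "?h ` conic_family A a0 a1 a2 b0 b1 0 = (\<lambda>\<mu>. (1 + (\<mu> * e\<^sup>2) ^ 3 + c * (\<mu> * e\<^sup>2), 1, \<mu> * e\<^sup>2)) ` (A - {0})"
      unfolding conic_family_def image_image h ..
    also have "\<dots> = (\<lambda>\<mu>. (1 + \<mu> ^ 3 + c * \<mu>, 1, \<mu>)) ` ((\<lambda>\<mu>. \<mu> * e\<^sup>2) ` (A - {0}))"
      by (simp only: image_image)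
    also have "(\<lambda>\<mu>. \<mu> * e\<^sup>2) ` (A - {0}) = A' - {0}" unfolding A'_def using e0 by auto
    finally have "?h ` conic_family A a0 a1 a2 b0 b1 0 = mathon_conics A' c" by (simp only: mathon_conics_def)
    moreover have "arc_equiv (conic_family A a0 a1 a2 b0 b1 0) (?h ` conic_family A a0 a1 a2 b0 b1 0)"
      by (rule arc_equiv_subst) (use s0 e0 in simp_all)
    ultimately show ?thesis by simp
  qed
  ultimately show ?thesis by blast
qed

text \<open>The shear x \<mapsto> x + t y changes \<beta> into \<beta> + t + t^2 \<alpha>, and t^2 =
  b2 / a2 removes the cubic term. The trace condition survives because \<alpha> \<beta> changes by
  (\<alpha> t)^2 + \<alpha> t, which has trace 0.\<close>

lemma family_normal_form':
  assumes A: "additive_subgroup A" "card A = 8" and a2: "a2 \<noteq> 0"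
    and tr: "\<And>\<mu>. \<mu> \<in> A - {0} \<Longrightarrow> abs_trace ((a0 + a1 * \<mu> + a2 * \<mu> ^ 3) * (b0 + b1 * \<mu> + b2 * \<mu> ^ 3)) = 1"
  shows "\<exists>A'\<in>isotropic_spaces. \<forall>c. arc_equiv (conic_family A a0 a1 a2 b0 b1 b2) (mathon_conics A' c)"
proof -
  obtain t where t: "t\<^sup>2 = b2 / a2" using ex_sqrt by blast
  let ?h = "conic_subst 1 t 0 1 0 0 1"
  define b0' b1' where "b0' = b0 + t + t\<^sup>2 * a0" and "b1' = b1 + t\<^sup>2 * a1"
  have be: "(a0 + a1 * \<mu> + a2 * \<mu> ^ 3) * t\<^sup>2 + t + (b0 + b1 * \<mu> + b2 * \<mu> ^ 3) = b0' + b1' * \<mu>" for \<mu>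
  proof -
    have "(a0 + a1 * \<mu> + a2 * \<mu> ^ 3) * t\<^sup>2 + t + (b0 + b1 * \<mu> + b2 * \<mu> ^ 3) = b0' + b1' * \<mu> + (a2 * t\<^sup>2 + b2) * \<mu> ^ 3"
      by (simp add: b0'_def b1'_def distrib_left distrib_right mult_ac add_ac)
    thus ?thesis using a2 by (simp add: t)
  qed
  have "?h ` conic_family A a0 a1 a2 b0 b1 b2 = conic_family A a0 a1 a2 b0' b1' 0"
    unfolding conic_family_def image_image by (rule image_cong) (simp_all add: be)
  hence "arc_equiv (conic_family A a0 a1 a2 b0 b1 b2) (conic_family A a0 a1 a2 b0' b1' 0)"
    using arc_equiv_subst[of 1 1 t 0 1 "conic_family A a0 a1 a2 b0 b1 b2" 0 0] by simp
  moreover have "\<exists>A'\<in>isotropic_spaces. \<forall>c. arc_equiv (conic_family A a0 a1 a2 b0' b1' 0) (mathon_conics A' c)"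
  proof (rule family_normal_form[OF A a2])
    fix \<mu> assume \<mu>: "\<mu> \<in> A - {0}"
    define al where "al = a0 + a1 * \<mu> + a2 * \<mu> ^ 3"
    have "al * (b0' + b1' * \<mu>) = (al * t)\<^sup>2 + al * t + al * (b0 + b1 * \<mu> + b2 * \<mu> ^ 3)"
      unfolding be[symmetric] al_def[symmetric] by (simp add: power2_eq_square distrib_left mult_ac)
    hence "abs_trace (al * (b0' + b1' * \<mu>)) = abs_trace (al * (b0 + b1 * \<mu> + b2 * \<mu> ^ 3))"
      by (simp only: trace_add trace_sq) simp
    thus "abs_trace ((a0 + a1 * \<mu> + a2 * \<mu> ^ 3) * (b0' + b1' * \<mu>)) = 1" using tr[OF \<mu>] by (simp add: al_def)
  qed
  ultimately show ?thesis using arc_equiv_trans by blast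
qed

text \<open>Without cubic terms, Tr(\<alpha> \<beta>) is Tr(a0 b0) plus an additive function l. As l
  takes one value at x, y and x + y, that value is 0, so Tr(a0 b0) = 1. The linear terms are then
  absorbed by the substitution for z.\<close>

lemma family_pencil:
  assumes A: "additive_subgroup A" "card A = 8"
    and tr: "\<And>\<mu>. \<mu> \<in> A - {0} \<Longrightarrow> abs_trace ((a0 + a1 * \<mu>) * (b0 + b1 * \<mu>)) = 1"
  shows "\<exists>\<alpha>. abs_trace \<alpha> = 1 \<and> arc_equiv (conic_family A a0 a1 0 b0 b1 0) {(\<alpha>, 1, \<mu>) | \<mu>. \<mu> \<in> A - {0}}"
proof -
  define l where "l \<mu> = abs_trace ((a0 * b1 + a1 * b0) * \<mu> + a1 * b1 * \<mu>\<^sup>2)" for \<mu>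
  have l_add: "l (u + v) = l u + l v" for u v
    unfolding l_def by (simp add: sum_sq distrib_left trace_add add_ac)
  have l: "abs_trace (a0 * b0) + l \<mu> = 1" if "\<mu> \<in> A - {0}" for \<mu>
  proof -
    have "(a0 + a1 * \<mu>) * (b0 + b1 * \<mu>) = a0 * b0 + ((a0 * b1 + a1 * b0) * \<mu> + a1 * b1 * \<mu>\<^sup>2)"
      by (simp add: power2_eq_square distrib_left distrib_right mult_ac add_ac)
    thus ?thesis using tr[OF that] by (simp add: l_def trace_add)
  qed
  obtain x y z where xyz: "x \<in> A - {0}" "y \<in> A - {0, x}" "z \<in> A - {0, x, y, x + y}"
    using subgroup8_basis[OF A] .
  have "x + y \<in> A - {0}" using xyz A by (auto simp: additive_subgroup_def add_eq_0_iff_eq)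
  hence "abs_trace (a0 * b0) + (l x + l y) = 1" using l l_add by metis
  moreover have "abs_trace (a0 * b0) + l x = 1" "abs_trace (a0 * b0) + l y = 1" using l xyz by auto
  ultimately have tr0: "abs_trace (a0 * b0) = 1" by (metis add.assoc add.right_neutral add_left_cancel)
  hence b0: "b0 \<noteq> 0" by auto
  obtain s where s: "s\<^sup>2 = b0" using ex_sqrt by blast
  obtain a where a: "a\<^sup>2 = b0 * a1" using ex_sqrt by blast
  obtain b where b: "b\<^sup>2 = b1 / b0" using ex_sqrt by blast
  have s0: "s \<noteq> 0" using s b0 by auto
  let ?h = "conic_subst s 0 0 (1 / s) a b 1"
  have h: "?h (a0 + a1 * \<mu> + 0 * \<mu> ^ 3, b0 + b1 * \<mu> + 0 * \<mu> ^ 3, \<mu>) = (a0 * b0, 1, \<mu>)" for \<mu>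
  proof -
    have "(a0 + a1 * \<mu>) * s\<^sup>2 + \<mu> * a\<^sup>2 = a0 * b0" by (simp add: s a distrib_left distrib_right mult_ac add_ac)
    moreover have "(1 / s)\<^sup>2 = 1 / b0" using s by (simp add: power_divide)
    hence "(b0 + b1 * \<mu>) * (1 / s)\<^sup>2 + \<mu> * b\<^sup>2 = 1"
      using b0 by (simp add: b distrib_right add_divide_distrib add_ac mult_ac)
    ultimately show ?thesis by simp
  qed
  have "?h ` conic_family A a0 a1 0 b0 b1 0 = {(a0 * b0, 1, \<mu>) | \<mu>. \<mu> \<in> A - {0}}"
    unfolding conic_family_def image_image h by blast
  hence "arc_equiv (conic_family A a0 a1 0 b0 b1 0) {(a0 * b0, 1, \<mu>) | \<mu>. \<mu> \<in> A - {0}}"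
    using arc_equiv_subst[of s "1 / s" 0 0 1 "conic_family A a0 a1 0 b0 b1 0" a b] s0 by simp
  thus ?thesis using tr0 by blast
qed

lemma closed_conics_normal_form:
  assumes C: "closed_conics (C :: 'a conic_param set)" "card C = 7"
  shows "(\<exists>\<alpha> A. abs_trace \<alpha> = 1 \<and> additive_subgroup A \<and> arc_equiv C {(\<alpha>, 1, \<mu>) | \<mu>. \<mu> \<in> A - {0}}) \<or>
    (\<exists>A\<in>isotropic_spaces. \<forall>c. arc_equiv C (mathon_conics A c))"
proof -
  obtain A a0 a1 a2 b0 b1 b2 where A: "additive_subgroup A" "card A = 8" and fam: "C = conic_family A a0 a1 a2 b0 b1 b2"
    using closed_conics_family[OF C] by blast
  have tr: "abs_trace ((a0 + a1 * \<mu> + a2 * \<mu> ^ 3) * (b0 + b1 * \<mu> + b2 * \<mu> ^ 3)) = 1" if "\<mu> \<in> A - {0}" for \<mu>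
  proof -
    have "(a0 + a1 * \<mu> + a2 * \<mu> ^ 3, b0 + b1 * \<mu> + b2 * \<mu> ^ 3, \<mu>) \<in> C"
      unfolding fam conic_family_def using that by blast
    from closed_conicsD(1)[OF C(1) this] show ?thesis by simp
  qed
  consider "a2 \<noteq> 0" | "a2 = 0" "b2 \<noteq> 0" | "a2 = 0" "b2 = 0" by blast
  thus ?thesis
  proof cases
    case 1
    thus ?thesis using family_normal_form'[OF A 1 tr] unfolding fam by blast
  next
    case 2
    \<comment> \<open>Interchanging x and y interchanges \<alpha> and \<beta>.\<close>
    have "conic_subst 0 1 1 0 0 0 1 ` C = conic_family A b0 b1 b2 a0 a1 a2"
      unfolding fam conic_family_def image_image by (rule image_cong) simp_all
    hence "arc_equiv C (conic_family A b0 b1 b2 a0 a1 a2)"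
      using arc_equiv_subst[of 0 0 1 1 1 C 0 0] by simp
    moreover have "\<exists>A'\<in>isotropic_spaces. \<forall>c. arc_equiv (conic_family A b0 b1 b2 a0 a1 a2) (mathon_conics A' c)"
      by (rule family_normal_form'[OF A 2(2)]) (use tr in \<open>simp add: mult.commute\<close>)
    ultimately show ?thesis using arc_equiv_trans by blast
  next
    case 3
    have "\<exists>\<alpha>. abs_trace \<alpha> = 1 \<and> arc_equiv (conic_family A a0 a1 0 b0 b1 0) {(\<alpha>, 1, \<mu>) | \<mu>. \<mu> \<in> A - {0}}"
      by (rule family_pencil[OF A]) (use tr 3 in simp)
    thus ?thesis using A(1) unfolding fam 3 by blast
  qed
qed

end

section \<open>Isomorphism classes\<close>

text \<open>\<phi> preserves and reflects equivalence and meets every class of R, so sending a class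
  to the R-class of its image is a bijection, even where \<phi> itself is not.\<close>

lemma card_quotient_transfer:
  assumes E: "equiv X E" and R: "equiv S R" and \<phi>: "\<And>x. x \<in> X \<Longrightarrow> \<phi> x \<in> S"
    and iff: "\<And>x y. x \<in> X \<Longrightarrow> y \<in> X \<Longrightarrow> (\<phi> x, \<phi> y) \<in> R \<longleftrightarrow> (x, y) \<in> E"
    and surj: "\<And>s. s \<in> S \<Longrightarrow> \<exists>x\<in>X. (\<phi> x, s) \<in> R"
  shows "card (S // R) = card (X // E)"
proof -
  have img: "R `` (\<phi> ` (E `` {x})) = R `` {\<phi> x}" if x: "x \<in> X" for x
  proof -
    have *: "R `` {\<phi> y} = R `` {\<phi> x}" if "y \<in> E `` {x}" for y
    proof -
      have "y \<in> X" "(x, y) \<in> E" using that E by (auto simp: equiv_def)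
      hence "(\<phi> x, \<phi> y) \<in> R" using iff x by blast
      thus ?thesis using equiv_class_eq[OF R] by blast
    qed
    have "x \<in> E `` {x}" using E x by (rule equiv_class_self)
    thus ?thesis using * by blast
  qed
  have "bij_betw (\<lambda>c. R `` (\<phi> ` c)) (X // E) (S // R)"
    unfolding bij_betw_def
  proof
    show "inj_on (\<lambda>c. R `` (\<phi> ` c)) (X // E)"
    proof (rule inj_onI)
      fix c d assume "c \<in> X // E" "d \<in> X // E" and eq: "R `` (\<phi> ` c) = R `` (\<phi> ` d)"
      then obtain x y where xy: "x \<in> X" "c = E `` {x}" "y \<in> X" "d = E `` {y}" by (auto elim!: quotientE)
      hence "R `` {\<phi> x} = R `` {\<phi> y}" using eq img by simp
      hence "(\<phi> x, \<phi> y) \<in> R" using eq_equiv_class[OF _ R] \<phi> xy by blast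
      hence "(x, y) \<in> E" using iff xy by blast
      thus "c = d" unfolding xy(2,4) by (rule equiv_class_eq[OF E])
    qed
    show "(\<lambda>c. R `` (\<phi> ` c)) ` (X // E) = S // R"
    proof (intro equalityI subsetI)
      fix c assume "c \<in> (\<lambda>c. R `` (\<phi> ` c)) ` (X // E)"
      then obtain x where "x \<in> X" "c = R `` (\<phi> ` (E `` {x}))" by (auto elim!: quotientE)
      thus "c \<in> S // R" using img \<phi> by (simp add: quotientI)
    next
      fix c assume "c \<in> S // R"
      then obtain s where s: "s \<in> S" "c = R `` {s}" by (rule quotientE)
      obtain x where x: "x \<in> X" "(\<phi> x, s) \<in> R" using surj[OF s(1)] by blast
      hence "c = R `` (\<phi> ` (E `` {x}))" using img[OF x(1)] equiv_class_eq[OF R x(2)] s by simp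
      moreover have "E `` {x} \<in> X // E" using x(1) by (rule quotientI)
      ultimately show "c \<in> (\<lambda>c. R `` (\<phi> ` c)) ` (X // E)" by blast
    qed
  qed
  thus ?thesis using bij_betw_same_card by metis
qed

context char_two_field
begin

text \<open>The degree is read off from a line through F0, here y = 0: it has 1 + |C| points, hence
  not 0.\<close>

lemma card_closed_conics:
  assumes C: "closed_conics (C :: 'a conic_param set)"
    and f: "Vector_Spaces.linear (*s) (*s) f" "bij f" and K: "maximal_arc 8 ((`) f ` conics_union C)"
  shows "card C = 7"
proof -
  let ?L = "{v :: 'a ^ 3. v $ 1 * 0 = v $ 2 * 1}"
  have "(1, 0) \<in> (dirs :: ('a \<times> 'a) set)" by (simp add: dirs_def)
  hence card: "card {P \<in> conics_union C. P \<subseteq> ?L} = 1 + card C" by (rule card_line_through_F0[OF C])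
  have L: "?L \<in> lines"
    unfolding lines_iff
  proof (intro exI conjI allI)
    show "vec3 0 0 1 \<noteq> (0 :: 'a ^ 3)" by (simp add: vec3_eq_iff)
    show "vec3 1 0 0 \<noteq> k *s vec3 0 0 (1::'a)" for k by (simp add: vec3_eq_iff)
    show "?L = {a *s vec3 1 0 0 + b *s vec3 0 0 1 | a b. True}"
    proof (intro equalityI subsetI)
      fix v assume "v \<in> ?L"
      hence "v = v $ 1 *s vec3 1 0 0 + v $ 3 *s vec3 0 0 1" by (subst vec3_eq_iff) simp
      thus "v \<in> {a *s vec3 1 0 0 + b *s vec3 0 0 1 | a b. True}" by blast
    qed auto
  qed
  have inj: "inj ((`) f)"
    by (rule injI) (simp add: inj_image_eq_iff[OF bij_is_inj[OF f(2)]])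
  have "{P \<in> (`) f ` conics_union C. P \<subseteq> f ` ?L} = (`) f ` {P \<in> conics_union C. P \<subseteq> ?L}"
    using f(2) by (auto simp: bij_is_inj inj_image_subset_iff)
  hence "card {P \<in> (`) f ` conics_union C. P \<subseteq> f ` ?L} = 1 + card C"
    using card inj by (simp add: card_image inj_on_subset)
  moreover have "card {P \<in> (`) f ` conics_union C. P \<subseteq> f ` ?L} \<in> {0, 8}"
    using K image_lines[OF f L] unfolding maximal_arc_def by blast
  ultimately show ?thesis by auto
qed

lemma arc_equiv_iff:
  "arc_equiv C C' \<longleftrightarrow> (\<exists>f. Vector_Spaces.linear (*s) (*s) f \<and> bij f \<and> (`) f ` conics_union C = conics_union (C' :: 'a conic_param set))"
proof -
  have "(`) f ` conics_union C = conics_union C' \<longleftrightarrow> f ` arc_cone C = arc_cone C'"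
    if "Vector_Spaces.linear (*s) (*s) f" "bij f" for f :: "'a ^ 3 \<Rightarrow> 'a ^ 3"
    by (rule image_conics_union_iff[OF id_automorphism that(1)[unfolded linear_semilinear] that(2)])
  thus ?thesis unfolding arc_equiv_def by (intro ex_cong1 conj_cong) simp_all
qed

lemma linear_comp:
  fixes f f' :: "'a ^ 3 \<Rightarrow> 'a ^ 3"
  assumes "Vector_Spaces.linear (*s) (*s) f" "bij f" "Vector_Spaces.linear (*s) (*s) f'" "bij f'"
  shows "Vector_Spaces.linear (*s) (*s) (f' \<circ> f)" "bij (f' \<circ> f)" "(`) (f' \<circ> f) ` K = (`) f' ` ((`) f ` K)"
proof -
  show "Vector_Spaces.linear (*s) (*s) (f' \<circ> f)" using assms(1,3) unfolding linear_vec_iff by simp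
  show "bij (f' \<circ> f)" using assms(2,4) by (rule bij_comp)
  have "(`) (f' \<circ> f) = (\<lambda>X. f' ` f ` X)" by (simp add: fun_eq_iff image_comp)
  thus "(`) (f' \<circ> f) ` K = (`) f' ` ((`) f ` K)" by (simp only: image_image)
qed

lemma closed_pencil: "abs_trace (\<alpha> :: 'a) = 1 \<Longrightarrow> additive_subgroup B \<Longrightarrow> closed_conics {(\<alpha>, 1, \<mu>) | \<mu>. \<mu> \<in> B - {0}}"
proof -
  assume \<alpha>: "abs_trace \<alpha> = 1" and B: "additive_subgroup B"
  let ?C = "{(\<alpha>, 1 :: 'a, \<mu>) | \<mu>. \<mu> \<in> B - {0}}"
  show ?thesis unfolding closed_conics_def
  proof (intro conjI ballI impI)
    show "admissible c" if "c \<in> ?C" for c using that \<alpha> by auto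
    show "inj_on conic_mu ?C" by (auto intro: inj_onI)
    fix c c' assume "c \<in> ?C" "c' \<in> ?C" "c \<noteq> c'"
    then obtain \<mu> \<mu>' where *: "c = (\<alpha>, 1, \<mu>)" "c' = (\<alpha>, 1, \<mu>')" "\<mu> \<in> B" "\<mu>' \<in> B" "\<mu> \<noteq> \<mu>'" by auto
    hence s: "\<mu> + \<mu>' \<noteq> 0" "\<mu> + \<mu>' \<in> B" using B by (auto simp: add_eq_0_iff_eq additive_subgroup_def)
    have "\<alpha> * \<mu> + \<alpha> * \<mu>' = \<alpha> * (\<mu> + \<mu>')" by (simp add: distrib_left)
    hence "c \<oplus> c' = (\<alpha>, 1, \<mu> + \<mu>')" using s by (simp add: *)
    thus "c \<oplus> c' \<in> ?C" using s by blast
  qed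
qed

text \<open>By \<open>mathon_conics_twist_equiv\<close> the choice of c does not affect the
  isomorphism class.\<close>

definition mathon_arc :: "'a set \<Rightarrow> 'a point set" where
  "mathon_arc A = conics_union (mathon_conics A (SOME c. twist A c))"

lemma twist_some: "A \<in> isotropic_spaces \<Longrightarrow> twist A (SOME c. twist A c)"
  using ex_twist by (rule someI_ex)

lemma PGL3_I: "Vector_Spaces.linear (*s) (*s) f \<Longrightarrow> bij f \<Longrightarrow> (`) f \<in> PGL3"
  by (auto simp: PGL3_def)

text \<open>A Denniston pencil for this arc would also have seven conics, as the degree is 8, and so
  enough parameters for \<open>mathon_conics_not_pencil\<close>.\<close>

lemma mathon_arc_proper:
  assumes A: "A \<in> isotropic_spaces" and m: "m \<ge> 5"
  shows "mathon_arc A \<in> proper_Mathon_arcs 8"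
proof -
  define c where "c = (SOME c. twist A c)"
  have c: "twist A c" unfolding c_def by (rule twist_some[OF A])
  have sub: "additive_subgroup A" "card A = 8" using A by (simp_all add: isotropic_spaces_def)
  have K: "mathon_arc A = conics_union (mathon_conics A c)" by (simp add: mathon_arc_def c_def)
  have max: "maximal_arc 8 (mathon_arc A)"
    unfolding K by (rule maximal_arc_mathon_conics[OF sub c]) (use m in simp)
  moreover have "Mathon_type (mathon_arc A)"
    unfolding Mathon_type_def
  proof (intro conjI exI bexI)
    show "maximal_arc 8 (mathon_arc A)" by (rule max)
    show "mathon_conics A c \<noteq> {}" using card_mathon_conics[OF sub, of c] by auto
    show "closed_conics (mathon_conics A c)" by (rule closed_mathon_conics[OF sub(1) c])
    show "mathon_arc A = (`) (\<lambda>x. x) ` conics_union (mathon_conics A c)" by (simp add: K)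
    show "(`) (\<lambda>x. x) \<in> PGL3" by (rule PGL3_I) (simp_all add: linear_vec_iff bij_id[unfolded id_def])
  qed
  moreover have "\<not> Denniston_type (mathon_arc A)"
  proof
    assume "Denniston_type (mathon_arc A)"
    then obtain \<alpha> B g where *: "abs_trace \<alpha> = 1" "additive_subgroup B" "g \<in> PGL3"
      "mathon_arc A = g ` conics_union {(\<alpha>, 1, \<mu>) | \<mu>. \<mu> \<in> B - {0}}" unfolding Denniston_type_def by blast
    let ?D = "{(\<alpha>, 1 :: 'a, \<mu>) | \<mu>. \<mu> \<in> B - {0}}"
    obtain f where f: "Vector_Spaces.linear (*s) (*s) f" "bij f" "g = (`) f" using PGL3_obtain[OF *(3)] .
    have "card ?D = 7"
      by (rule card_closed_conics[OF closed_pencil[OF *(1,2)] f(1,2)]) (use max *(4) f(3) in simp)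
    moreover have "?D = (\<lambda>\<mu>. (\<alpha>, 1, \<mu>)) ` (B - {0})" by blast
    hence "card ?D = card (B - {0})" by (simp only: card_image[OF inj_mathon_param])
    ultimately have B: "card (B - {0}) \<ge> 4" by simp
    have "(`) f ` conics_union ?D = conics_union (mathon_conics A c)" using *(4) by (simp only: f(3) K)
    hence "arc_equiv ?D (mathon_conics A c)" unfolding arc_equiv_iff using f(1,2) by blast
    hence "arc_equiv (mathon_conics A c) ?D" by (rule arc_equiv_sym)
    thus False using mathon_conics_not_pencil[OF sub B _ _ m] unfolding arc_equiv_def by blast
  qed
  ultimately show ?thesis by (simp add: proper_Mathon_arcs_def)
qed

lemma proper_Mathon_arc_equiv:
  assumes K: "(K :: 'a point set) \<in> proper_Mathon_arcs 8"
  shows "\<exists>A\<in>isotropic_spaces. (mathon_arc A, K) \<in> isomorphic"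
proof -
  have max: "maximal_arc 8 K" and nD: "\<not> Denniston_type K" and "Mathon_type K"
    using K by (simp_all add: proper_Mathon_arcs_def)
  then obtain C g where C: "closed_conics C" "g \<in> PGL3" "K = g ` conics_union C" unfolding Mathon_type_def by blast
  obtain f where f: "Vector_Spaces.linear (*s) (*s) f" "bij f" "g = (`) f" using PGL3_obtain[OF C(2)] .
  have card: "card C = 7" by (rule card_closed_conics[OF C(1) f(1,2)]) (use max C(3) f(3) in simp)
  have transport: "\<exists>g'\<in>PGL3. K = g' ` conics_union D" if "arc_equiv C D" for D
  proof -
    from arc_equiv_sym[OF that] obtain f' where f': "Vector_Spaces.linear (*s) (*s) f'" "bij f'"
      "(`) f' ` conics_union D = conics_union C" unfolding arc_equiv_iff by blast
    have "(`) (f \<circ> f') ` conics_union D = K"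
      unfolding linear_comp(3)[OF f'(1,2) f(1,2)] f'(3) C(3) f(3) ..
    thus ?thesis using PGL3_I[OF linear_comp(1,2)[OF f'(1,2) f(1,2)]] by blast
  qed
  from closed_conics_normal_form[OF C(1) card] show ?thesis
  proof
    assume "\<exists>\<alpha> A. abs_trace \<alpha> = 1 \<and> additive_subgroup A \<and> arc_equiv C {(\<alpha>, 1, \<mu>) | \<mu>. \<mu> \<in> A - {0}}"
    hence "Denniston_type K" unfolding Denniston_type_def using max transport by blast
    thus ?thesis using nD by blast
  next
    assume "\<exists>A\<in>isotropic_spaces. \<forall>c. arc_equiv C (mathon_conics A c)"
    then obtain A where A: "A \<in> isotropic_spaces" "\<forall>c. arc_equiv C (mathon_conics A c)" by blast
    \<comment> \<open>The equivalence is available for every c, in particular for the one chosen in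
      \<open>mathon_arc\<close>.\<close>
    then obtain g' where "g' \<in> PGL3" "K = g' ` mathon_arc A" unfolding mathon_arc_def using transport by blast
    hence "(mathon_arc A, K) \<in> isomorphic" using PGL3_subset unfolding isomorphic_def by blast
    thus ?thesis using A(1) by blast
  qed
qed

text \<open>Composing a semilinear map with the inverse of S leaves a linear map, which is what
  \<open>mathon_conics_rigid\<close> requires. The shape of the normal form is kept because \<sigma>
  fixes 1.\<close>

lemma coordinatewise_semilinear:
  assumes \<sigma>: "field_automorphism (\<sigma> :: 'a \<Rightarrow> 'a)"
  defines "S \<equiv> \<lambda>v. vec3 (\<sigma> (v $ 1)) (\<sigma> (v $ 2)) (\<sigma> (v $ 3))"
  shows "semilinear \<sigma> S" "bij S" "S ` arc_cone (mathon_conics A c) = arc_cone (mathon_conics (\<sigma> ` A) (\<sigma> c))"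
proof -
  note \<sigma>s = field_automorphismD[OF \<sigma>]
  show "semilinear \<sigma> S" unfolding semilinear_def S_def
    by (intro conjI allI; subst vec3_eq_iff) (simp_all add: \<sigma>s)
  have "inj S"
    by (rule injI) (use \<sigma>s(5) in \<open>auto simp: S_def vec3_eq_iff dest: injD\<close>)
  thus bij: "bij S" by (simp add: bij_def finite_UNIV_inj_surj)
  have zero: "\<sigma> x = 0 \<longleftrightarrow> x = 0" for x using \<sigma>s(3,5) by (metis injD)
  have qf: "qf (\<sigma> \<alpha>, \<sigma> \<beta>, \<sigma> \<mu>) (S v) = 0 \<longleftrightarrow> qf (\<alpha>, \<beta>, \<mu>) v = 0" for \<alpha> \<beta> \<mu> v
  proof -
    have "qf (\<sigma> \<alpha>, \<sigma> \<beta>, \<sigma> \<mu>) (S v) = \<sigma> (qf (\<alpha>, \<beta>, \<mu>) v)" by (simp add: S_def \<sigma>s)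
    thus ?thesis by (simp only: zero)
  qed
  have "v \<in> arc_cone (mathon_conics A c) \<longleftrightarrow> S v \<in> arc_cone (mathon_conics (\<sigma> ` A) (\<sigma> c))" for v
  proof -
    have "\<sigma> ` A - {0} = \<sigma> ` (A - {0})" using zero by auto
    hence "mathon_conics (\<sigma> ` A) (\<sigma> c) = (\<lambda>\<mu>. (\<sigma> (1 + \<mu> ^ 3 + c * \<mu>), \<sigma> 1, \<sigma> \<mu>)) ` (A - {0})"
      by (simp add: mathon_conics_def image_image \<sigma>s)
    hence "(\<exists>p\<in>mathon_conics (\<sigma> ` A) (\<sigma> c). qf p (S v) = 0) \<longleftrightarrow> (\<exists>p\<in>mathon_conics A c. qf p v = 0)"
      by (simp only: mathon_conics_def[of A c] bex_simps(7) qf)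
    thus ?thesis by (simp add: arc_cone_def S_def zero)
  qed
  hence "arc_cone (mathon_conics A c) = S -` arc_cone (mathon_conics (\<sigma> ` A) (\<sigma> c))" by blast
  thus "S ` arc_cone (mathon_conics A c) = arc_cone (mathon_conics (\<sigma> ` A) (\<sigma> c))"
    using bij by (simp add: surj_image_vimage_eq bij_is_surj)
qed

text \<open>Replacing z by z + a x adds a^2 \<mu> to \<alpha>.\<close>

lemma mathon_conics_twist_equiv: "arc_equiv (mathon_conics A c) (mathon_conics A c')"
proof -
  obtain a where a: "a\<^sup>2 = c + c'" using ex_sqrt by blast
  have "conic_subst 1 0 0 1 a 0 1 ` mathon_conics A c = mathon_conics A c'"
    unfolding mathon_conics_def image_image by (rule image_cong) (simp_all add: a distrib_left mult_ac add_ac)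
  thus ?thesis using arc_equiv_subst[of 1 1 0 0 1 "mathon_conics A c" a 0] by simp
qed

lemma mathon_arc_isomorphic_iff:
  assumes A: "A \<in> isotropic_spaces" and B: "B \<in> isotropic_spaces" and m: "m \<ge> 5"
  shows "(mathon_arc A, mathon_arc B) \<in> isomorphic \<longleftrightarrow> (A, B) \<in> galois_rel"
proof -
  define c d where "c = (SOME c. twist A c)" and "d = (SOME c. twist B c)"
  have K: "mathon_arc A = conics_union (mathon_conics A c)" "mathon_arc B = conics_union (mathon_conics B d)"
    by (simp_all add: mathon_arc_def c_def d_def)
  show ?thesis
  proof
    assume "(mathon_arc A, mathon_arc B) \<in> isomorphic"
    then obtain \<sigma> f where f: "field_automorphism \<sigma>" "semilinear \<sigma> f" "bij f"
      "(`) f ` conics_union (mathon_conics A c) = conics_union (mathon_conics B d)"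
      unfolding isomorphic_def PGammaL3_def K by auto
    hence fc: "f ` arc_cone (mathon_conics A c) = arc_cone (mathon_conics B d)"
      by (simp only: image_conics_union_iff[OF f(1-3)])
    define S where "S = (\<lambda>v :: 'a ^ 3. vec3 (\<sigma> (v $ 1)) (\<sigma> (v $ 2)) (\<sigma> (v $ 3)))"
    note S = coordinatewise_semilinear[OF f(1), folded S_def]
    have SS: "inv S (S v) = v" "S (inv S v) = v" for v using S(2) by (simp_all add: bij_is_inj bij_is_surj surj_f_inv_f)
    have \<sigma>: "\<sigma> (inv \<sigma> x) = x" for x using field_automorphismD(6)[OF f(1)] by (simp add: surj_f_inv_f)
    have lin: "Vector_Spaces.linear (*s) (*s) (f \<circ> inv S)"
      using f(2) inv_semilinear[OF f(1) S(1,2)] by (simp add: linear_vec_iff semilinear_def \<sigma>)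
    have bij: "bij (f \<circ> inv S)" by (rule bij_comp[OF bij_imp_bij_inv[OF S(2)] f(3)])
    have im: "(f \<circ> inv S) ` arc_cone (mathon_conics (\<sigma> ` A) (\<sigma> c)) = arc_cone (mathon_conics B d)"
      by (simp add: S(3)[symmetric] image_image SS fc)
    have "\<sigma> ` A \<in> isotropic_spaces" by (rule isotropic_spaces_image[OF A f(1) m])
    hence A': "additive_subgroup (\<sigma> ` A)" "card (\<sigma> ` A) = 8" by (simp_all add: isotropic_spaces_def)
    have B': "additive_subgroup B" "card B = 8" using B by (simp_all add: isotropic_spaces_def)
    have "\<sigma> ` A = B" by (rule mathon_conics_rigid[OF A' B' lin bij im m])
    thus "(A, B) \<in> galois_rel" using A B f(1) by (auto simp: galois_rel_def)
  next
    assume "(A, B) \<in> galois_rel"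
    then obtain \<sigma> where \<sigma>: "field_automorphism \<sigma>" "B = \<sigma> ` A" by (auto simp: galois_rel_def)
    define S where "S = (\<lambda>v :: 'a ^ 3. vec3 (\<sigma> (v $ 1)) (\<sigma> (v $ 2)) (\<sigma> (v $ 3)))"
    note S = coordinatewise_semilinear[OF \<sigma>(1), folded S_def]
    have "(`) S ` mathon_arc A = conics_union (mathon_conics B (\<sigma> c))"
      unfolding K(1) \<sigma>(2) by (simp only: image_conics_union_iff[OF \<sigma>(1) S(1,2)] S(3))
    moreover have "(`) S \<in> PGammaL3" using \<sigma>(1) S unfolding PGammaL3_def by blast
    ultimately have 1: "(mathon_arc A, conics_union (mathon_conics B (\<sigma> c))) \<in> isomorphic"
      unfolding isomorphic_def by blast
    \<comment> \<open>S turns c into \<sigma> c, which need not be the parameter chosen for B; a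
      further linear map corrects this.\<close>
    obtain f where f: "Vector_Spaces.linear (*s) (*s) f" "bij f"
      "(`) f ` conics_union (mathon_conics B (\<sigma> c)) = conics_union (mathon_conics B d)"
      using mathon_conics_twist_equiv unfolding arc_equiv_iff by blast
    have "(conics_union (mathon_conics B (\<sigma> c)), mathon_arc B) \<in> isomorphic"
      using PGL3_I[OF f(1,2)] PGL3_subset f(3) unfolding isomorphic_def K by blast
    with 1 show "(mathon_arc A, mathon_arc B) \<in> isomorphic" by (rule isomorphic_trans)
  qed
qed

lemma equiv_isomorphic: "equiv S (isomorphic \<inter> S \<times> S)" for S :: "'b::{field,finite} point set set"
proof (rule equivI)
  show "isomorphic \<inter> S \<times> S \<subseteq> S \<times> S" by blast
  show "refl_on S (isomorphic \<inter> S \<times> S)" by (rule refl_onI) (simp add: isomorphic_refl)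
  show "sym (isomorphic \<inter> S \<times> S)" by (rule symI) (use isomorphic_sym in blast)
  show "trans (isomorphic \<inter> S \<times> S)" by (rule transI) (use isomorphic_trans in blast)
qed

lemma card_iso_classes:
  assumes m: "m \<ge> 5"
  shows "card (iso_classes (proper_Mathon_arcs 8 :: 'a point set set)) = card (isotropic_spaces // galois_rel)"
  unfolding iso_classes_def
proof (rule card_quotient_transfer[where \<phi> = mathon_arc])
  show "equiv isotropic_spaces galois_rel" by (rule equiv_galois_rel)
  show "equiv (proper_Mathon_arcs 8 :: 'a point set set) (isomorphic \<inter> proper_Mathon_arcs 8 \<times> proper_Mathon_arcs 8)"
    by (rule equiv_isomorphic)
  show "mathon_arc A \<in> proper_Mathon_arcs 8" if "A \<in> isotropic_spaces" for A
    using mathon_arc_proper[OF that m] .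
  show "(mathon_arc A, mathon_arc B) \<in> isomorphic \<inter> proper_Mathon_arcs 8 \<times> proper_Mathon_arcs 8 \<longleftrightarrow> (A, B) \<in> galois_rel"
    if "A \<in> isotropic_spaces" "B \<in> isotropic_spaces" for A B
    using mathon_arc_isomorphic_iff[OF that m] mathon_arc_proper[OF _ m] that by blast
  show "\<exists>A\<in>isotropic_spaces. (mathon_arc A, K) \<in> isomorphic \<inter> proper_Mathon_arcs 8 \<times> proper_Mathon_arcs 8"
    if "K \<in> proper_Mathon_arcs 8" for K
    using proper_Mathon_arc_equiv[OF that] mathon_arc_proper[OF _ m] that by blast
qed

end

theorem theorem4:
  fixes h :: nat and N :: real
  assumes "h \<ge> 1"
    and "prime (2 * h + 1)" and "2 * h + 1 \<noteq> 3" and "2 * h + 1 \<noteq> 7"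
    and "CARD('a::{field,finite}) = 2 ^ (2 * h + 1)"
    and "N = (2 ^ (2 * h) - 1) / (3 * (2 * real h + 1))"
  shows "real (card (iso_classes (proper_Mathon_arcs 8 :: 'a point set set))) =
           N / 14 * (2 ^ (2 * h - 2) - 1) * ((6 * real h + 3) * N - 1)"
proof -
  define m where "m = 2 * h + 1"
  interpret char_two_field "TYPE('a)" m
    by unfold_locales (use assms(5) in \<open>simp_all add: m_def\<close>)
  have m: "prime m" "m \<ge> 5" "m \<noteq> 7" and h: "h \<ge> 2" using assms(1-4) by (auto simp: m_def)
  define n where "n = card (iso_classes (proper_Mathon_arcs 8 :: 'a point set set))"
  obtain j where j: "h = j + 2" using h by (metis add.commute le_Suc_ex)
  \<comment> \<open>K = 2^(2 h - 2), so q = 8 K and the k of \<open>card_isotropic_triples\<close>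
    is 2 K; the exponent is written with j = h - 2 to avoid truncated subtraction.\<close>
  define K :: nat where "K = 4 ^ (j + 1)"
  have K: "K \<ge> 4" by (simp add: K_def)
  have e: "2 * h - 2 = 2 * (j + 1)" "2 * h = 2 * (j + 2)" "m = Suc (2 * (j + 2))" by (simp_all add: j m_def)
  have two_pow: "(2::real) ^ (2 * i) = 4 ^ i" for i by (simp add: power_mult)
  have pow: "2 ^ (2 * h - 2) = real K" "2 ^ (2 * h) = 4 * real K"
    by (simp_all only: e(1) two_pow) (simp_all add: K_def j)
  have card: "(2::nat) ^ m = 4 * (2 * K)"
    unfolding e(3) power_Suc power_mult K_def by simp
  have "168 * (m * n) = 168 * card isotropic_spaces"
    using card_iso_classes[OF m(2)] card_galois_classes[OF m] by (simp add: n_def)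
  also have "\<dots> = (4 * (2 * K) - 2) * ((2 * (2 * K) - 4) * (2 * K - 1))"
    unfolding card_isotropic_triples_spaces[symmetric]
    by (rule card_isotropic_triples) (use card K in simp_all)
  finally have "real (168 * (m * n)) = real ((4 * (2 * K) - 2) * ((2 * (2 * K) - 4) * (2 * K - 1)))" by simp
  hence eq: "168 * (real m * real n) = (8 * real K - 2) * ((4 * real K - 4) * (2 * real K - 1))"
    using K by (simp add: of_nat_diff)
  have N: "N = (4 * real K - 1) / (3 * real m)" using assms(6) pow(2) by (simp add: m_def)
  have m0: "real m \<noteq> 0" using m by simp
  have "(6 * real h + 3) * N = 4 * real K - 1" unfolding N using m0 by (simp add: m_def field_simps)
  hence "N / 14 * (2 ^ (2 * h - 2) - 1) * ((6 * real h + 3) * N - 1) =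
    (4 * real K - 1) / (3 * real m) / 14 * (real K - 1) * (4 * real K - 2)"
    by (simp only: pow(1) N) simp
  \<comment> \<open>Numerator and denominator are multiplied by 4, and 3 * 14 * 4 = 168.\<close>
  also have "\<dots> = (8 * real K - 2) * ((4 * real K - 4) * (2 * real K - 1)) / (168 * real m)"
    using m0 by (simp add: field_simps)
  also have "\<dots> = real n" using m0 by (simp add: eq[symmetric])
  finally show ?thesis by (simp add: n_def)
qed

end
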